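(* For every $c \in \mathfrak{C}_+$ and $P \in \bar{\mathfrak{P}}_+ \setminus \{0\}$ the functional $$\mathbb{J}_P(Q) = \langle c, q \rangle - \int_{\mathbb{T}^d} P(e^{i\boldsymbol{\theta}}) \log Q(e^{i\boldsymbol{\theta}})\, dm(\boldsymbol{\theta}), \qquad Q\in\bar{\mathfrak{P}}_+,$$ is strictly convex and has a unique minimizer $\hat{Q} \in \bar{\mathfrak{P}}_+ \setminus \{0\}$ (over $\bar{\mathfrak P}_+$). Moreover, there exist a unique $\hat{c} \in \partial \mathfrak{C}_+$ and a nonnegative singular measure $d\hat{\mu}$ with support $\mathrm{supp}(d \hat{\mu}) \subseteq \{ \boldsymbol{\theta} \in \mathbb{T}^d \mid \hat{Q}(e^{i\boldsymbol{\theta}}) = 0 \}$ such that $$c_{\mathbf{k}} = \int_{\mathbb{T}^d} e^{i (\mathbf{k},\boldsymbol{\theta})} \left( \frac{P}{\hat Q}\, dm + d \hat{\mu} \right) \quad \text{for all } \mathbf{k} \in \Lambda$$ and $$\hat{c}_{\mathbf{k}} = \int_{\mathbb{T}^d} e^{i (\mathbf{k},\boldsymbol{\theta})}\, d \hat{\mu} \quad \text{for all } \mathbf{k} \in \Lambda.$$ For any such $d\hat{\mu}$, the measure $d\mu(\boldsymbol{\theta}) = (P(e^{i\boldsymbol{\theta}})/\hat{Q}(e^{i\boldsymbol{\theta}}))\,dm(\boldsymbol{\theta}) + d\hat{\mu}(\boldsymbol{\theta})$ is an optimal solution to the problem of maximizing $$\mathbb{I}_P(d\mu) = \int_{\mathbb{T}^d}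 P(e^{i\boldsymbol{\theta}}) \log \Phi(e^{i\boldsymbol{\theta}})\, dm(\boldsymbol{\theta})$$ over nonnegative bounded measures $d\mu=\Phi\,dm+d\hat\mu$ on $\mathbb{T}^d$ (with $\Phi\,dm$ the absolutely continuous part and $d\hat\mu$ the singular part of $d\mu$) subject to the moment constraints $c_{\mathbf{k}} = \int_{\mathbb{T}^d} e^{i(\mathbf{k},\boldsymbol{\theta})}\,d\mu(\boldsymbol{\theta})$ for all $\mathbf{k}\in\Lambda$. Moreover, $d \hat{\mu}$ can be chosen with support in at most $|\Lambda|-1$ points.
   Context: Let $d\ge 1$, $\mathbb{T}=(-\pi,\pi]$ (functions on $\mathbb{T}^d$ are regarded as periodic), $\boldsymbol{\theta}=(\theta_1,\dots,\theta_d)$, $e^{i\boldsymbol{\theta}}=(e^{i\theta_1},\dots,e^{i\theta_d})$, $(\mathbf{k},\boldsymbol{\theta})=\sum_{j=1}^d k_j\theta_j$, and $dm(\boldsymbol{\theta})=(1/2\pi)^d\prod_{j=1}^d d\theta_j$. The index set $\Lambda\subset\mathbb{Z}^d$ is finite with $0\in\Lambda$ and $-\Lambda=\Lambda$; $|\Lambda|$ is its cardinality. Trigonometric polynomials are $P(e^{i\boldsymbol{\theta}})=\sum_{\mathbf{k}\in\Lambda}p_{\mathbf{k}}e^{-i(\mathbf{k},\boldsymbol{\theta})}$ with $p_{-\mathbf{k}}=\bar p_{\mathbf{k}}$ (real valued), identified with their coefficient vector $p=(p_{\mathbf{k}})_{\mathbf{k}\in\Lambda}$ (similarly $Q\leftrightarrow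 q$). $\mathfrak{P}_+$ is the convex cone of such polynomials that are positive for all $\boldsymbol{\theta}\in\mathbb{T}^d$; $\bar{\mathfrak{P}}_+$ is its closure (nonnegative polynomials). Sequences $c=(c_{\mathbf{k}})_{\mathbf{k}\in\Lambda}$ are complex with $c_{-\mathbf{k}}=\bar c_{\mathbf{k}}$; $\langle c,p\rangle=\sum_{\mathbf{k}\in\Lambda}c_{\mathbf{k}}\bar p_{\mathbf{k}}$. $\mathfrak{C}_+=\{c\mid\langle c,p\rangle>0\text{ for all }P\in\bar{\mathfrak{P}}_+\setminus\{0\}\}$, an open convex cone, with closure $\bar{\mathfrak{C}}_+$ and boundary $\partial\mathfrak{C}_+=\bar{\mathfrak C}_+\setminus\mathfrak{C}_+$. By convention $\mathbb{J}_P(Q)=+\infty$ for $Q\equiv0$. "Singular" is with respect to $dm$. *)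

theory Defs
  imports "HOL-Analysis.Analysis"
begin

section \<open>Trigonometric polynomials and their coefficient vectors\<close>

definition torus :: "(real ^ 'd) set" where
  "torus = {\<theta>. \<forall>j. - pi < \<theta> $ j \<and> \<theta> $ j \<le> pi}"

definition phase :: "int ^ 'd \<Rightarrow> real ^ 'd \<Rightarrow> real" where
  "phase k \<theta> = (\<Sum>j\<in>UNIV. of_int (k $ j) * \<theta> $ j)"

text \<open>
  A family \<open>(p\<^sub>k)\<close> indexed by \<open>\<Lambda>\<close> is a function on all of \<open>int ^ 'd\<close> vanishing off \<open>\<Lambda>\<close>, so that
  equality of functions is equality of families, and the product topology on functions
  restricts to the usual topology of the finite-dimensional space of families.
\<close>

definition hermitian :: "(int ^ 'd) set \<Rightarrow> (int ^ 'd \<Rightarrow> complex) set" where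
  "hermitian \<Lambda> = {p. (\<forall>k\<in>\<Lambda>. p (- k) = cnj (p k)) \<and> (\<forall>k. k \<notin> \<Lambda> \<longrightarrow> p k = 0)}"

text \<open>
  For hermitian coefficients the sums under \<open>Re\<close> in the next two definitions are already real;
  see \<open>of_real_trig_poly\<close> and \<open>of_real_pairing\<close> below.
\<close>

definition trig_poly :: "(int ^ 'd) set \<Rightarrow> (int ^ 'd \<Rightarrow> complex) \<Rightarrow> real ^ 'd \<Rightarrow> real" where
  "trig_poly \<Lambda> p \<theta> = Re (\<Sum>k\<in>\<Lambda>. p k * cis (- phase k \<theta>))"

definition pairing :: "(int ^ 'd) set \<Rightarrow> (int ^ 'd \<Rightarrow> complex) \<Rightarrow> (int ^ 'd \<Rightarrow> complex) \<Rightarrow> real" where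
  "pairing \<Lambda> c p = Re (\<Sum>k\<in>\<Lambda>. c k * cnj (p k))"

definition pos_polys :: "(int ^ 'd) set \<Rightarrow> (int ^ 'd \<Rightarrow> complex) set" where
  "pos_polys \<Lambda> = {p \<in> hermitian \<Lambda>. \<forall>\<theta>\<in>torus. trig_poly \<Lambda> p \<theta> > 0}"

definition nonneg_polys :: "(int ^ 'd) set \<Rightarrow> (int ^ 'd \<Rightarrow> complex) set" where
  "nonneg_polys \<Lambda> = closure (pos_polys \<Lambda>)"

definition dual_cone :: "(int ^ 'd) set \<Rightarrow> (int ^ 'd \<Rightarrow> complex) set" where
  "dual_cone \<Lambda> = {c \<in> hermitian \<Lambda>. \<forall>p \<in> nonneg_polys \<Lambda> - {\<lambda>_. 0}. pairing \<Lambda> c p > 0}"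

text \<open>
  The boundary is relative to the space \<open>hermitian \<Lambda>\<close>, in which \<open>dual_cone \<Lambda>\<close> is open;
  \<open>frontier\<close> would instead refer to the space of all functions.
\<close>

definition dual_boundary :: "(int ^ 'd) set \<Rightarrow> (int ^ 'd \<Rightarrow> complex) set" where
  "dual_boundary \<Lambda> = closure (dual_cone \<Lambda>) - dual_cone \<Lambda>"


section \<open>Measures on the torus\<close>

definition torus_measure :: "(real ^ 'd) measure" where
  "torus_measure = scale_measure (ennreal ((1 / (2 * pi)) ^ CARD('d))) (restrict_space lborel torus)"

definition bounded_measures :: "(real ^ 'd) measure set" where
  "bounded_measures = {\<mu>. sets \<mu> = sets torus_measure \<and> finite_measure \<mu>}"

definition measure_add :: "'a measure \<Rightarrow> 'a measure \<Rightarrow> 'a measure" where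
  "measure_add M N = measure_of (space M) (sets M) (\<lambda>A. emeasure M A + emeasure N A)"

definition singular_measure :: "(real ^ 'd) measure \<Rightarrow> bool" where
  "singular_measure \<nu> \<longleftrightarrow>
     (\<exists>N \<in> null_sets torus_measure. emeasure \<nu> (space torus_measure - N) = 0)"

text \<open>
  Closed support with respect to the topology of the torus as a quotient of \<open>real ^ 'd\<close>: basic
  neighbourhoods of a point are the images of its open neighbourhoods under reduction modulo \<open>2 * pi\<close>.
\<close>

definition measure_supp :: "(real ^ 'd) measure \<Rightarrow> (real ^ 'd) set" where
  "measure_supp \<mu> = {\<theta>\<in>torus. \<forall>U. open U \<and> \<theta> \<in> U \<longrightarrow>
     emeasure \<mu> {\<phi>\<in>torus. \<exists>n :: int ^ 'd. (\<chi> j. \<phi> $ j + 2 * pi * of_int (n $ j)) \<in> U} > 0}"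

definition has_moments ::
    "(int ^ 'd) set \<Rightarrow> (real ^ 'd) measure \<Rightarrow> (int ^ 'd \<Rightarrow> complex) \<Rightarrow> bool" where
  "has_moments \<Lambda> \<mu> c \<longleftrightarrow>
     \<mu> \<in> bounded_measures \<and> (\<forall>k\<in>\<Lambda>. c k = (LINT \<theta>|\<mu>. cis (phase k \<theta>)))"

definition lebesgue_decomp ::
    "(real ^ 'd) measure \<Rightarrow> (real ^ 'd \<Rightarrow> real) \<Rightarrow> (real ^ 'd) measure \<Rightarrow> bool" where
  "lebesgue_decomp \<mu> \<Phi> \<nu> \<longleftrightarrow>
     \<Phi> \<in> borel_measurable torus_measure \<and> (\<forall>\<theta>. \<Phi> \<theta> \<ge> 0) \<and>
     sets \<nu> = sets torus_measure \<and> singular_measure \<nu> \<and>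
     \<mu> = measure_add (density torus_measure (\<lambda>\<theta>. ennreal (\<Phi> \<theta>))) \<nu>"

definition ac_density :: "(real ^ 'd) measure \<Rightarrow> real ^ 'd \<Rightarrow> real" where
  "ac_density \<mu> = (SOME \<Phi>. \<exists>\<nu>. lebesgue_decomp \<mu> \<Phi> \<nu>)"


section \<open>The two functionals\<close>

definition ext_integral :: "'a measure \<Rightarrow> ('a \<Rightarrow> ereal) \<Rightarrow> ereal" where
  "ext_integral M f =
     enn2ereal (\<integral>\<^sup>+x. e2ennreal (f x) \<partial>M) - enn2ereal (\<integral>\<^sup>+x. e2ennreal (- f x) \<partial>M)"

text \<open>
  The value at \<open>0\<close> matters: the density of a competing measure may vanish on a set of positive
  measure, in which case the primal functional is \<open>-\<infinity>\<close>, whereas \<open>ln 0 = 0\<close>.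
  Note that \<open>0 * (-\<infinity>) = 0\<close> in \<open>ereal\<close>.
\<close>

definition ext_ln :: "real \<Rightarrow> ereal" where
  "ext_ln x = (if x \<le> 0 then -\<infinity> else ereal (ln x))"

definition dual_functional ::
    "(int ^ 'd) set \<Rightarrow> (int ^ 'd \<Rightarrow> complex) \<Rightarrow> (int ^ 'd \<Rightarrow> complex) \<Rightarrow> (int ^ 'd \<Rightarrow> complex) \<Rightarrow> ereal"
  where
  "dual_functional \<Lambda> c p q =
     (if q = (\<lambda>_. 0) then \<infinity>
      else ereal (pairing \<Lambda> c q) -
        ext_integral torus_measure (\<lambda>\<theta>. ereal (trig_poly \<Lambda> p \<theta>) * ext_ln (trig_poly \<Lambda> q \<theta>)))"

definition primal_functional ::
    "(int ^ 'd) set \<Rightarrow> (int ^ 'd \<Rightarrow> complex) \<Rightarrow> (real ^ 'd) measure \<Rightarrow> ereal" where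
  "primal_functional \<Lambda> p \<mu> =
     ext_integral torus_measure (\<lambda>\<theta>. ereal (trig_poly \<Lambda> p \<theta>) * ext_ln (ac_density \<mu> \<theta>))"

definition strictly_convex_on ::
    "('i \<Rightarrow> complex) set \<Rightarrow> (('i \<Rightarrow> complex) \<Rightarrow> ereal) \<Rightarrow> bool" where
  "strictly_convex_on S f \<longleftrightarrow>
     (\<forall>x\<in>S. \<forall>y\<in>S. \<forall>t::real. x \<noteq> y \<longrightarrow> 0 < t \<longrightarrow> t < 1 \<longrightarrow>
        f (\<lambda>i. of_real (1 - t) * x i + of_real t * y i) < ereal (1 - t) * f x + ereal t * f y)"

definition spectral_measure ::
    "(int ^ 'd) set \<Rightarrow> (int ^ 'd \<Rightarrow> complex) \<Rightarrow> (int ^ 'd \<Rightarrow> complex) \<Rightarrow> (real ^ 'd) measure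
      \<Rightarrow> (real ^ 'd) measure" where
  "spectral_measure \<Lambda> p q \<nu> =
     measure_add (density torus_measure (\<lambda>\<theta>. ennreal (trig_poly \<Lambda> p \<theta> / trig_poly \<Lambda> q \<theta>))) \<nu>"

definition singular_part_for ::
    "(int ^ 'd) set \<Rightarrow> (int ^ 'd \<Rightarrow> complex) \<Rightarrow> (int ^ 'd \<Rightarrow> complex) \<Rightarrow> (int ^ 'd \<Rightarrow> complex)
      \<Rightarrow> (int ^ 'd \<Rightarrow> complex) \<Rightarrow> (real ^ 'd) measure \<Rightarrow> bool" where
  "singular_part_for \<Lambda> c p q c' \<nu> \<longleftrightarrow>
     \<nu> \<in> bounded_measures \<and> singular_measure \<nu> \<and>
     measure_supp \<nu> \<subseteq> {\<theta>\<in>torus. trig_poly \<Lambda> q \<theta> = 0} \<and>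
     has_moments \<Lambda> (spectral_measure \<Lambda> p q \<nu>) c \<and>
     has_moments \<Lambda> \<nu> c'"


section \<open>Consistency of the definitions\<close>

lemma sum_reflect:
  fixes f :: "int ^ 'd \<Rightarrow> 'b::comm_monoid_add"
  assumes "uminus ` \<Lambda> = \<Lambda>"
  shows "(\<Sum>k\<in>\<Lambda>. f (- k)) = (\<Sum>k\<in>\<Lambda>. f k)"
proof -
  have "(\<Sum>k\<in>uminus ` \<Lambda>. f k) = (\<Sum>k\<in>\<Lambda>. f (- k))"
    by (subst sum.reindex) (auto simp: inj_on_def)
  with assms show ?thesis by simp
qed

lemma phase_uminus: "phase (- k) \<theta> = - phase k \<theta>"
  by (simp add: phase_def sum_negf)

lemma real_of_cnj_eq: "cnj z = z \<Longrightarrow> complex_of_real (Re z) = z"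
  by (metis Reals_cnj_iff complex_is_Real_iff of_real_Re)

lemma of_real_trig_poly:
  assumes "uminus ` \<Lambda> = \<Lambda>" and "p \<in> hermitian \<Lambda>"
  shows "complex_of_real (trig_poly \<Lambda> p \<theta>) = (\<Sum>k\<in>\<Lambda>. p k * cis (- phase k \<theta>))"
proof -
  have "cnj (\<Sum>k\<in>\<Lambda>. p k * cis (- phase k \<theta>)) = (\<Sum>k\<in>\<Lambda>. p (- k) * cis (- phase (- k) \<theta>))"
    unfolding cnj_sum
    using assms(2) by (intro sum.cong) (auto simp: hermitian_def cis_cnj phase_uminus)
  also have "\<dots> = (\<Sum>k\<in>\<Lambda>. p k * cis (- phase k \<theta>))"
    by (rule sum_reflect[OF assms(1)])
  finally show ?thesis
    unfolding trig_poly_def by (rule real_of_cnj_eq)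
qed

lemma of_real_pairing:
  assumes "uminus ` \<Lambda> = \<Lambda>" and "c \<in> hermitian \<Lambda>" and "p \<in> hermitian \<Lambda>"
  shows "complex_of_real (pairing \<Lambda> c p) = (\<Sum>k\<in>\<Lambda>. c k * cnj (p k))"
proof -
  have "cnj (\<Sum>k\<in>\<Lambda>. c k * cnj (p k)) = (\<Sum>k\<in>\<Lambda>. c (- k) * cnj (p (- k)))"
    unfolding cnj_sum
    using assms(2,3) by (intro sum.cong) (auto simp: hermitian_def)
  also have "\<dots> = (\<Sum>k\<in>\<Lambda>. c k * cnj (p k))"
    by (rule sum_reflect[OF assms(1)])
  finally show ?thesis
    unfolding pairing_def by (rule real_of_cnj_eq)
qed

lemma space_torus_measure: "space torus_measure = torus"
  by (simp add: torus_measure_def space_scale_measure space_restrict_space)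

lemma emeasure_measure_add:
  assumes "sets N = sets M" and "A \<in> sets M"
  shows "emeasure (measure_add M N) A = emeasure M A + emeasure N A"
proof -
  have "countably_additive (sets M) (\<lambda>A. emeasure M A + emeasure N A)"
    by (auto simp: countably_additive_def assms(1) suminf_add[symmetric] suminf_emeasure)
  then show ?thesis
    unfolding measure_add_def using assms(2)
    by (intro emeasure_measure_of_sigma) (auto simp: positive_def sets.sigma_algebra_axioms)
qed

lemma nonneg_polys_iff:
  fixes \<Lambda> :: "(int ^ 'd) set"
  assumes "finite \<Lambda>" and "0 \<in> \<Lambda>"
  shows "p \<in> nonneg_polys \<Lambda> \<longleftrightarrow> p \<in> hermitian \<Lambda> \<and> (\<forall>\<theta>\<in>torus. trig_poly \<Lambda> p \<theta> \<ge> 0)"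
proof -
  define C :: "(int ^ 'd \<Rightarrow> complex) set" where
    "C = (\<Inter>k\<in>\<Lambda>. {p. p (- k) = cnj (p k)}) \<inter> (\<Inter>k\<in>- \<Lambda>. {p. p k = 0}) \<inter>
       (\<Inter>\<theta>\<in>torus. {p. 0 \<le> trig_poly \<Lambda> p \<theta>})"
  have C: "p \<in> C \<longleftrightarrow> p \<in> hermitian \<Lambda> \<and> (\<forall>\<theta>\<in>torus. trig_poly \<Lambda> p \<theta> \<ge> 0)" for p
    by (auto simp: C_def hermitian_def)
  have ev: "continuous_on UNIV (\<lambda>p :: int ^ 'd \<Rightarrow> complex. p k)" for k
    by (rule continuous_on_product_coordinates)
  have "closed C"
    unfolding C_def trig_poly_def
    by (intro closed_Int closed_INT ballI closed_Collect_eq closed_Collect_le continuous_intros ev)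
  then have "nonneg_polys \<Lambda> \<subseteq> C"
    unfolding nonneg_polys_def
    by (rule closure_minimal[rotated]) (auto simp: C pos_polys_def less_imp_le)
  moreover have "p \<in> nonneg_polys \<Lambda>" if p: "p \<in> C" for p
  proof -
    define f where "f n k = p k + (if k = 0 then of_real (inverse (real (Suc n))) else 0)" for n k
    have "trig_poly \<Lambda> (f n) \<theta> = trig_poly \<Lambda> p \<theta> + inverse (real (Suc n))" for n \<theta>
    proof -
      have "f n k * cis (- phase k \<theta>) = p k * cis (- phase k \<theta>) +
          (if k = 0 then of_real (inverse (real (Suc n))) else 0)" for k
        by (simp add: f_def phase_def distrib_right)
      then have "(\<Sum>k\<in>\<Lambda>. f n k * cis (- phase k \<theta>)) =
          (\<Sum>k\<in>\<Lambda>. p k * cis (- phase k \<theta>)) + of_real (inverse (real (Suc n)))"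
        using assms by (simp only: sum.distrib) simp
      then show ?thesis
        by (simp add: trig_poly_def del: of_real_inverse)
    qed
    moreover have "f n \<in> hermitian \<Lambda>" for n
      using p assms by (auto simp: C hermitian_def f_def)
    ultimately have "f n \<in> pos_polys \<Lambda>" for n
      using p by (auto simp: pos_polys_def C intro!: add_nonneg_pos)
    moreover have "f \<longlonglongrightarrow> p"
    proof -
      have "(\<lambda>n. f n k) \<longlonglongrightarrow> p k" for k
      proof (cases "k = 0")
        case True
        have "(\<lambda>n. p k + complex_of_real (inverse (real (Suc n)))) \<longlonglongrightarrow> p k + of_real 0"
          by (intro tendsto_intros LIMSEQ_inverse_real_of_nat)
        with True show ?thesis by (simp add: f_def)
      qed (simp add: f_def)
      then show ?thesis
        using limitin_componentwise[of "\<lambda>_. euclidean" UNIV f p sequentially]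
        by (simp add: euclidean_product_topology)
    qed
    ultimately show ?thesis
      unfolding nonneg_polys_def
      by (rule_tac closed_sequentially[OF closed_closure, of f]) (auto intro: subsetD[OF closure_subset])
  qed
  ultimately show ?thesis
    using C by blast
qed

end

theory Submission
  imports Defs "HOL-Computational_Algebra.Fundamental_Theorem_Algebra"
begin

text \<open>
  The logarithm of a nonzero trigonometric polynomial is integrable: on lines in a generic integer direction
  it is a polynomial in \<open>cis s\<close> whose leading coefficient has constant modulus, and \<open>log |cis s - z|\<close>
  is integrable uniformly in \<open>z\<close>. Hence the dual functional is finite and strictly convex away from 0.
  Minimising it first along half-lines leaves a lower semicontinuous functional on a compact base of the
  cone, which yields the minimiser \<open>Q\<close> together with \<open>\<langle>c, q\<rangle> = \<integral> P\<close>. The first variation towards \<open>R\<close> gives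
  \<open>\<integral> P R / Q \<le> \<langle>c, r\<rangle>\<close>, so that \<open>c\<close> minus the moments of \<open>P / Q\<close> lies in the closed dual cone and is
  orthogonal to \<open>q\<close>. It is therefore a nonnegative combination of point evaluations at zeros of \<open>Q\<close>, and
  Caratheodory's theorem in the hyperplane orthogonal to \<open>q\<close> bounds the number of points by \<open>|\<Lambda>| - 1\<close>.
  Optimality for the primal problem follows by integrating
  \<open>P log \<Phi> \<le> P log (P / Q) + \<Phi> Q - P\<close>.
\<close>

section \<open>Integrability of the logarithm of a trigonometric polynomial\<close>

text \<open>The shaping obstacle is that the minimiser \<open>Q\<close> may lie on the boundary of
  the cone, that is, vanish somewhere on the torus. Then \<open>P / Q\<close> is not known in
  advance to be integrable and no dominating function is at hand, so limits pass through Fatou's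
  lemma and only one-sided variations \<open>Q + R / n\<close> are used; the choice
  \<open>R = 1\<close> is what yields integrability of \<open>P / Q\<close>. Only the rescaling of
  \<open>Q\<close> itself can be varied in both directions, and it gives an equality instead of an
  inequality. The defect in the one-sided inequalities is exactly the moment vector of the singular
  part. Its orthogonality to \<open>q\<close> is complementary slackness. For d > 1 the zero set of
  \<open>Q\<close> need not be finite; the estimate along lines requires no knowledge of it.
  Uniqueness concerns the moment vector alone, which is determined by \<open>c\<close>,
  \<open>P\<close> and \<open>Q\<close>; nothing is claimed about uniqueness of the singular
  measure. The torus is half-open, hence not compact; closest moment vectors are therefore sought
  over the closed cube, and the atoms are moved back afterwards.\<close>

definition neg_log :: "real \<Rightarrow> ennreal" where
  "neg_log y = e2ennreal (- ext_ln y)"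

text \<open>The infinite value is deliberate: with \<open>ln 0 = 0\<close> a finite integral would
  say nothing about zeros, whereas a finite integral of \<open>neg_log\<close> also shows that the
  zero set is null.\<close>

lemma neg_log_nonpos: "y \<le> 0 \<Longrightarrow> neg_log y = \<infinity>"
  by (simp add: neg_log_def ext_ln_def)

lemma neg_log_pos: "y > 0 \<Longrightarrow> neg_log y = ennreal (- ln y)"
  by (simp add: neg_log_def ext_ln_def ennreal.abs_eq)

text \<open>\<open>neg_log\<close> is the positive part of minus the logarithm, and positive parts
  are subadditive. This allows the linear factors of a polynomial to be estimated one at a
  time.\<close>

lemma neg_log_mult:
  assumes "x \<ge> 0" "y \<ge> 0"
  shows "neg_log (x * y) \<le> neg_log x + neg_log y"
proof (cases "x = 0 \<or> y = 0")
  case True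
  then show ?thesis by (auto simp: neg_log_nonpos)
next
  case False
  then have "x > 0" "y > 0" using assms by auto
  then show ?thesis
    by (simp add: neg_log_pos ln_mult ennreal_plus_if ennreal_leI)
qed

lemma neg_log_antimono: "x \<le> y \<Longrightarrow> neg_log y \<le> neg_log x"
  by (cases "x \<le> 0") (auto simp: neg_log_nonpos neg_log_pos intro: ennreal_leI)

text \<open>This is \<open>ln u \<le> u - 1\<close> at \<open>u = 1 / sqrt y\<close>; the square
  root makes the singularity on the right integrable.\<close>

lemma neg_log_le_inverse_sqrt:
  assumes "y > 0"
  shows "neg_log y \<le> ennreal (2 / sqrt y)"
proof -
  have "ln (1 / sqrt y) \<le> 1 / sqrt y - 1"
    using assms by (intro ln_le_minus_one) simp
  also have "ln (1 / sqrt y) = - ln y / 2"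
    using assms by (simp add: ln_div ln_sqrt)
  finally have "- ln y \<le> 2 / sqrt y" by simp
  then show ?thesis using assms by (simp add: neg_log_pos ennreal_leI)
qed

lemma measurable_neg_log [measurable]: "neg_log \<in> borel_measurable borel"
proof -
  have "neg_log = (\<lambda>y. if y \<le> 0 then \<infinity> else ennreal (- ln y))"
    by (auto simp: neg_log_pos neg_log_nonpos)
  also have "\<dots> \<in> borel_measurable borel" by measurable
  finally show ?thesis .
qed

lemma neg_log_finite: "y > 0 \<Longrightarrow> neg_log y < \<infinity>"
  by (simp add: neg_log_pos)

section \<open>Uniform logarithmic bounds on an arc of the unit circle\<close>

lemma nn_integral_inverse_sqrt:
  "(\<integral>\<^sup>+u. ennreal (indicator {0..1} u * (1 / sqrt u)) \<partial>lborel) = 2"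
proof -
  have "((\<lambda>u::real. 1 / sqrt u) has_integral (2 * sqrt 1 - 2 * sqrt 0)) {0..1}"
  proof (rule fundamental_theorem_of_calculus_interior)
    show "((\<lambda>u. 2 * sqrt u) has_vector_derivative 1 / sqrt x) (at x)" if "x \<in> {0<..<1}" for x :: real
      using that
      by (auto intro!: derivative_eq_intros simp: has_real_derivative_iff_has_vector_derivative[symmetric] field_simps)
  qed (auto intro!: continuous_intros)
  then have "((\<lambda>u::real. 1 / sqrt u) has_integral 2) {0..1}" by simp
  then show ?thesis
    using nn_integral_has_integral_lebesgue[of "{0..1}" "\<lambda>u. 1 / sqrt u" 2] by simp
qed

lemma nn_integral_inverse_sqrt_abs:
  "(\<integral>\<^sup>+u. ennreal (indicator {-1..1} u * (1 / sqrt \<bar>u\<bar>)) \<partial>lborel) \<le> 4"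
proof -
  let ?g = "\<lambda>u::real. ennreal (indicator {0..1} u * (1 / sqrt u))"
  have "(\<integral>\<^sup>+u. ennreal (indicator {-1..1} u * (1 / sqrt \<bar>u\<bar>)) \<partial>lborel) \<le> (\<integral>\<^sup>+u. ?g u + ?g (- u) \<partial>lborel)"
    by (intro nn_integral_mono) (auto simp: indicator_def)
  also have "\<dots> = (\<integral>\<^sup>+u. ?g u \<partial>lborel) + (\<integral>\<^sup>+u. ?g (- u) \<partial>lborel)"
    by (intro nn_integral_add) auto
  also have "(\<integral>\<^sup>+u. ?g (- u) \<partial>lborel) = (\<integral>\<^sup>+u. ?g u \<partial>lborel)"
    using nn_integral_real_affine[of ?g "-1" 0] by simp
  finally show ?thesis by (simp only: nn_integral_inverse_sqrt) simp
qed

text \<open>Since \<open>1 < pi / 3\<close>, the cosine is at least 1/2 on \<open>{0..1}\<close>,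
  and the mean value theorem for \<open>sin\<close> bounds the vertical part of the chord from
  below. Working on an arc of length one instead of the full circle is what makes so simple a bound
  possible.\<close>

lemma dist_cis_ge:
  assumes "s \<in> {0..1}" "t \<in> {0..1}"
  shows "\<bar>s - t\<bar> / 2 \<le> cmod (cis s - cis t)"
proof -
  have half: "cos x \<ge> 1 / 2" if "0 \<le> x" "x \<le> 1" for x :: real
  proof -
    have "cos (pi / 3) \<le> cos x"
      using that pi_gt3 by (intro cos_monotone_0_pi_le) auto
    then show ?thesis by (simp add: cos_60)
  qed
  have main: "(b - a) / 2 \<le> sin b - sin a" if "0 \<le> a" "a \<le> b" "b \<le> 1" for a b :: real
  proof (cases "a = b")
    case False
    then have "a < b" using that by simp
    then obtain z where z: "a < z" "z < b" "sin b - sin a = (b - a) * cos z"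
      using MVT2[of a b sin cos] DERIV_sin by blast
    then show ?thesis
      using mult_left_mono[OF half[of z], of "b - a"] that by auto
  qed simp
  have "\<bar>s - t\<bar> / 2 \<le> \<bar>sin s - sin t\<bar>"
    using main[of s t] main[of t s] assms by (cases "s \<le> t") auto
  also have "\<dots> = \<bar>Im (cis s - cis t)\<bar>" by simp
  also have "\<dots> \<le> cmod (cis s - cis t)" by (rule abs_Im_le_cmod)
  finally show ?thesis .
qed

text \<open>Uniformity in \<open>z\<close> comes from comparison with the point
  \<open>cis s0\<close> of the arc nearest to \<open>z\<close>: the triangle inequality bounds the
  distance to \<open>z\<close> below by \<open>\<bar>s - s0\<bar> / 4\<close>. The constant is 4 *
  4: the integrand is at most \<open>4 / sqrt \<bar>s - s0\<bar>\<close>, and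
  \<open>1 / sqrt \<bar>u\<bar>\<close> has integral at most 4 over \<open>{-1..1}\<close>.\<close>

lemma nn_integral_neg_log_cis_le:
  "(\<integral>\<^sup>+s. neg_log (cmod (cis s - z)) * indicator {0..1} s \<partial>lborel) \<le> 16"
proof -
  have "\<exists>s0\<in>{0..1}. \<forall>s\<in>{0..1}. cmod (cis s0 - z) \<le> cmod (cis s - z)"
    by (rule continuous_attains_inf) (auto intro!: continuous_intros)
  then obtain s0 where s0: "s0 \<in> {0..1}" "\<And>s. s \<in> {0..1} \<Longrightarrow> cmod (cis s0 - z) \<le> cmod (cis s - z)"
    by blast
  have ge: "\<bar>s - s0\<bar> / 4 \<le> cmod (cis s - z)" if "s \<in> {0..1}" for s
  proof -
    have "\<bar>s - s0\<bar> / 2 \<le> cmod (cis s - cis s0)"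
      using that s0 by (intro dist_cis_ge) auto
    also have "\<dots> \<le> cmod (cis s - z) + cmod (cis s0 - z)"
      using norm_triangle_ineq4[of "cis s - z" "cis s0 - z"] by simp
    also have "\<dots> \<le> 2 * cmod (cis s - z)"
      using s0(2)[OF that] by simp
    finally show ?thesis by simp
  qed
  let ?h = "\<lambda>u::real. ennreal 4 * ennreal (indicator {-1..1} u * (1 / sqrt \<bar>u\<bar>))"
  have "(\<integral>\<^sup>+s. neg_log (cmod (cis s - z)) * indicator {0..1} s \<partial>lborel) \<le> (\<integral>\<^sup>+s. ?h (- s0 + 1 * s) \<partial>lborel)"
  proof (rule nn_integral_mono_AE)
    have "AE s in lborel. s \<noteq> s0" by (rule AE_lborel_singleton)
    then show "AE s in lborel. neg_log (cmod (cis s - z)) * indicator {0..1} s \<le> ?h (- s0 + 1 * s)"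
    proof eventually_elim
      case (elim s)
      show ?case
      proof (cases "s \<in> {0..1}")
        case True
        have "neg_log (cmod (cis s - z)) \<le> neg_log (\<bar>s - s0\<bar> / 4)"
          by (rule neg_log_antimono[OF ge[OF True]])
        also have "\<dots> \<le> ennreal (2 / sqrt (\<bar>s - s0\<bar> / 4))"
          using elim by (intro neg_log_le_inverse_sqrt) auto
        also have "2 / sqrt (\<bar>s - s0\<bar> / 4) = 4 * (1 / sqrt \<bar>s - s0\<bar>)"
          by (simp add: real_sqrt_divide)
        also have "ennreal \<dots> = ?h (- s0 + 1 * s)"
          using True s0(1) by (simp add: ennreal_mult'[symmetric] indicator_def flip: ennreal_numeral)
        finally show ?thesis using True by simp
      qed simp
    qed
  qed
  also have "\<dots> = (\<integral>\<^sup>+u. ?h u \<partial>lborel)"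
    by (subst (2) nn_integral_real_affine[where c=1 and t="- s0"]) auto
  also have "\<dots> = 4 * (\<integral>\<^sup>+u. ennreal (indicator {-1..1} u * (1 / sqrt \<bar>u\<bar>)) \<partial>lborel)"
    by (simp add: nn_integral_cmult)
  also have "\<dots> \<le> 4 * 4"
    by (intro mult_left_mono nn_integral_inverse_sqrt_abs) simp
  finally show ?thesis by simp
qed

text \<open>Splitting into linear factors costs 16 per root wherever the root lies. The bound sees
  only the degree and the modulus of the leading coefficient, which is what makes it uniform over
  parallel lines.\<close>

lemma nn_integral_neg_log_poly_le:
  fixes f :: "complex poly"
  assumes "f \<noteq> 0"
  shows "(\<integral>\<^sup>+s. neg_log (cmod (poly f (cis s))) * indicator {0..1} s \<partial>lborel)
    \<le> neg_log (cmod (lead_coeff f)) + 16 * of_nat (degree f)"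
proof -
  obtain A where A: "size A = degree f" "f = smult (lead_coeff f) (\<Prod>x\<in>#A. [:- x, 1:])"
    using alg_closed_imp_factorization[OF assms] by blast
  have meas [measurable]: "(\<lambda>s. neg_log (cmod (poly f (cis s)))) \<in> borel_measurable borel" for f
    by (intro measurable_compose[OF _ measurable_neg_log] borel_measurable_continuous_onI continuous_intros)
  have "(\<integral>\<^sup>+s. neg_log (cmod (poly (smult a (\<Prod>x\<in>#A. [:- x, 1:])) (cis s))) * indicator {0..1} s \<partial>lborel)
      \<le> neg_log (cmod a) + 16 * of_nat (size A)" for a
  proof (induction A)
    case empty
    then show ?case by (simp add: nn_integral_cmult_indicator)
  next
    case (add x A)
    let ?g = "smult a (\<Prod>x\<in>#A. [:- x, 1:])"
    have "(\<integral>\<^sup>+s. neg_log (cmod (poly (smult a (\<Prod>x\<in>#add_mset x A. [:- x, 1:])) (cis s))) * indicator {0..1} s \<partial>lborel)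
        \<le> (\<integral>\<^sup>+s. neg_log (cmod (cis s - x)) * indicator {0..1} s + neg_log (cmod (poly ?g (cis s))) * indicator {0..1} s \<partial>lborel)"
    proof (rule nn_integral_mono)
      fix s
      have "cmod (poly (smult a (\<Prod>x\<in>#add_mset x A. [:- x, 1:])) (cis s)) = cmod (cis s - x) * cmod (poly ?g (cis s))"
        by (simp add: norm_mult[symmetric] algebra_simps)
      then show "neg_log (cmod (poly (smult a (\<Prod>x\<in>#add_mset x A. [:- x, 1:])) (cis s))) * indicator {0..1} s
          \<le> neg_log (cmod (cis s - x)) * indicator {0..1} s + neg_log (cmod (poly ?g (cis s))) * indicator {0..1} s"
        using neg_log_mult[of "cmod (cis s - x)" "cmod (poly ?g (cis s))"]
        by (simp add: indicator_def)
    qed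
    also have "\<dots> = (\<integral>\<^sup>+s. neg_log (cmod (cis s - x)) * indicator {0..1} s \<partial>lborel) +
        (\<integral>\<^sup>+s. neg_log (cmod (poly ?g (cis s))) * indicator {0..1} s \<partial>lborel)"
      using meas[of "[:-x, 1:]"] meas[of ?g]
      by (intro nn_integral_add borel_measurable_times_ennreal) simp_all
    also have "\<dots> \<le> 16 + (neg_log (cmod a) + 16 * of_nat (size A))"
      by (intro add_mono nn_integral_neg_log_cis_le add.IH)
    also have "\<dots> = neg_log (cmod a) + 16 * of_nat (size (add_mset x A))"
      by (simp add: distrib_left add_ac)
    finally show ?case .
  qed
  from this[of "lead_coeff f"] show ?thesis
    unfolding A(1) A(2)[symmetric] .
qed

section \<open>Generic integer directions\<close>

lemma finite_int_avoid:
  fixes a b :: "'i \<Rightarrow> int"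
  assumes "finite S" "\<And>i. i \<in> S \<Longrightarrow> a i \<noteq> 0 \<or> b i \<noteq> 0"
  shows "\<exists>t. \<forall>i\<in>S. t * a i + b i \<noteq> 0"
proof -
  have "finite {t. t * a i + b i = 0}" if "i \<in> S" for i
  proof (cases "a i = 0")
    case True
    then show ?thesis using assms(2)[OF that] by simp
  next
    case False
    then have "{t. t * a i + b i = 0} \<subseteq> {- b i div a i}"
      by (auto simp: eq_neg_iff_add_eq_0[symmetric] dest: sym)
    then show ?thesis by (rule finite_subset) simp
  qed
  then have "finite (\<Union>i\<in>S. {t. t * a i + b i = 0})"
    using assms(1) by blast
  then obtain t where "t \<notin> (\<Union>i\<in>S. {t. t * a i + b i = 0})"
    by (meson ex_new_if_finite infinite_UNIV_int)
  then show ?thesis by blast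
qed

text \<open>Finitely many hyperplanes do not cover the integer lattice. In the induction the old
  \<open>v\<close> is replaced by \<open>t * v\<close> plus a unit vector along which the new
  \<open>x\<close> is nonzero; every condition is then affine and nontrivial in \<open>t\<close>, so
  it excludes at most one integer \<open>t\<close>.\<close>

lemma separating_int_vector:
  fixes S :: "(int ^ 'd) set"
  assumes "finite S" "0 \<notin> S"
  shows "\<exists>v :: int ^ 'd. \<forall>x\<in>S. (\<Sum>j\<in>UNIV. x $ j * v $ j) \<noteq> 0"
  using assms
proof (induction S)
  case (insert x S)
  then obtain v where v: "\<And>y. y \<in> S \<Longrightarrow> (\<Sum>j\<in>UNIV. y $ j * v $ j) \<noteq> 0"
    by auto
  obtain i where i: "x $ i \<noteq> 0"
    using insert.prems by (auto simp: vec_eq_iff)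
  have "\<exists>t. \<forall>y\<in>insert x S. t * (\<Sum>j\<in>UNIV. y $ j * v $ j) + y $ i \<noteq> 0"
    using v i insert.hyps by (intro finite_int_avoid) auto
  then obtain t where t: "\<And>y. y \<in> insert x S \<Longrightarrow> t * (\<Sum>j\<in>UNIV. y $ j * v $ j) + y $ i \<noteq> 0"
    by blast
  define w where "w = (\<chi> j. t * v $ j + (if j = i then 1 else 0))"
  have "(\<Sum>j\<in>UNIV. y $ j * w $ j) = t * (\<Sum>j\<in>UNIV. y $ j * v $ j) + y $ i" for y
    unfolding w_def vec_lambda_beta distrib_left sum.distrib
    by (simp add: sum_distrib_left mult_ac if_distrib cong: if_cong)
  with t have "\<forall>y\<in>insert x S. (\<Sum>j\<in>UNIV. y $ j * w $ j) \<noteq> 0"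
    by simp
  then show ?case by blast
qed auto

lemma phase_add_scaleR:
  fixes v :: "int ^ 'd"
  shows "phase k (\<theta> + s *\<^sub>R (\<chi> j. of_int (v $ j))) = phase k \<theta> + s * of_int (\<Sum>j\<in>UNIV. k $ j * v $ j)"
  by (simp add: phase_def distrib_left sum.distrib sum_distrib_left mult_ac)

lemma continuous_on_phase [continuous_intros]:
  "continuous_on S f \<Longrightarrow> continuous_on S (\<lambda>x. phase k (f x))"
  unfolding phase_def by (intro continuous_intros)

text \<open>
  Along the direction \<open>v\<close> all frequencies are distinct, so that the restriction to a line is, up to a
  unimodular factor, a polynomial in \<open>cis s\<close> whose leading coefficient has the same modulus on all
  parallel lines.
\<close>

lemma nn_integral_neg_log_lines:
  fixes r :: "int ^ 'd \<Rightarrow> complex"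
  assumes "finite \<Lambda>" "k0 \<in> \<Lambda>" "r k0 \<noteq> 0"
  shows "\<exists>(v :: real ^ 'd) B. B < \<infinity> \<and> (\<forall>\<theta>.
    (\<integral>\<^sup>+s. neg_log (cmod (\<Sum>k\<in>\<Lambda>. r k * cis (- phase k (\<theta> + s *\<^sub>R v)))) * indicator {0..1} s \<partial>lborel) \<le> B)"
proof -
  define S where "S = {k \<in> \<Lambda>. r k \<noteq> 0}"
  have S: "finite S" "k0 \<in> S" using assms by (auto simp: S_def)
  \<comment> \<open>Separating the nonzero differences from 0 makes the frequencies
    \<open>n k\<close> along \<open>v\<close> pairwise distinct.\<close>
  have "finite ((\<lambda>(k, l). k - l) ` (S \<times> S) - {0})" using S by simp
  then obtain v :: "int ^ 'd" where
    "\<And>x. x \<in> (\<lambda>(k, l). k - l) ` (S \<times> S) - {0} \<Longrightarrow> (\<Sum>j\<in>UNIV. x $ j * v $ j) \<noteq> 0"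
    using separating_int_vector[of "(\<lambda>(k, l). k - l) ` (S \<times> S) - {0}"] by blast
  then have "(\<Sum>j\<in>UNIV. (k - l) $ j * v $ j) \<noteq> 0" if "k \<in> S" "l \<in> S" "k \<noteq> l" for k l
    using that by force
  moreover define n where "n k = (\<Sum>j\<in>UNIV. k $ j * v $ j)" for k
  ultimately have n_inj: "n k \<noteq> n l" if "k \<in> S" "l \<in> S" "k \<noteq> l" for k l
    using that by (simp add: left_diff_distrib sum_subtractf)
  \<comment> \<open>The polynomial has frequencies \<open>- n k\<close> along the line.
    Multiplication by the unimodular \<open>cis (s * of_int N)\<close> shifts them to the exponents
    \<open>N - n k\<close>, which are nonnegative, without changing the modulus.\<close>
  define N where "N = Max (n ` S)"
  define e where "e k = nat (N - n k)" for k
  have le_N: "n k \<le> N" if "k \<in> S" for k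
    using S that by (simp add: N_def)
  have e_inj: "e k \<noteq> e l" if "k \<in> S" "l \<in> S" "k \<noteq> l" for k l
    using n_inj[OF that] le_N[OF that(1)] le_N[OF that(2)] by (simp add: e_def)
  obtain k1 where k1: "k1 \<in> S" "e k1 = Max (e ` S)"
    using S by (metis (no_types) Max_in empty_iff finite_imageI image_iff)
  have le_e: "e k \<le> e k1" if "k \<in> S" for k
    using S that k1 by simp
  define f where "f \<theta> = (\<Sum>k\<in>S. monom (r k * cis (- phase k \<theta>)) (e k))" for \<theta>
  have coeff_f: "coeff (f \<theta>) i = (\<Sum>k\<in>S. if e k = i then r k * cis (- phase k \<theta>) else 0)" for \<theta> i
    by (simp add: f_def coeff_sum)
  \<comment> \<open>Because exponents are distinct, a single frequency feeds the top coefficient; no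
    cancellation can occur, and its modulus \<open>cmod (r k1)\<close> does not depend on
    \<open>\<theta>\<close>.\<close>
  have lead: "coeff (f \<theta>) (e k1) = r k1 * cis (- phase k1 \<theta>)" for \<theta>
  proof -
    have "coeff (f \<theta>) (e k1) = (\<Sum>k\<in>S. if k = k1 then r k * cis (- phase k \<theta>) else 0)"
      unfolding coeff_f using e_inj k1(1) by (intro sum.cong) auto
    then show ?thesis using S k1 by simp
  qed
  have "coeff (f \<theta>) i = 0" if "i > e k1" for \<theta> i
    unfolding coeff_f using le_e that by (intro sum.neutral) fastforce
  then have deg_le: "degree (f \<theta>) \<le> e k1" for \<theta>
    by (simp add: degree_le)
  have r1: "r k1 \<noteq> 0" using k1(1) by (simp add: S_def)
  then have nz: "coeff (f \<theta>) (e k1) \<noteq> 0" for \<theta>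
    by (simp add: lead)
  then have deg: "degree (f \<theta>) = e k1" for \<theta>
    using deg_le le_degree le_antisym by metis
  have poly_f: "cmod (poly (f \<theta>) (cis s)) =
      cmod (\<Sum>k\<in>\<Lambda>. r k * cis (- phase k (\<theta> + s *\<^sub>R (\<chi> j. of_int (v $ j)))))" for \<theta> s
  proof -
    have "poly (f \<theta>) (cis s) = (\<Sum>k\<in>S. cis (s * of_int N) * (r k * cis (- phase k (\<theta> + s *\<^sub>R (\<chi> j. of_int (v $ j))))))"
      unfolding f_def poly_sum poly_monom
    proof (rule sum.cong)
      fix k assume "k \<in> S"
      then have "real (e k) = of_int N - of_int (n k)"
        using le_N[of k] by (simp add: e_def)
      then have "cis s ^ e k = cis (s * of_int N - s * of_int (n k))"
        by (simp add: Complex.DeMoivre mult.commute right_diff_distrib)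
      then show "r k * cis (- phase k \<theta>) * cis s ^ e k =
          cis (s * of_int N) * (r k * cis (- phase k (\<theta> + s *\<^sub>R (\<chi> j. of_int (v $ j)))))"
        by (simp add: phase_add_scaleR n_def cis_mult algebra_simps)
    qed simp
    also have "\<dots> = cis (s * of_int N) * (\<Sum>k\<in>\<Lambda>. r k * cis (- phase k (\<theta> + s *\<^sub>R (\<chi> j. of_int (v $ j)))))"
      unfolding sum_distrib_left[symmetric] using assms(1)
      by (intro arg_cong2[where f="(*)"] refl sum.mono_neutral_left) (auto simp: S_def)
    finally show ?thesis by (simp add: norm_mult)
  qed
  have "(\<integral>\<^sup>+s. neg_log (cmod (\<Sum>k\<in>\<Lambda>. r k * cis (- phase k (\<theta> + s *\<^sub>R (\<chi> j. of_int (v $ j)))))) * indicator {0..1} s \<partial>lborel)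
      \<le> neg_log (cmod (r k1)) + 16 * of_nat (e k1)" for \<theta>
  proof -
    have "f \<theta> \<noteq> 0" using nz[of \<theta>] by (metis coeff_0)
    from nn_integral_neg_log_poly_le[OF this] show ?thesis
      by (simp add: poly_f deg lead norm_mult)
  qed
  moreover have "neg_log (cmod (r k1)) + 16 * of_nat (e k1) < \<infinity>"
    using neg_log_finite[of "cmod (r k1)"] r1 by (simp add: ennreal_mult_less_top of_nat_less_top)
  ultimately show ?thesis by blast
qed

section \<open>From bounds on segments to bounds on bounded sets\<close>

lemma nn_integral_lborel_translation:
  fixes a :: "'a::euclidean_space"
  assumes [measurable]: "f \<in> borel_measurable borel"
  shows "(\<integral>\<^sup>+x. f (a + x) \<partial>lborel) = (\<integral>\<^sup>+x. f x \<partial>lborel)"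
  by (subst (2) lborel_distr_plus[symmetric, of a]) (simp add: nn_integral_distr)

text \<open>The integral over \<open>A\<close> is averaged over the translations by
  \<open>s *\<^sub>R v\<close> with \<open>s\<close> in \<open>{0..1}\<close>. After translation the
  base point stays in the ball \<open>C\<close>, enlarged by \<open>norm v\<close>, and exchanging
  the integrals leaves the segment bound times the volume of \<open>C\<close>.\<close>

lemma nn_integral_le_lines:
  fixes G :: "'a::euclidean_space \<Rightarrow> ennreal"
  assumes [measurable]: "G \<in> borel_measurable borel" "A \<in> sets borel" and "bounded A"
    and B: "B < \<infinity>" "\<And>x. (\<integral>\<^sup>+s. G (x + s *\<^sub>R v) * indicator {0..1} s \<partial>lborel) \<le> B"
  shows "(\<integral>\<^sup>+x. G x * indicator A x \<partial>lborel) < \<infinity>"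
proof -
  obtain R where R: "\<And>x. x \<in> A \<Longrightarrow> norm x \<le> R"
    using \<open>bounded A\<close> by (auto simp: bounded_iff)
  define C where "C = cball (0::'a) (R + norm v)"
  have C [measurable]: "C \<in> sets borel" by (simp add: C_def)
  have "(\<integral>\<^sup>+x. G x * indicator A x \<partial>lborel) = (\<integral>\<^sup>+s. (\<integral>\<^sup>+x. G x * indicator A x \<partial>lborel) * indicator {0..1::real} s \<partial>lborel)"
    by (simp add: nn_integral_cmult_indicator)
  also have "\<dots> \<le> (\<integral>\<^sup>+s. (\<integral>\<^sup>+x. G (x + s *\<^sub>R v) * indicator {0..1} s * indicator C x \<partial>lborel) \<partial>lborel)"
  proof (rule nn_integral_mono)
    fix s :: real
    show "(\<integral>\<^sup>+x. G x * indicator A x \<partial>lborel) * indicator {0..1} s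
        \<le> (\<integral>\<^sup>+x. G (x + s *\<^sub>R v) * indicator {0..1} s * indicator C x \<partial>lborel)"
    proof (cases "s \<in> {0..1}")
      case True
      have "(\<integral>\<^sup>+x. G x * indicator A x \<partial>lborel) = (\<integral>\<^sup>+x. G (s *\<^sub>R v + x) * indicator A (s *\<^sub>R v + x) \<partial>lborel)"
        by (rule nn_integral_lborel_translation[symmetric]) measurable
      also have "\<dots> \<le> (\<integral>\<^sup>+x. G (x + s *\<^sub>R v) * indicator C x \<partial>lborel)"
      proof (intro nn_integral_mono)
        fix x
        have "x \<in> C" if "s *\<^sub>R v + x \<in> A"
        proof -
          have "norm x \<le> norm (s *\<^sub>R v + x) + norm (s *\<^sub>R v)"
            using norm_triangle_ineq4[of "s *\<^sub>R v + x" "s *\<^sub>R v"] by simp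
          also have "norm (s *\<^sub>R v) \<le> norm v"
            using True by (simp add: mult_left_le_one_le)
          finally show ?thesis using R[OF that] by (simp add: C_def)
        qed
        then show "G (s *\<^sub>R v + x) * indicator A (s *\<^sub>R v + x) \<le> G (x + s *\<^sub>R v) * indicator C x"
          by (auto simp: indicator_def add.commute)
      qed
      finally show ?thesis using True by simp
    qed simp
  qed
  also have "\<dots> = (\<integral>\<^sup>+x. (\<integral>\<^sup>+s. G (x + s *\<^sub>R v) * indicator {0..1} s * indicator C x \<partial>lborel) \<partial>lborel)"
    by (intro pair_sigma_finite.Fubini'[symmetric] pair_sigma_finite.intro lborel.sigma_finite_measure_axioms)
      (simp add: split_beta')
  also have "\<dots> = (\<integral>\<^sup>+x. (\<integral>\<^sup>+s. G (x + s *\<^sub>R v) * indicator {0..1} s \<partial>lborel) * indicator C x \<partial>lborel)"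
    by (simp add: nn_integral_multc)
  also have "\<dots> \<le> (\<integral>\<^sup>+x. B * indicator C x \<partial>lborel)"
    by (intro nn_integral_mono mult_right_mono B) simp
  also have "\<dots> = B * emeasure lborel C"
    by (simp add: nn_integral_cmult_indicator)
  also have "\<dots> < \<infinity>"
    using B emeasure_bounded_finite[of C] by (simp add: C_def ennreal_mult_less_top)
  finally show ?thesis .
qed

lemma torus_borel [measurable]: "torus \<in> sets borel"
proof -
  have "torus = (\<Inter>j. {\<theta> :: real ^ 'd. - pi < \<theta> $ j \<and> \<theta> $ j \<le> pi})"
    by (auto simp: torus_def)
  also have "\<dots> \<in> sets borel"
    by (intro sets.countable_INT'' ) auto
  finally show ?thesis .
qed

lemma bounded_torus: "bounded (torus :: (real ^ 'd) set)"
  by (rule bounded_subset[OF bounded_cbox[of "\<chi> j. - pi" "\<chi> j. pi"]])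
    (auto simp: torus_def mem_box_cart less_imp_le)

lemma nn_integral_torus_measure:
  assumes [measurable]: "f \<in> borel_measurable borel"
  shows "(\<integral>\<^sup>+\<theta>. f \<theta> \<partial>torus_measure) =
    ennreal ((1 / (2 * pi)) ^ CARD('d)) * (\<integral>\<^sup>+\<theta>. f \<theta> * indicator torus \<theta> \<partial>(lborel :: (real ^ 'd) measure))"
  by (simp add: torus_measure_def nn_integral_scale_measure nn_integral_restrict_space measurable_restrict_space1)

lemma nn_integral_neg_log_trig:
  fixes r :: "int ^ 'd \<Rightarrow> complex"
  assumes "finite \<Lambda>" "k0 \<in> \<Lambda>" "r k0 \<noteq> 0"
  shows "(\<integral>\<^sup>+\<theta>. neg_log (cmod (\<Sum>k\<in>\<Lambda>. r k * cis (- phase k \<theta>))) \<partial>torus_measure) < \<infinity>"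
proof -
  have [measurable]: "(\<lambda>\<theta>. neg_log (cmod (\<Sum>k\<in>\<Lambda>. r k * cis (- phase k \<theta>)))) \<in> borel_measurable borel"
    by (intro measurable_compose[OF _ measurable_neg_log] borel_measurable_continuous_onI continuous_intros)
  obtain v B where "B < \<infinity>" "\<And>\<theta>.
    (\<integral>\<^sup>+s. neg_log (cmod (\<Sum>k\<in>\<Lambda>. r k * cis (- phase k (\<theta> + s *\<^sub>R v)))) * indicator {0..1} s \<partial>lborel) \<le> B"
    using nn_integral_neg_log_lines[of \<Lambda> k0 r] assms by blast
  then have "(\<integral>\<^sup>+\<theta>. neg_log (cmod (\<Sum>k\<in>\<Lambda>. r k * cis (- phase k \<theta>))) * indicator torus \<theta> \<partial>lborel) < \<infinity>"
    by (intro nn_integral_le_lines[where v=v]) (auto intro: bounded_torus)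
  then show ?thesis
    by (simp add: nn_integral_torus_measure ennreal_mult_less_top)
qed

section \<open>Lebesgue decomposition on the torus\<close>

lemma sets_torus_measure: "sets torus_measure = sets (restrict_space lborel torus)"
  by (simp add: torus_measure_def)

lemma borel_measurable_torus:
  "f \<in> borel_measurable borel \<Longrightarrow> f \<in> borel_measurable torus_measure"
  by (simp add: torus_measure_def measurable_restrict_space1 cong: measurable_cong_sets)

lemma finite_measure_torus: "finite_measure (torus_measure :: (real ^ 'd) measure)"
proof
  have "emeasure (torus_measure :: (real ^ 'd) measure) (space torus_measure) =
      (\<integral>\<^sup>+\<theta>. 1 \<partial>(torus_measure :: (real ^ 'd) measure))"
    by simp
  also have "\<dots> = ennreal ((1 / (2 * pi)) ^ CARD('d)) * emeasure lborel (torus :: (real ^ 'd) set)"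
    by (subst nn_integral_torus_measure) auto
  also have "\<dots> < \<infinity>"
    using emeasure_bounded_finite[OF bounded_torus[where 'd='d]] by (simp add: ennreal_mult_less_top)
  finally show "emeasure (torus_measure :: (real ^ 'd) measure) (space torus_measure) \<noteq> \<infinity>"
    by simp
qed

lemma emeasure_torus_pos: "emeasure (torus_measure :: (real ^ 'd) measure) (space torus_measure) > 0"
proof -
  have "box (\<chi> j. 0) (\<chi> j. pi) \<subseteq> (torus :: (real ^ 'd) set)"
    by (auto simp: torus_def mem_box_cart less_imp_le intro: less_trans[OF _ pi_gt_zero] order_less_trans[of "- pi" 0])
  then have "emeasure lborel (torus :: (real ^ 'd) set) \<ge> emeasure lborel (box (\<chi> j. 0) (\<chi> j. pi) :: (real ^ 'd) set)"
    by (intro emeasure_mono) auto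
  moreover have "emeasure lborel (box (\<chi> j. 0) (\<chi> j. pi) :: (real ^ 'd) set) > 0"
    by (auto simp: emeasure_lborel_box_eq Basis_vec_def inner_axis intro!: prod_pos)
  ultimately have pos: "emeasure lborel (torus :: (real ^ 'd) set) > 0"
    by (rule order.strict_trans2[rotated])
  have "emeasure (torus_measure :: (real ^ 'd) measure) (space torus_measure) =
      (\<integral>\<^sup>+\<theta>. 1 \<partial>(torus_measure :: (real ^ 'd) measure))"
    by simp
  also have "\<dots> = ennreal ((1 / (2 * pi)) ^ CARD('d)) * emeasure lborel (torus :: (real ^ 'd) set)"
    by (subst nn_integral_torus_measure) auto
  finally show ?thesis
    using pos by (simp add: ennreal_zero_less_mult_iff)
qed

lemma AE_torus_imp_ex:
  "AE \<theta> in (torus_measure :: (real ^ 'd) measure). P \<theta> \<Longrightarrow> \<exists>\<theta>. P \<theta>"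
  using emeasure_torus_pos[where 'd='d] ae_filter_eq_bot_iff[of "torus_measure :: (real ^ 'd) measure"]
  by (metis eventually_mono trivial_limit_def less_irrefl)

section \<open>Integration against a sum of measures\<close>

lemma sets_measure_add [simp, measurable_cong]: "sets (measure_add M N) = sets M"
  by (simp add: measure_add_def)

lemma space_measure_add [simp]: "space (measure_add M N) = space M"
  by (simp add: measure_add_def)

lemma nn_integral_measure_add:
  assumes sets: "sets N = sets M" and f: "f \<in> borel_measurable M"
  shows "(\<integral>\<^sup>+x. f x \<partial>measure_add M N) = (\<integral>\<^sup>+x. f x \<partial>M) + (\<integral>\<^sup>+x. f x \<partial>N)"
proof -
  note [measurable_cong] = sets
  have space: "space N = space M" by (rule sets_eq_imp_space_eq[OF sets])
  from f show ?thesis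
  proof induction
    case (cong f g)
    then show ?case
      using nn_integral_cong[of "measure_add M N" f g] nn_integral_cong[of M f g] nn_integral_cong[of N f g] space
      by simp
  next
    case (set A)
    then show ?case by (simp add: emeasure_measure_add sets)
  next
    case (mult u c)
    then have [measurable]: "u \<in> borel_measurable M" by simp
    show ?case using mult by (simp add: nn_integral_cmult distrib_left)
  next
    case (add u v)
    then have [measurable]: "u \<in> borel_measurable M" "v \<in> borel_measurable M" by simp_all
    show ?case using add by (simp add: nn_integral_add add_ac)
  next
    case (seq U)
    then have [measurable]: "\<And>i. U i \<in> borel_measurable M" by simp
    have inc: "incseq (\<lambda>i. \<integral>\<^sup>+x. U i x \<partial>L)" for L :: "'a measure"
      using \<open>incseq U\<close> by (auto simp: incseq_def le_fun_def intro!: nn_integral_mono)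
    have "(\<integral>\<^sup>+x. (SUP i. U i) x \<partial>L) = (SUP i. \<integral>\<^sup>+x. U i x \<partial>L)" if "sets L = sets M" for L
      unfolding SUP_apply using \<open>incseq U\<close> that
      by (intro nn_integral_monotone_convergence_SUP) (simp_all cong: measurable_cong_sets)
    then show ?case
      using seq.IH ennreal_SUP_add[OF inc inc, of M N] sets by (simp add: image_comp o_def)
  qed
qed

lemma integrable_measure_add:
  fixes f :: "'a \<Rightarrow> 'b::{banach, second_countable_topology}"
  assumes "sets N = sets M" and "f \<in> borel_measurable M"
  shows "integrable (measure_add M N) f \<longleftrightarrow> integrable M f \<and> integrable N f"
  using assms by (simp add: integrable_iff_bounded nn_integral_measure_add cong: measurable_cong_sets)

lemma integral_measure_add_real:
  fixes f :: "'a \<Rightarrow> real"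
  assumes "sets N = sets M" "integrable M f" "integrable N f"
  shows "(LINT x|measure_add M N. f x) = (LINT x|M. f x) + (LINT x|N. f x)"
proof -
  have [measurable]: "f \<in> borel_measurable M" using assms(2) by simp
  have "integrable (measure_add M N) f"
    using assms by (simp add: integrable_measure_add)
  moreover have "enn2real (a + b) = enn2real a + enn2real b" if "a < \<infinity>" "b < \<infinity>" for a b
    using that by (rule_tac enn2real_plus) auto
  ultimately show ?thesis
    using assms
    by (simp add: real_lebesgue_integral_def nn_integral_measure_add real_integrable_def less_top)
qed

lemma integral_measure_add:
  fixes f :: "'a \<Rightarrow> complex"
  assumes "sets N = sets M" "integrable M f" "integrable N f"
  shows "(LINT x|measure_add M N. f x) = (LINT x|M. f x) + (LINT x|N. f x)"
proof (rule complex_eqI)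
  have add: "integrable (measure_add M N) f"
    using assms by (simp add: integrable_measure_add)
  have "Re (LINT x|measure_add M N. f x) = (LINT x|measure_add M N. Re (f x))"
    using add by simp
  also have "\<dots> = (LINT x|M. Re (f x)) + (LINT x|N. Re (f x))"
    using assms by (intro integral_measure_add_real) auto
  finally show "Re (LINT x|measure_add M N. f x) = Re ((LINT x|M. f x) + (LINT x|N. f x))"
    using assms by simp
  have "Im (LINT x|measure_add M N. f x) = (LINT x|measure_add M N. Im (f x))"
    using add by simp
  also have "\<dots> = (LINT x|M. Im (f x)) + (LINT x|N. Im (f x))"
    using assms by (intro integral_measure_add_real) auto
  finally show "Im (LINT x|measure_add M N. f x) = Im ((LINT x|M. f x) + (LINT x|N. f x))"
    using assms by simp
qed

text \<open>
  Radon-Nikodym for the base measure with respect to its sum with \<open>\<mu>\<close>; the singular part lives where this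
  derivative vanishes.
\<close>

lemma lebesgue_decomp_exists:
  fixes \<mu> :: "(real ^ 'd) measure"
  assumes "\<mu> \<in> bounded_measures"
  shows "\<exists>\<Phi> \<nu>. lebesgue_decomp \<mu> \<Phi> \<nu>"
proof -
  let ?m = "torus_measure :: (real ^ 'd) measure"
  have sets: "sets \<mu> = sets ?m" and "finite_measure \<mu>"
    using assms by (auto simp: bounded_measures_def)
  interpret \<mu>: finite_measure \<mu> by fact
  interpret m: finite_measure ?m by (rule finite_measure_torus)
  note [measurable_cong] = sets
  have space: "space \<mu> = space ?m" by (rule sets_eq_imp_space_eq[OF sets])
  define L where "L = measure_add ?m \<mu>"
  have setsL [simp, measurable_cong]: "sets L = sets ?m" and spaceL: "space L = space ?m"
    by (simp_all add: L_def)
  have emL: "emeasure L A = emeasure ?m A + emeasure \<mu> A" if "A \<in> sets ?m" for A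
    using that sets by (simp add: L_def emeasure_measure_add)
  interpret L: finite_measure L
  proof
    show "emeasure L (space L) \<noteq> \<infinity>"
      using m.emeasure_finite \<mu>.emeasure_finite by (simp add: spaceL emL)
  qed
  have ac: "absolutely_continuous L ?m"
    by (auto simp: absolutely_continuous_def null_sets_def emL)
  then obtain g where g [measurable]: "g \<in> borel_measurable L" and dg: "density L g = ?m"
    using L.Radon_Nikodym[OF ac setsL[symmetric]] by blast
  have [measurable]: "g \<in> borel_measurable ?m" using g measurable_cong_sets[OF setsL refl] by blast
  define N where "N = {x \<in> space ?m. g x = 0}"
  have N [measurable]: "N \<in> sets ?m" unfolding N_def by measurable
  have "emeasure ?m N = (\<integral>\<^sup>+x. g x * indicator N x \<partial>L)"
    by (subst dg[symmetric]) (simp add: emeasure_density)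
  also have "\<dots> = (\<integral>\<^sup>+x. 0 \<partial>L)"
    by (intro nn_integral_cong) (auto simp: N_def indicator_def)
  finally have N_null: "N \<in> null_sets ?m" by (simp add: null_sets_def)
  define \<nu> where "\<nu> = density \<mu> (indicator N)"
  define \<mu>' where "\<mu>' = density \<mu> (indicator (space ?m - N))"
  have em: "emeasure \<nu> A = emeasure \<mu> (A \<inter> N)" "emeasure \<mu>' A = emeasure \<mu> (A - N)" if "A \<in> sets ?m" for A
  proof -
    have "A \<inter> (space ?m - N) = A - N" using sets.sets_into_space[OF that] by auto
    then show "emeasure \<nu> A = emeasure \<mu> (A \<inter> N)" "emeasure \<mu>' A = emeasure \<mu> (A - N)"
      using that by (simp_all add: \<nu>_def \<mu>'_def emeasure_restricted sets Int_commute)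
  qed
  \<comment> \<open>If \<open>A\<close> is null for the base measure, then \<open>g\<close>, the
    derivative of that measure with respect to \<open>L\<close>, vanishes almost everywhere on
    \<open>A\<close>. So \<open>A - N\<close> is null for \<open>L\<close>, and hence for
    \<open>\<mu>\<close>.\<close>
  have ac': "absolutely_continuous ?m \<mu>'"
    unfolding absolutely_continuous_def
  proof
    fix A assume A: "A \<in> null_sets ?m"
    then have [measurable]: "A \<in> sets ?m" by auto
    have "(\<integral>\<^sup>+x. g x * indicator A x \<partial>L) = emeasure ?m A"
      by (subst dg[symmetric]) (simp add: emeasure_density)
    also have "\<dots> = 0" using A by auto
    finally have "AE x in L. g x * indicator A x = 0"
      by (subst (asm) nn_integral_0_iff_AE) auto
    then have "AE x in L. x \<notin> A - N"
      by eventually_elim (use sets.sets_into_space[of A ?m] in \<open>auto simp: N_def indicator_def\<close>)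
    then have "emeasure L (A - N) = 0"
      by (subst (asm) AE_iff_measurable[of "A - N"]) (use sets.sets_into_space[of A ?m] in \<open>auto simp: spaceL\<close>)
    then show "A \<in> null_sets \<mu>'"
      using em(2)[of A] by (auto simp: null_sets_def emL \<mu>'_def sets)
  qed
  have "sets \<mu>' = sets ?m" by (simp add: \<mu>'_def sets)
  with ac' obtain f where f [measurable]: "f \<in> borel_measurable ?m" and df: "density ?m f = \<mu>'"
    using m.Radon_Nikodym by blast
  have "(\<integral>\<^sup>+x. f x \<partial>?m) = emeasure (density ?m f) (space ?m)"
    by (simp add: emeasure_density cong: nn_integral_cong)
  also have "\<dots> \<le> emeasure \<mu> (space \<mu>)"
    unfolding df em(2)[OF sets.top] space by (intro emeasure_mono) (auto simp: sets)
  finally have "(\<integral>\<^sup>+x. f x \<partial>?m) \<noteq> \<infinity>"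
    using \<mu>.emeasure_finite by (auto simp: top_unique)
  then have "AE x in ?m. f x \<noteq> \<infinity>"
    by (intro nn_integral_PInf_AE) auto
  \<comment> \<open>The decomposition requires a real density; finiteness of \<open>\<mu>\<close>
    confines the value \<open>\<infinity>\<close>, which \<open>enn2real\<close> sends to 0, to a
    null set.\<close>
  then have "density ?m (\<lambda>x. ennreal (enn2real (f x))) = density ?m f"
    by (intro density_cong) (auto simp: less_top)
  moreover have "\<mu> = measure_add \<mu>' \<nu>"
  proof (rule measure_eqI)
    show "sets \<mu> = sets (measure_add \<mu>' \<nu>)" by (simp add: \<mu>'_def)
    fix A assume A: "A \<in> sets \<mu>"
    then have A': "A \<in> sets ?m" by (simp add: sets)
    have "emeasure (measure_add \<mu>' \<nu>) A = emeasure \<mu> (A - N) + emeasure \<mu> (A \<inter> N)"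
      using A em[OF A'] by (subst emeasure_measure_add) (auto simp: \<mu>'_def \<nu>_def)
    also have "\<dots> = emeasure \<mu> ((A - N) \<union> (A \<inter> N))"
      using A' by (intro plus_emeasure) (auto simp: sets)
    also have "(A - N) \<union> (A \<inter> N) = A" by auto
    finally show "emeasure \<mu> A = emeasure (measure_add \<mu>' \<nu>) A" by simp
  qed
  moreover have "singular_measure \<nu>"
    unfolding singular_measure_def using N_null em(1)[of "space ?m - N"]
    by (intro bexI[of _ N]) (auto simp: Diff_Int_distrib2)
  ultimately have "lebesgue_decomp \<mu> (\<lambda>x. enn2real (f x)) \<nu>"
    using df by (simp add: lebesgue_decomp_def \<nu>_def sets)
  then show ?thesis by blast
qed

lemma lebesgue_decomp_ac_density:
  assumes "\<mu> \<in> bounded_measures"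
  obtains \<nu> where "lebesgue_decomp \<mu> (ac_density \<mu>) \<nu>"
  using someI_ex[of "\<lambda>\<Phi>. \<exists>\<nu>. lebesgue_decomp \<mu> \<Phi> \<nu>"] lebesgue_decomp_exists[OF assms]
  unfolding ac_density_def by blast

text \<open>Off the union of two null carriers both singular parts vanish, and densities do not see
  that union. Since \<open>ac_density\<close> is a choice, this is the only access to its
  values.\<close>

lemma density_eq_if_singular_rests:
  fixes f g :: "real ^ 'd \<Rightarrow> ennreal"
  assumes [measurable]: "f \<in> borel_measurable torus_measure" "g \<in> borel_measurable torus_measure"
    and sets: "sets \<nu> = sets torus_measure" "sets \<nu>' = sets torus_measure"
    and sing: "singular_measure \<nu>" "singular_measure \<nu>'"
    and eq: "measure_add (density torus_measure f) \<nu> = measure_add (density torus_measure g) \<nu>'"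
  shows "AE \<theta> in torus_measure. f \<theta> = g \<theta>"
proof -
  let ?m = "torus_measure :: (real ^ 'd) measure"
  interpret m: finite_measure ?m by (rule finite_measure_torus)
  obtain N1 where N1: "N1 \<in> null_sets ?m" "emeasure \<nu> (space ?m - N1) = 0"
    using sing(1) by (auto simp: singular_measure_def)
  obtain N2 where N2: "N2 \<in> null_sets ?m" "emeasure \<nu>' (space ?m - N2) = 0"
    using sing(2) by (auto simp: singular_measure_def)
  have [measurable]: "N1 \<in> sets ?m" "N2 \<in> sets ?m" using N1 N2 by auto
  let ?N = "N1 \<union> N2"
  have N: "?N \<in> null_sets ?m" using N1(1) N2(1) by auto
  have "density ?m f = density ?m g"
  proof (rule measure_eqI)
    fix A assume "A \<in> sets (density ?m f)"
    then have A [measurable]: "A \<in> sets ?m" by simp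
    have "A - ?N \<subseteq> space ?m - N1" "A - ?N \<subseteq> space ?m - N2"
      using sets.sets_into_space[OF A] by auto
    then have z: "emeasure \<nu> (A - ?N) = 0" "emeasure \<nu>' (A - ?N) = 0"
      using N1(2) N2(2) emeasure_mono[of "A - ?N" "space ?m - N1" \<nu>] emeasure_mono[of "A - ?N" "space ?m - N2" \<nu>'] sets
      by auto
    have diff: "emeasure (density ?m h) A = emeasure (density ?m h) (A - ?N)"
      if [measurable]: "h \<in> borel_measurable ?m" for h
    proof -
      have "AE x in ?m. x \<notin> ?N" using N by (rule AE_not_in)
      then have "(\<integral>\<^sup>+x. h x * indicator A x \<partial>?m) = (\<integral>\<^sup>+x. h x * indicator (A - ?N) x \<partial>?m)"
        by (intro nn_integral_cong_AE) (auto simp: indicator_def)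
      then show ?thesis by (simp add: emeasure_density)
    qed
    have "emeasure (density ?m f) (A - ?N) = emeasure (measure_add (density ?m f) \<nu>) (A - ?N)"
      using z sets by (simp add: emeasure_measure_add)
    also have "\<dots> = emeasure (density ?m g) (A - ?N)"
      unfolding eq using z sets by (simp add: emeasure_measure_add)
    finally show "emeasure (density ?m f) A = emeasure (density ?m g) A"
      by (simp add: diff)
  qed simp
  then show ?thesis by (intro m.density_unique) auto
qed

section \<open>Moment cones\<close>

lemma trig_poly_lincomb:
  "trig_poly \<Lambda> (\<lambda>k. of_real a * x k + of_real b * y k) \<theta> = a * trig_poly \<Lambda> x \<theta> + b * trig_poly \<Lambda> y \<theta>"
  by (simp add: trig_poly_def algebra_simps sum.distrib sum_distrib_left sum_subtractf)

lemma pairing_eq_sum: "pairing \<Lambda> x y = (\<Sum>k\<in>\<Lambda>. Re (x k) * Re (y k) + Im (x k) * Im (y k))"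
  by (simp add: pairing_def)

lemma pairing_commute: "pairing \<Lambda> x y = pairing \<Lambda> y x"
  by (simp add: pairing_eq_sum mult.commute)

lemma pairing_lincomb:
  "pairing \<Lambda> c (\<lambda>k. of_real a * x k + of_real b * y k) = a * pairing \<Lambda> c x + b * pairing \<Lambda> c y"
  by (simp add: pairing_eq_sum algebra_simps sum.distrib sum_distrib_left)

lemma pairing_cong: "(\<And>k. k \<in> \<Lambda> \<Longrightarrow> x k = x' k) \<Longrightarrow> (\<And>k. k \<in> \<Lambda> \<Longrightarrow> y k = y' k) \<Longrightarrow> pairing \<Lambda> x y = pairing \<Lambda> x' y'"
  by (simp add: pairing_def)

text \<open>The left argument is the moment vector of a unit mass at \<open>\<theta>\<close>, so
  pairing with moments of atomic measures becomes evaluation of polynomials at the atoms.\<close>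

lemma pairing_cis: "pairing \<Lambda> (\<lambda>k. cis (phase k \<theta>)) q = trig_poly \<Lambda> q \<theta>"
  by (simp add: pairing_eq_sum trig_poly_def algebra_simps)

lemma pairing_sum_left:
  "pairing \<Lambda> (\<lambda>k. \<Sum>j\<in>J. x j k) q = (\<Sum>j\<in>J. pairing \<Lambda> (x j) q)"
  unfolding pairing_def sum_distrib_right Re_sum by (rule sum.swap)

lemma pairing_scale_left: "pairing \<Lambda> (\<lambda>k. of_real a * x k) q = a * pairing \<Lambda> x q"
  by (simp add: pairing_eq_sum algebra_simps sum_distrib_left)

lemma pairing_moments:
  "pairing \<Lambda> (\<lambda>k. \<Sum>j\<in>J. of_real (a j) * cis (phase k (\<theta> j))) q = (\<Sum>j\<in>J. a j * trig_poly \<Lambda> q (\<theta> j))"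
  by (simp add: pairing_sum_left pairing_scale_left pairing_cis)

text \<open>Transfers atoms found in the compact cube to the half-open torus: shifting coordinates
  equal to \<open>- pi\<close> by a full period leaves every character unchanged.\<close>

lemma cis_phase_torus_rep:
  fixes \<theta> :: "real ^ 'd"
  assumes "\<theta> \<in> cbox (\<chi> j. - pi) (\<chi> j. pi)"
  shows "\<exists>\<phi>\<in>torus. \<forall>k. cis (phase k \<phi>) = cis (phase k \<theta>)"
proof
  define u where "u j = (if \<theta> $ j = - pi then 1 else 0 :: int)" for j
  define \<phi> :: "real ^ 'd" where "\<phi> = (\<chi> j. \<theta> $ j + 2 * pi * of_int (u j))"
  show "\<phi> \<in> torus"
    unfolding torus_def
  proof (intro CollectI allI)
    fix j
    have "- pi \<le> \<theta> $ j" "\<theta> $ j \<le> pi"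
      using assms by (auto simp: mem_box_cart)
    then show "- pi < \<phi> $ j \<and> \<phi> $ j \<le> pi"
      using pi_gt_zero by (cases "\<theta> $ j = - pi") (simp_all add: \<phi>_def u_def)
  qed
  show "\<forall>k. cis (phase k \<phi>) = cis (phase k \<theta>)"
  proof
    fix k :: "int ^ 'd"
    have "phase k \<phi> = phase k \<theta> + 2 * pi * of_int (\<Sum>j\<in>UNIV. k $ j * u j)"
      by (simp add: phase_def \<phi>_def distrib_left sum.distrib sum_distrib_left mult_ac)
    then show "cis (phase k \<phi>) = cis (phase k \<theta>)"
      by (simp only: cis_mult[symmetric] cis_multiple_2pi[OF Ints_of_int]) simp
  qed
qed

section \<open>Linear relations and the conic Caratheodory theorem\<close>

lemma exists_linear_relation:
  fixes A :: "'k \<Rightarrow> 'j \<Rightarrow> real"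
  assumes "finite K" "finite J" "card K < card J"
  shows "\<exists>x. (\<exists>j\<in>J. x j \<noteq> 0) \<and> (\<forall>k\<in>K. (\<Sum>j\<in>J. x j * A k j) = 0)"
  using assms
proof (induction K arbitrary: A J)
  case empty
  then obtain j where "j \<in> J" by fastforce
  then show ?case by (intro exI[of _ "\<lambda>_. 1"]) auto
next
  case (insert k K)
  show ?case
  proof (cases "\<forall>j\<in>J. A k j = 0")
    case True
    have "card K < card J" using insert by simp
    then obtain x where "\<exists>j\<in>J. x j \<noteq> 0" "\<forall>k\<in>K. (\<Sum>j\<in>J. x j * A k j) = 0"
      using insert.IH[of J A] insert.prems by blast
    then show ?thesis using True by (intro exI[of _ x]) auto
  next
    case False
    then obtain j0 where j0: "j0 \<in> J" "A k j0 \<noteq> 0" by blast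
    \<comment> \<open>One step of Gaussian elimination: equation \<open>k\<close> with pivot
      \<open>j0\<close> removes the unknown \<open>j0\<close> from all other equations. The vector
      \<open>y\<close> below is the back substitution.\<close>
    define B where "B l j = A l j - A l j0 / A k j0 * A k j" for l j
    have "card K < card (J - {j0})"
      using insert.prems insert.hyps j0 by simp
    then obtain x where x: "\<exists>j\<in>J - {j0}. x j \<noteq> 0" "\<And>l. l \<in> K \<Longrightarrow> (\<Sum>j\<in>J - {j0}. x j * B l j) = 0"
      using insert.IH[of "J - {j0}" B] insert.prems by blast
    define y where "y = x(j0 := - (\<Sum>j\<in>J - {j0}. x j * A k j) / A k j0)"
    have split: "(\<Sum>j\<in>J. y j * A l j) = y j0 * A l j0 + (\<Sum>j\<in>J - {j0}. x j * A l j)" for l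
      using j0 insert.prems(1) by (subst sum.remove[of J j0]) (auto simp: y_def intro!: sum.cong)
    have "(\<Sum>j\<in>J. y j * A l j) = 0" if "l \<in> insert k K" for l
    proof (cases "l = k")
      case True
      then show ?thesis using j0 by (simp add: split) (simp add: y_def)
    next
      case False
      then have "(\<Sum>j\<in>J - {j0}. x j * B l j) = 0" using that x by simp
      moreover have "(\<Sum>j\<in>J - {j0}. x j * B l j) =
          (\<Sum>j\<in>J - {j0}. x j * A l j) - A l j0 / A k j0 * (\<Sum>j\<in>J - {j0}. x j * A k j)"
        by (simp only: B_def right_diff_distrib sum_subtractf sum_distrib_left mult.left_commute)
      ultimately show ?thesis by (simp add: split) (simp add: y_def)
    qed
    moreover have "\<exists>j\<in>J. y j \<noteq> 0"
      using x(1) by (auto simp: y_def)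
    ultimately show ?thesis by blast
  qed
qed

text \<open>With more than \<open>card K\<close> positive weights there is a linear relation among
  the vectors; moving the weights along it until the first one reaches 0 keeps the sum and drops an
  index. No normalisation of the total weight has to be kept, so the bound is \<open>card K\<close>
  and not one more.\<close>

lemma conic_caratheodory:
  fixes v :: "'j \<Rightarrow> 'k \<Rightarrow> real"
  assumes "finite K" "finite J" "\<And>j. j \<in> J \<Longrightarrow> a j \<ge> 0"
  shows "\<exists>J' a'. J' \<subseteq> J \<and> card J' \<le> card K \<and> (\<forall>j\<in>J'. a' j > 0) \<and>
    (\<forall>k\<in>K. (\<Sum>j\<in>J'. a' j * v j k) = (\<Sum>j\<in>J. a j * v j k))"
  using assms(2,3)
proof (induction "card J" arbitrary: J a rule: less_induct)
  case less
  have drop: ?case if j0: "j0 \<in> J" and b: "b j0 = 0" "\<And>j. j \<in> J \<Longrightarrow> b j \<ge> 0"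
    and eq: "\<And>k. k \<in> K \<Longrightarrow> (\<Sum>j\<in>J. b j * v j k) = (\<Sum>j\<in>J. a j * v j k)" for j0 b
  proof -
    have "card (J - {j0}) < card J"
      using less.prems(1) j0 by (rule card_Diff1_less)
    moreover have "finite (J - {j0})" "\<And>j. j \<in> J - {j0} \<Longrightarrow> b j \<ge> 0"
      using less.prems b by auto
    ultimately obtain J' a' where *: "J' \<subseteq> J - {j0}" "card J' \<le> card K" "\<forall>j\<in>J'. a' j > 0"
      "\<forall>k\<in>K. (\<Sum>j\<in>J'. a' j * v j k) = (\<Sum>j\<in>J - {j0}. b j * v j k)"
      using less.hyps[of "J - {j0}" b] by blast
    have "(\<Sum>j\<in>J - {j0}. b j * v j k) = (\<Sum>j\<in>J. b j * v j k)" for k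
      using less.prems(1) j0 b(1) by (simp add: sum.remove)
    with * eq show ?thesis by (intro exI[of _ J'] exI[of _ a']) auto
  qed
  show ?case
  proof (cases "(\<exists>j\<in>J. a j = 0) \<or> card J \<le> card K")
    case True
    show ?thesis
    proof (cases "\<exists>j\<in>J. a j = 0")
      case True
      then obtain j where "j \<in> J" "a j = 0" by blast
      then show ?thesis using drop[of j a] less.prems by simp
    next
      case False
      then have "\<forall>j\<in>J. a j > 0" using less.prems(2) by (metis order_le_less)
      then show ?thesis using \<open>(\<exists>j\<in>J. a j = 0) \<or> card J \<le> card K\<close> False by blast
    qed
  next
    case False
    then have pos: "a j > 0" if "j \<in> J" for j
      using less.prems(2)[OF that] False that by (cases "a j = 0") auto
    obtain x0 where x0: "\<exists>j\<in>J. x0 j \<noteq> 0" "\<forall>k\<in>K. (\<Sum>j\<in>J. x0 j * v j k) = 0"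
      using exists_linear_relation[OF assms(1) less.prems(1), of "\<lambda>k j. v j k"] False by auto
    \<comment> \<open>The sign is chosen so that some entry of the relation is positive and some
      weight therefore decreases.\<close>
    define s where "s = (if \<exists>j\<in>J. x0 j > 0 then 1 else - 1 :: real)"
    define x where "x j = s * x0 j" for j
    have x: "\<exists>j\<in>J. x j > 0" "\<And>k. k \<in> K \<Longrightarrow> (\<Sum>j\<in>J. x j * v j k) = 0"
    proof -
      show "\<exists>j\<in>J. x j > 0"
        using x0(1) unfolding x_def s_def by (auto simp: neq_iff)
      show "(\<Sum>j\<in>J. x j * v j k) = 0" if "k \<in> K" for k
        using x0(2) that by (simp add: x_def mult.assoc sum_distrib_left[symmetric])
    qed
    define P where "P = {j \<in> J. x j > 0}"
    have P: "finite P" "P \<noteq> {}" using x(1) less.prems(1) by (auto simp: P_def)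
    \<comment> \<open>The largest step that keeps all weights nonnegative; the weight at a
      minimising index becomes exactly 0.\<close>
    define t where "t = Min ((\<lambda>j. a j / x j) ` P)"
    have "t \<in> (\<lambda>j. a j / x j) ` P" using P by (simp add: t_def)
    then obtain j0 where j0: "j0 \<in> P" "t = a j0 / x j0" by blast
    have t_le: "t \<le> a j / x j" if "j \<in> P" for j using P that by (simp add: t_def)
    have "t \<ge> 0" using j0 pos[of j0] by (simp add: P_def less_imp_le)
    show ?thesis
    proof (rule drop[of j0 "\<lambda>j. a j - t * x j"])
      show "j0 \<in> J" "a j0 - t * x j0 = 0" using j0 by (auto simp: P_def)
      show "a j - t * x j \<ge> 0" if "j \<in> J" for j
      proof (cases "x j > 0")
        case True
        then show ?thesis using t_le[of j] that by (simp add: P_def pos_le_divide_eq)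
      next
        case False
        then have "t * x j \<le> 0" using \<open>t \<ge> 0\<close> by (simp add: mult_nonneg_nonpos)
        then show ?thesis using pos[OF that] by simp
      qed
      show "(\<Sum>j\<in>J. (a j - t * x j) * v j k) = (\<Sum>j\<in>J. a j * v j k)" if "k \<in> K" for k
        using x(2)[OF that] by (simp add: left_diff_distrib sum_subtractf mult.assoc sum_distrib_left[symmetric])
    qed
  qed
qed

section \<open>Moments on a symmetric frequency set\<close>

locale frequency_set =
  fixes \<Lambda> :: "(int ^ 'd) set"
  assumes finite_freq: "finite \<Lambda>" and zero_freq: "0 \<in> \<Lambda>" and uminus_freq: "uminus ` \<Lambda> = \<Lambda>"
begin

lemma neg_mem: "k \<in> \<Lambda> \<Longrightarrow> - k \<in> \<Lambda>"
  using uminus_freq by blast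

text \<open>
  The map \<open>x \<mapsto> Re x + Im x\<close> is an isometry from hermitian families onto arbitrary real families on \<open>\<Lambda>\<close>
  (the Hartley transform); it makes the number of real coordinates equal to \<open>card \<Lambda>\<close>.
\<close>

lemma hartley_inj:
  assumes "\<And>k. k \<in> \<Lambda> \<Longrightarrow> x (- k) = cnj (x k)" "\<And>k. k \<in> \<Lambda> \<Longrightarrow> y (- k) = cnj (y k)"
    and "\<And>k. k \<in> \<Lambda> \<Longrightarrow> Re (x k) + Im (x k) = Re (y k) + Im (y k)" and k: "k \<in> \<Lambda>"
  shows "x k = y k"
  using assms(3)[OF k] assms(3)[OF neg_mem[OF k]] assms(1,2)[OF k] by (simp add: complex_eq_iff)

text \<open>The cross terms \<open>?f\<close> are odd under \<open>k \<mapsto> - k\<close>, so they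
  cancel in the sum over the symmetric index set.\<close>

lemma hartley_pairing:
  assumes "\<And>k. k \<in> \<Lambda> \<Longrightarrow> x (- k) = cnj (x k)" "\<And>k. k \<in> \<Lambda> \<Longrightarrow> y (- k) = cnj (y k)"
  shows "pairing \<Lambda> x y = (\<Sum>k\<in>\<Lambda>. (Re (x k) + Im (x k)) * (Re (y k) + Im (y k)))"
proof -
  let ?f = "\<lambda>k. Re (x k) * Im (y k) + Im (x k) * Re (y k)"
  have "(\<Sum>k\<in>\<Lambda>. ?f k) = (\<Sum>k\<in>\<Lambda>. ?f (- k))"
    by (rule sum_reflect[OF uminus_freq, symmetric])
  also have "\<dots> = (\<Sum>k\<in>\<Lambda>. - ?f k)"
    using assms by (intro sum.cong) auto
  finally have "(\<Sum>k\<in>\<Lambda>. ?f k) = 0"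
    unfolding sum_negf by simp
  then show ?thesis
    by (simp add: pairing_eq_sum algebra_simps sum.distrib)
qed

lemma moments_reflect:
  "(\<Sum>j\<in>J. of_real (a j) * cis (phase (- k) (\<theta> j))) = cnj (\<Sum>j\<in>J. of_real (a j) * cis (phase k (\<theta> j)))"
  by (simp add: phase_uminus cis_cnj)

text \<open>Caratheodory is applied in the real coordinates cos + sin. Treating real and imaginary
  parts as separate equations would double the bound.\<close>

lemma moments_caratheodory:
  assumes "finite J" "\<And>j. j \<in> J \<Longrightarrow> a j \<ge> 0"
  shows "\<exists>J' a'. J' \<subseteq> J \<and> card J' \<le> card \<Lambda> \<and> (\<forall>j\<in>J'. a' j > 0) \<and>
    (\<forall>k\<in>\<Lambda>. (\<Sum>j\<in>J'. of_real (a' j) * cis (phase k (\<theta> j))) = (\<Sum>j\<in>J. of_real (a j) * cis (phase k (\<theta> j))))"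
proof -
  have "\<exists>J' a'. J' \<subseteq> J \<and> card J' \<le> card \<Lambda> \<and> (\<forall>j\<in>J'. a' j > 0) \<and>
    (\<forall>k\<in>\<Lambda>. (\<Sum>j\<in>J'. a' j * (cos (phase k (\<theta> j)) + sin (phase k (\<theta> j)))) =
      (\<Sum>j\<in>J. a j * (cos (phase k (\<theta> j)) + sin (phase k (\<theta> j)))))"
    by (rule conic_caratheodory[OF finite_freq assms])
  then obtain J' a' where *: "J' \<subseteq> J" "card J' \<le> card \<Lambda>" "\<forall>j\<in>J'. a' j > 0"
    "\<forall>k\<in>\<Lambda>. (\<Sum>j\<in>J'. a' j * (cos (phase k (\<theta> j)) + sin (phase k (\<theta> j)))) =
      (\<Sum>j\<in>J. a j * (cos (phase k (\<theta> j)) + sin (phase k (\<theta> j))))"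
    by (elim exE conjE)
  have "(\<Sum>j\<in>J'. of_real (a' j) * cis (phase k (\<theta> j))) = (\<Sum>j\<in>J. of_real (a j) * cis (phase k (\<theta> j)))"
    if "k \<in> \<Lambda>" for k
    using _ _ _ that
  proof (rule hartley_inj)
    fix k assume "k \<in> \<Lambda>"
    then show "Re (\<Sum>j\<in>J'. of_real (a' j) * cis (phase k (\<theta> j))) + Im (\<Sum>j\<in>J'. of_real (a' j) * cis (phase k (\<theta> j))) =
        Re (\<Sum>j\<in>J. of_real (a j) * cis (phase k (\<theta> j))) + Im (\<Sum>j\<in>J. of_real (a j) * cis (phase k (\<theta> j)))"
      using * by (simp add: distrib_left sum.distrib)
  qed (rule moments_reflect)+
  with * show ?thesis by blast
qed

lemma moments_caratheodory_orthogonal: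
  assumes "finite J" "\<And>j. j \<in> J \<Longrightarrow> a j \<ge> 0"
    and q: "q \<in> hermitian \<Lambda>" "q \<noteq> (\<lambda>_. 0)" "\<And>j. j \<in> J \<Longrightarrow> trig_poly \<Lambda> q (\<theta> j) = 0"
  shows "\<exists>J' a'. J' \<subseteq> J \<and> card J' \<le> card \<Lambda> - 1 \<and> (\<forall>j\<in>J'. a' j > 0) \<and>
    (\<forall>k\<in>\<Lambda>. (\<Sum>j\<in>J'. of_real (a' j) * cis (phase k (\<theta> j))) = (\<Sum>j\<in>J. of_real (a j) * cis (phase k (\<theta> j))))"
proof -
  define v where "v j k = cos (phase k (\<theta> j)) + sin (phase k (\<theta> j))" for j k
  define h where "h k = Re (q k) + Im (q k)" for k
  have "\<exists>k0\<in>\<Lambda>. h k0 \<noteq> 0"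
  proof (rule ccontr)
    assume "\<not> (\<exists>k0\<in>\<Lambda>. h k0 \<noteq> 0)"
    then have "q k = 0" if "k \<in> \<Lambda>" for k
      using q(1) that by (intro hartley_inj[of q "\<lambda>_. 0" k]) (auto simp: hermitian_def h_def)
    then have "q = (\<lambda>_. 0)" using q(1) by (auto simp: hermitian_def)
    with q(2) show False by simp
  qed
  then obtain k0 where k0: "k0 \<in> \<Lambda>" "h k0 \<noteq> 0" by blast
  have "\<exists>J' a'. J' \<subseteq> J \<and> card J' \<le> card (\<Lambda> - {k0}) \<and> (\<forall>j\<in>J'. a' j > 0) \<and>
    (\<forall>k\<in>\<Lambda> - {k0}. (\<Sum>j\<in>J'. a' j * v j k) = (\<Sum>j\<in>J. a j * v j k))"
    using finite_freq by (intro conic_caratheodory assms(1,2)) simp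
  then obtain J' a' where *: "J' \<subseteq> J" "card J' \<le> card (\<Lambda> - {k0})" "\<forall>j\<in>J'. a' j > 0"
    "\<forall>k\<in>\<Lambda> - {k0}. (\<Sum>j\<in>J'. a' j * v j k) = (\<Sum>j\<in>J. a j * v j k)"
    by (elim exE conjE)
  have orth: "(\<Sum>k\<in>\<Lambda>. h k * v j k) = 0" if "j \<in> J" for j
  proof -
    have "(\<Sum>k\<in>\<Lambda>. v j k * h k) = pairing \<Lambda> (\<lambda>k. cis (phase k (\<theta> j))) q"
      using q(1) by (subst hartley_pairing) (auto simp: v_def h_def phase_uminus cis_cnj hermitian_def)
    then show ?thesis using q(3)[OF that] by (simp add: pairing_cis mult.commute)
  qed
  \<comment> \<open>The orthogonality relation summed with arbitrary weights and solved for
    coordinate \<open>k0\<close>; used for the old and the new weights alike.\<close>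
  have last: "h k0 * (\<Sum>j\<in>I. b j * v j k0) = - (\<Sum>k\<in>\<Lambda> - {k0}. h k * (\<Sum>j\<in>I. b j * v j k))" if "I \<subseteq> J" for I b
  proof -
    have "(\<Sum>k\<in>\<Lambda>. h k * (\<Sum>j\<in>I. b j * v j k)) = (\<Sum>j\<in>I. b j * (\<Sum>k\<in>\<Lambda>. h k * v j k))"
      unfolding sum_distrib_left by (subst sum.swap) (simp add: mult_ac)
    also have "\<dots> = 0" using orth that by (intro sum.neutral) auto
    finally show ?thesis
      using sum.remove[OF finite_freq k0(1), of "\<lambda>k. h k * (\<Sum>j\<in>I. b j * v j k)"] by simp
  qed
  have "h k0 * (\<Sum>j\<in>J'. a' j * v j k0) = h k0 * (\<Sum>j\<in>J. a j * v j k0)"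
    unfolding last[OF *(1)] last[OF subset_refl] using *(4) by simp
  then have "(\<Sum>j\<in>J'. a' j * v j k0) = (\<Sum>j\<in>J. a j * v j k0)"
    using k0(2) by simp
  with *(4) have eq: "(\<Sum>j\<in>J'. a' j * v j k) = (\<Sum>j\<in>J. a j * v j k)" if "k \<in> \<Lambda>" for k
    using that by (cases "k = k0") auto
  have "(\<Sum>j\<in>J'. of_real (a' j) * cis (phase k (\<theta> j))) = (\<Sum>j\<in>J. of_real (a j) * cis (phase k (\<theta> j)))"
    if "k \<in> \<Lambda>" for k
    using _ _ _ that
  proof (rule hartley_inj)
    fix k assume "k \<in> \<Lambda>"
    then show "Re (\<Sum>j\<in>J'. of_real (a' j) * cis (phase k (\<theta> j))) + Im (\<Sum>j\<in>J'. of_real (a' j) * cis (phase k (\<theta> j))) =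
        Re (\<Sum>j\<in>J. of_real (a j) * cis (phase k (\<theta> j))) + Im (\<Sum>j\<in>J. of_real (a j) * cis (phase k (\<theta> j)))"
      using eq by (simp add: distrib_left sum.distrib v_def)
  qed (rule moments_reflect)+
  moreover have "card J' \<le> card \<Lambda> - 1" using * k0 by simp
  ultimately show ?thesis using * by blast
qed

end

section \<open>Nonnegative functionals as sums of point evaluations\<close>

lemma compact_PiE_UNIV:
  fixes S :: "'i \<Rightarrow> 'a::topological_space set"
  assumes "\<And>i. compact (S i)"
  shows "compact {f. \<forall>i. f i \<in> S i}"
proof -
  have "compactin (product_topology (\<lambda>_. euclidean) UNIV) (PiE UNIV S)"
    using assms by (simp add: compactin_PiE)
  moreover have "PiE UNIV S = {f. \<forall>i. f i \<in> S i}"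
    by auto
  ultimately show ?thesis
    by (simp add: euclidean_product_topology)
qed

text \<open>First-order optimality: dividing by \<open>e\<close> and letting it tend to 0 leaves the
  linear term. The explicit \<open>e\<close> in the proof is small enough that
  \<open>e * d \<le> b < 2 * b\<close>.\<close>

lemma le_zero_if_quadratic_ge:
  fixes b d :: real
  assumes "\<And>e. 0 < e \<Longrightarrow> e < 1 \<Longrightarrow> 0 \<le> e * e * d - 2 * e * b"
  shows "b \<le> 0"
proof (rule ccontr)
  assume "\<not> b \<le> 0"
  then have b: "b > 0" by simp
  define e where "e = min (1 / 2) (b / (\<bar>d\<bar> + 1))"
  have e: "0 < e" "e < 1" "e \<le> b / (\<bar>d\<bar> + 1)" using b by (auto simp: e_def)
  have "e * d \<le> e * (\<bar>d\<bar> + 1)" using e by (intro mult_left_mono) auto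
  also have "\<dots> \<le> b" using e(3) by (simp add: pos_le_divide_eq)
  finally have "e * (e * d - 2 * b) < 0" using e b by (simp add: mult_pos_neg)
  then show False using assms[OF e(1,2)] by (simp add: algebra_simps)
qed

context frequency_set
begin

text \<open>
  If \<open>x\<close> is the point of the moment cone closest to \<open>c\<close>, then \<open>x - c\<close> is a nonnegative polynomial that
  pairs to \<open>-\<parallel>x - c\<parallel>\<^sup>2\<close> with \<open>c\<close>. Closest points exist since boundedly many atoms suffice.
\<close>

lemma moment_representation:
  assumes c: "c \<in> hermitian \<Lambda>"
    and nonneg: "\<And>p. p \<in> hermitian \<Lambda> \<Longrightarrow> (\<And>\<theta>. \<theta> \<in> torus \<Longrightarrow> trig_poly \<Lambda> p \<theta> \<ge> 0) \<Longrightarrow> pairing \<Lambda> c p \<ge> 0"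
  shows "\<exists>n (a :: nat \<Rightarrow> real) \<theta>. (\<forall>j<n. a j \<ge> 0 \<and> \<theta> j \<in> torus) \<and>
    (\<forall>k\<in>\<Lambda>. c k = (\<Sum>j<n. of_real (a j) * cis (phase k (\<theta> j))))"
proof -
  define n where "n = card \<Lambda>"
  define m where "m J a \<theta> k = (\<Sum>j\<in>J. of_real (a j) * cis (phase k (\<theta> j)))"
    for J :: "nat set" and a and \<theta> :: "nat \<Rightarrow> real ^ 'd" and k
  define S where "S x = pairing \<Lambda> x x" for x
  have S_eq: "S x = (\<Sum>k\<in>\<Lambda>. (cmod (x k))\<^sup>2)" for x
    by (simp add: S_def pairing_eq_sum cmod_power2 flip: power2_eq_square)
  have S_nonneg: "S x \<ge> 0" for x by (simp add: S_eq sum_nonneg)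
  have S_ge: "(cmod (x k))\<^sup>2 \<le> S x" if "k \<in> \<Lambda>" for x k
    unfolding S_eq using finite_freq that by (intro member_le_sum) auto
  define Q :: "(real ^ 'd) set" where "Q = cbox (\<chi> j. - pi) (\<chi> j. pi)"
  \<comment> \<open>Only candidates at least as good as the zero measure matter. Their zeroth
    moment, the total mass, lies within \<open>sqrt (S c)\<close> of \<open>c 0\<close>, whose
    modulus has the same bound, so each weight is at most \<open>M\<close>.\<close>
  define M where "M = 2 * sqrt (S c)"
  \<comment> \<open>Infinite sequences of weighted atoms give a compact product; \<open>F\<close>
    reads only the first \<open>n\<close> entries.\<close>
  define D where "D = {f :: nat \<Rightarrow> real \<times> (real ^ 'd). \<forall>j. f j \<in> {0..M} \<times> Q}"
  define F where "F f = S (\<lambda>k. c k - m {..<n} (fst \<circ> f) (snd \<circ> f) k)" for f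
  have "compact D"
    unfolding D_def Q_def by (intro compact_PiE_UNIV compact_Times compact_Icc compact_cbox)
  have zero: "0 \<in> Q" by (simp add: Q_def mem_box_cart)
  have M0: "M \<ge> 0" using S_nonneg by (simp add: M_def)
  have zD: "(\<lambda>_. (0, 0)) \<in> D" using zero M0 by (simp add: D_def)
  have "continuous_on D F"
    unfolding F_def S_eq m_def o_def
    by (intro continuous_intros continuous_on_subset[OF continuous_on_product_coordinates]) auto
  then obtain f where f: "f \<in> D" and f_min: "\<And>g. g \<in> D \<Longrightarrow> F f \<le> F g"
    using continuous_attains_inf[OF \<open>compact D\<close>, of F] zD by blast
  have F0: "F (\<lambda>_. (0, 0)) = S c" by (simp add: F_def m_def)
  have min_n: "F f \<le> S (\<lambda>k. c k - m {..<n} a \<theta> k)"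
    if a: "\<And>j. j < n \<Longrightarrow> a j \<ge> 0" and \<theta>: "\<And>j. j < n \<Longrightarrow> \<theta> j \<in> Q" for a \<theta>
  proof (cases "S (\<lambda>k. c k - m {..<n} a \<theta> k) \<le> S c")
    case False
    then show ?thesis using f_min[OF zD] F0 by simp
  next
    case True
    have m0: "m {..<n} a \<theta> 0 = of_real (\<Sum>j<n. a j)"
      by (simp add: m_def phase_def)
    have "cmod (c 0 - m {..<n} a \<theta> 0) \<le> sqrt (S c)"
      using S_ge[OF zero_freq, of "\<lambda>k. c k - m {..<n} a \<theta> k"] True by (intro real_le_rsqrt) simp
    moreover have "cmod (c 0) \<le> sqrt (S c)"
      using S_ge[OF zero_freq, of c] by (intro real_le_rsqrt)
    ultimately have "cmod (m {..<n} a \<theta> 0) \<le> M"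
      using norm_triangle_ineq4[of "c 0" "c 0 - m {..<n} a \<theta> 0"] by (simp add: M_def)
    then have sum_le: "(\<Sum>j<n. a j) \<le> M"
      unfolding m0 norm_of_real by simp
    have "a j \<le> M" if "j < n" for j
      using member_le_sum[of j "{..<n}" a] a that sum_le by simp
    then have "(\<lambda>j. if j < n then (a j, \<theta> j) else (0, 0)) \<in> D"
      using a \<theta> zero M0 by (simp add: D_def)
    then have "F f \<le> F (\<lambda>j. if j < n then (a j, \<theta> j) else (0, 0))" by (rule f_min)
    also have "\<dots> = S (\<lambda>k. c k - m {..<n} a \<theta> k)"
      by (simp add: F_def m_def)
    finally show ?thesis .
  qed
  \<comment> \<open>Caratheodory extends optimality from \<open>n\<close> atoms to any finite
    number. This is essential, since the variations below add an atom to the \<open>n\<close>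
    optimal ones.\<close>
  have min: "F f \<le> S (\<lambda>k. c k - m J a \<theta> k)"
    if J: "finite J" and a: "\<And>j. j \<in> J \<Longrightarrow> a j \<ge> 0" and \<theta>: "\<And>j. j \<in> J \<Longrightarrow> \<theta> j \<in> Q" for J a \<theta>
  proof -
    have "\<exists>J' a'. J' \<subseteq> J \<and> card J' \<le> card \<Lambda> \<and> (\<forall>j\<in>J'. a' j > 0) \<and>
      (\<forall>k\<in>\<Lambda>. m J' a' \<theta> k = m J a \<theta> k)"
      unfolding m_def by (rule moments_caratheodory[OF J a])
    then obtain J' a' where *: "J' \<subseteq> J" "card J' \<le> n" "\<forall>j\<in>J'. a' j > 0"
      "\<forall>k\<in>\<Lambda>. m J' a' \<theta> k = m J a \<theta> k"
      unfolding n_def by (elim exE conjE)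
    have "finite J'" using *(1) J by (rule finite_subset)
    then obtain h where h: "bij_betw h {..<card J'} J'"
      using ex_bij_betw_nat_finite[of J'] by (auto simp: atLeast0LessThan)
    define a2 where "a2 i = (if i < card J' then a' (h i) else 0)" for i
    define t2 where "t2 i = (if i < card J' then \<theta> (h i) else 0)" for i
    have hJ: "h i \<in> J'" if "i < card J'" for i
      using h that by (auto simp: bij_betw_def)
    have "m {..<n} a2 t2 k = m J' a' \<theta> k" for k
    proof -
      have "m {..<n} a2 t2 k = (\<Sum>i<card J'. of_real (a2 i) * cis (phase k (t2 i)))"
        unfolding m_def using *(2) by (intro sum.mono_neutral_right) (auto simp: a2_def)
      also have "\<dots> = (\<Sum>i<card J'. of_real (a' (h i)) * cis (phase k (\<theta> (h i))))"
        by (simp add: a2_def t2_def)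
      also have "\<dots> = m J' a' \<theta> k"
        unfolding m_def by (rule sum.reindex_bij_betw[OF h])
      finally show ?thesis .
    qed
    then have "S (\<lambda>k. c k - m {..<n} a2 t2 k) = S (\<lambda>k. c k - m J a \<theta> k)"
      unfolding S_eq using *(4) by simp
    moreover have "F f \<le> S (\<lambda>k. c k - m {..<n} a2 t2 k)"
      using *(1,3) hJ \<theta> zero by (intro min_n) (auto simp: a2_def t2_def less_imp_le)
    ultimately show ?thesis by simp
  qed
  define a where "a j = fst (f j)" for j
  define t where "t j = snd (f j)" for j
  have a: "a j \<ge> 0" and t: "t j \<in> Q" for j
    using f by (auto simp: D_def a_def t_def mem_Times_iff)
  define x where "x = m {..<n} a t"
  define u where "u k = c k - x k" for k
  have Ff: "F f = S u" by (simp add: F_def u_def[abs_def] x_def m_def a_def t_def)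
  have quad: "S (\<lambda>k. u k - of_real e * w k) = S u + (e * e * S w - 2 * e * pairing \<Lambda> u w)" for e w
    by (simp add: S_def pairing_eq_sum algebra_simps sum.distrib sum_distrib_left sum_subtractf)
  have add_point: "pairing \<Lambda> u (\<lambda>k. cis (phase k \<theta>)) \<le> 0" if "\<theta> \<in> Q" for \<theta>
  proof (rule le_zero_if_quadratic_ge)
    fix e :: real assume "0 < e" "e < 1"
    have "m {..<Suc n} (a(n := e)) (t(n := \<theta>)) k = x k + of_real e * cis (phase k \<theta>)" for k
      by (simp add: m_def x_def lessThan_Suc)
    then have "S (\<lambda>k. c k - m {..<Suc n} (a(n := e)) (t(n := \<theta>)) k) = S (\<lambda>k. u k - of_real e * cis (phase k \<theta>))"
      by (simp add: u_def algebra_simps)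
    moreover have "F f \<le> S (\<lambda>k. c k - m {..<Suc n} (a(n := e)) (t(n := \<theta>)) k)"
      using a t that \<open>0 < e\<close> by (intro min) auto
    ultimately show "0 \<le> e * e * S (\<lambda>k. cis (phase k \<theta>)) - 2 * e * pairing \<Lambda> u (\<lambda>k. cis (phase k \<theta>))"
      unfolding quad Ff by simp
  qed
  \<comment> \<open>All weights can be rescaled by \<open>1 + e\<close> and by \<open>1 - e\<close>,
    so the one-sided condition holds with both signs and \<open>u\<close> is orthogonal to
    \<open>x\<close>.\<close>
  have scale: "s * pairing \<Lambda> u x \<le> 0" if s: "\<bar>s\<bar> = 1" for s
  proof (rule le_zero_if_quadratic_ge)
    fix e :: real assume e: "0 < e" "e < 1"
    have "1 + e * s \<ge> 0"
      using e s by (cases "s \<ge> 0") auto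
    have "m {..<n} (\<lambda>j. (1 + e * s) * a j) t k = of_real (1 + e * s) * x k" for k
      by (simp add: m_def x_def sum_distrib_left mult.assoc)
    then have "S (\<lambda>k. c k - m {..<n} (\<lambda>j. (1 + e * s) * a j) t k) = S (\<lambda>k. u k - of_real (e * s) * x k)"
      by (simp add: u_def algebra_simps)
    moreover have "F f \<le> S (\<lambda>k. c k - m {..<n} (\<lambda>j. (1 + e * s) * a j) t k)"
      using a t \<open>1 + e * s \<ge> 0\<close> by (intro min) auto
    moreover have "s * s = 1" using s by (auto simp: abs_if split: if_splits)
    ultimately show "0 \<le> e * e * S x - 2 * e * (s * pairing \<Lambda> u x)"
      unfolding quad Ff by (simp add: algebra_simps)
  qed
  have ux: "pairing \<Lambda> u x = 0"
    using scale[of 1] scale[of "- 1"] by simp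
  \<comment> \<open>By \<open>add_point\<close> this is a nonnegative polynomial, hence an
    admissible test for \<open>c\<close>. Combined with orthogonality of \<open>u\<close> and
    \<open>x\<close> it gives \<open>S u \<le> 0\<close>.\<close>
  define p where "p k = (if k \<in> \<Lambda> then - u k else 0)" for k
  have p_pairing: "pairing \<Lambda> y p = - pairing \<Lambda> u y" for y
    unfolding pairing_eq_sum sum_negf[symmetric] by (simp add: p_def mult.commute)
  have "p \<in> hermitian \<Lambda>"
    using c neg_mem by (simp add: hermitian_def p_def u_def x_def m_def phase_uminus cis_cnj)
  moreover have "trig_poly \<Lambda> p \<theta> \<ge> 0" if "\<theta> \<in> torus" for \<theta>
  proof -
    have "\<theta> \<in> Q" using that by (auto simp: Q_def torus_def mem_box_cart less_imp_le)
    then show ?thesis using add_point p_pairing[of "\<lambda>k. cis (phase k \<theta>)"] by (simp add: pairing_cis)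
  qed
  ultimately have "pairing \<Lambda> u c \<le> 0"
    using nonneg[of p] p_pairing[of c] by simp
  moreover have "pairing \<Lambda> u c = S u + pairing \<Lambda> u x"
    unfolding S_def pairing_eq_sum sum.distrib[symmetric]
    by (intro sum.cong) (simp_all add: u_def algebra_simps)
  ultimately have "S u \<le> 0" using ux by simp
  then have "c k = x k" if "k \<in> \<Lambda>" for k
  proof -
    have "(cmod (u k))\<^sup>2 \<le> 0" using S_ge[OF that, of u] \<open>S u \<le> 0\<close> by linarith
    then show ?thesis by (simp add: u_def)
  qed
  moreover have "\<forall>j. \<exists>\<phi>\<in>torus. \<forall>k. cis (phase k \<phi>) = cis (phase k (t j))"
    using t by (intro allI cis_phase_torus_rep) (simp add: Q_def)
  then obtain \<theta> where "\<And>j. \<theta> j \<in> torus" "\<And>j k. cis (phase k (\<theta> j)) = cis (phase k (t j))"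
    by metis
  ultimately show ?thesis
    using a by (intro exI[of _ n] exI[of _ a] exI[of _ \<theta>]) (simp add: x_def m_def)
qed

end

section \<open>Atomic measures on the torus\<close>

definition atomic_measure :: "'j set \<Rightarrow> ('j \<Rightarrow> real) \<Rightarrow> ('j \<Rightarrow> real ^ 'd) \<Rightarrow> (real ^ 'd) measure" where
  "atomic_measure J a \<theta> = distr (point_measure J (\<lambda>j. ennreal (a j))) torus_measure \<theta>"

lemma measurable_atoms:
  assumes "\<And>j. j \<in> J \<Longrightarrow> \<theta> j \<in> torus"
  shows "\<theta> \<in> measurable (point_measure J w) torus_measure"
  using assms by (simp add: measurable_def point_measure_def space_torus_measure Pi_iff sets_point_measure)

lemma sets_atomic_measure [simp]: "sets (atomic_measure J a \<theta>) = sets torus_measure"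
  by (simp add: atomic_measure_def)

text \<open>The sum runs over indices and not over points, so \<open>\<theta>\<close> may repeat
  atoms and their masses add up.\<close>

lemma emeasure_atomic_measure:
  assumes "finite J" "\<And>j. j \<in> J \<Longrightarrow> \<theta> j \<in> torus" "A \<in> sets torus_measure"
  shows "emeasure (atomic_measure J a \<theta>) A = (\<Sum>j\<in>{j \<in> J. \<theta> j \<in> A}. ennreal (a j))"
proof -
  have "emeasure (atomic_measure J a \<theta>) A = emeasure (point_measure J (\<lambda>j. ennreal (a j))) {j \<in> J. \<theta> j \<in> A}"
    unfolding atomic_measure_def using assms measurable_atoms[of J \<theta>]
    by (subst emeasure_distr) (auto simp: space_point_measure intro!: arg_cong2[where f=emeasure])
  also have "\<dots> = (\<Sum>j\<in>{j \<in> J. \<theta> j \<in> A}. ennreal (a j))"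
    using assms(1) by (intro emeasure_point_measure_finite) auto
  finally show ?thesis .
qed

lemma atomic_measure_bounded:
  assumes "finite J" "\<And>j. j \<in> J \<Longrightarrow> \<theta> j \<in> torus"
  shows "atomic_measure J a \<theta> \<in> bounded_measures"
proof -
  have "emeasure (atomic_measure J a \<theta>) (space (atomic_measure J a \<theta>)) < \<infinity>"
    using assms emeasure_atomic_measure[OF assms sets.top] sets_eq_imp_space_eq[OF sets_atomic_measure[of J a \<theta>]]
    by simp
  then show ?thesis
    by (auto simp: bounded_measures_def intro: finite_measureI)
qed

lemma integral_atomic_measure:
  fixes f :: "real ^ 'd \<Rightarrow> complex"
  assumes "finite J" "\<And>j. j \<in> J \<Longrightarrow> \<theta> j \<in> torus" "\<And>j. j \<in> J \<Longrightarrow> a j \<ge> 0"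
    and "f \<in> borel_measurable torus_measure"
  shows "(LINT x|atomic_measure J a \<theta>. f x) = (\<Sum>j\<in>J. of_real (a j) * f (\<theta> j))"
proof -
  have "(LINT x|atomic_measure J a \<theta>. f x) = (LINT j|point_measure J (\<lambda>j. ennreal (a j)). f (\<theta> j))"
    unfolding atomic_measure_def using assms(4) measurable_atoms[of J \<theta>, OF assms(2)]
    by (intro integral_distr) (auto simp: space_torus_measure assms(2))
  also have "\<dots> = (\<Sum>j\<in>J. a j *\<^sub>R f (\<theta> j))"
    using assms by (intro lebesgue_integral_point_measure_finite) auto
  finally show ?thesis by (simp add: scaleR_conv_of_real)
qed

lemma finite_subset_torus_null:
  fixes F :: "(real ^ 'd) set"
  assumes "finite F" "F \<subseteq> torus"
  shows "F \<in> null_sets torus_measure"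
proof -
  have F: "F \<in> sets torus_measure"
    using assms by (auto simp: sets_torus_measure sets_restrict_space_iff finite_imp_closed)
  have "emeasure torus_measure F = ennreal ((1 / (2 * pi)) ^ CARD('d)) * emeasure lborel F"
    using assms by (simp add: torus_measure_def emeasure_restrict_space)
  also have "emeasure lborel F = 0"
    using assms(1) by (rule emeasure_lborel_countable[OF countable_finite])
  finally show ?thesis using F by (simp add: null_sets_def)
qed

lemma singular_atomic_measure:
  assumes "finite J" "\<And>j. j \<in> J \<Longrightarrow> \<theta> j \<in> torus"
  shows "singular_measure (atomic_measure J a \<theta>)"
  unfolding singular_measure_def
proof
  show N: "\<theta> ` J \<in> null_sets torus_measure"
    using assms by (intro finite_subset_torus_null) auto
  have "space torus_measure - \<theta> ` J \<in> sets torus_measure" using N by auto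
  moreover have "{j \<in> J. \<theta> j \<in> space torus_measure - \<theta> ` J} = {}" by auto
  ultimately show "emeasure (atomic_measure J a \<theta>) (space torus_measure - \<theta> ` J) = 0"
    using emeasure_atomic_measure[OF assms, where A = "space torus_measure - \<theta> ` J"] by (simp only: sum.empty)
qed

lemma measure_supp_atomic_measure:
  fixes \<theta> :: "'j \<Rightarrow> real ^ 'd"
  assumes "finite J" "\<And>j. j \<in> J \<Longrightarrow> \<theta> j \<in> torus"
  shows "measure_supp (atomic_measure J a \<theta>) \<subseteq> \<theta> ` J"
proof
  fix x assume x: "x \<in> measure_supp (atomic_measure J a \<theta>)"
  then have "x \<in> torus" by (simp add: measure_supp_def)
  show "x \<in> \<theta> ` J"
  proof (rule ccontr)
    assume "x \<notin> \<theta> ` J"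
    \<comment> \<open>Stating "different from every atom" through \<open>cis\<close> makes this open
      set periodic. Its reduction to the torus therefore still misses the atoms, as the quotient
      topology in \<open>measure_supp\<close> demands.\<close>
    define U where "U = (\<Inter>j\<in>J. \<Union>i. {y :: real ^ 'd. cis (y $ i) \<noteq> cis (\<theta> j $ i)})"
    have "open U"
      unfolding U_def using assms(1)
      by (intro open_INT open_UN ballI open_Collect_neq continuous_intros)
    moreover have "x \<in> U"
      unfolding U_def
    proof
      fix j assume "j \<in> J"
      then have "x \<noteq> \<theta> j" using \<open>x \<notin> \<theta> ` J\<close> by auto
      then obtain i where i: "x $ i \<noteq> \<theta> j $ i" by (auto simp: vec_eq_iff)
      moreover have "- pi < x $ i \<and> x $ i \<le> pi" "- pi < \<theta> j $ i \<and> \<theta> j $ i \<le> pi"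
        using \<open>x \<in> torus\<close> assms(2)[OF \<open>j \<in> J\<close>] by (auto simp: torus_def)
      ultimately have "cis (x $ i) \<noteq> cis (\<theta> j $ i)"
        using Arg_cis[of "x $ i"] Arg_cis[of "\<theta> j $ i"] by auto
      then show "x \<in> (\<Union>i. {y. cis (y $ i) \<noteq> cis (\<theta> j $ i)})" by auto
    qed
    ultimately have pos: "emeasure (atomic_measure J a \<theta>) {\<phi>\<in>torus. \<exists>n :: int ^ 'd. (\<chi> j. \<phi> $ j + 2 * pi * of_int (n $ j)) \<in> U} > 0"
      using x by (simp add: measure_supp_def)
    let ?V = "{\<phi>\<in>torus. \<exists>n :: int ^ 'd. (\<chi> j. \<phi> $ j + 2 * pi * of_int (n $ j)) \<in> U}"
    \<comment> \<open>A set outside the sigma-algebra has \<open>emeasure\<close> 0, so positivity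
      already gives measurability.\<close>
    have "?V \<in> sets torus_measure"
      using pos emeasure_notin_sets[of ?V "atomic_measure J a \<theta>"] by force
    moreover have "\<theta> j \<notin> ?V" if "j \<in> J" for j
    proof
      assume "\<theta> j \<in> ?V"
      then obtain n :: "int ^ 'd" where "(\<chi> i. \<theta> j $ i + 2 * pi * of_int (n $ i)) \<in> U" by blast
      then have "\<forall>l\<in>J. \<exists>i. cis (\<theta> j $ i + 2 * pi * of_int (n $ i)) \<noteq> cis (\<theta> l $ i)"
        by (simp add: U_def)
      then have "\<exists>i. cis (\<theta> j $ i + 2 * pi * of_int (n $ i)) \<noteq> cis (\<theta> j $ i)"
        using that by (rule bspec)
      then obtain i where "cis (\<theta> j $ i + 2 * pi * of_int (n $ i)) \<noteq> cis (\<theta> j $ i)"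
        by (rule exE)
      then show False
        by (simp only: cis_mult[symmetric] cis_multiple_2pi[OF Ints_of_int]) simp
    qed
    then have "{j \<in> J. \<theta> j \<in> ?V} = {}" by blast
    ultimately have "emeasure (atomic_measure J a \<theta>) ?V = 0"
      using emeasure_atomic_measure[OF assms, where A = ?V] by (simp only: sum.empty)
    with pos show False by simp
  qed
qed

section \<open>The dual functional\<close>

lemma ext_integral_mono_AE:
  assumes "AE x in M. f x \<le> g x"
  shows "ext_integral M f \<le> ext_integral M g"
proof -
  have "(\<integral>\<^sup>+x. e2ennreal (f x) \<partial>M) \<le> (\<integral>\<^sup>+x. e2ennreal (g x) \<partial>M)"
    using assms by (intro nn_integral_mono_AE) (auto elim!: eventually_mono intro: e2ennreal_mono)
  moreover have "(\<integral>\<^sup>+x. e2ennreal (- g x) \<partial>M) \<le> (\<integral>\<^sup>+x. e2ennreal (- f x) \<partial>M)"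
    using assms by (intro nn_integral_mono_AE) (auto elim!: eventually_mono intro: e2ennreal_mono)
  ultimately show ?thesis
    unfolding ext_integral_def by (intro ereal_minus_mono) (auto simp: less_eq_ennreal.rep_eq)
qed

lemma ext_integral_eq_integral:
  assumes "integrable M g" "AE x in M. f x = ereal (g x)"
  shows "ext_integral M f = ereal (LINT x|M. g x)"
proof -
  have "(\<integral>\<^sup>+x. e2ennreal (f x) \<partial>M) = (\<integral>\<^sup>+x. ennreal (g x) \<partial>M)"
    using assms(2) by (intro nn_integral_cong_AE) (auto elim!: eventually_mono simp: ennreal.abs_eq)
  moreover have "(\<integral>\<^sup>+x. e2ennreal (- f x) \<partial>M) = (\<integral>\<^sup>+x. ennreal (- g x) \<partial>M)"
    using assms(2) by (intro nn_integral_cong_AE) (auto elim!: eventually_mono simp: ennreal.abs_eq)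
  moreover obtain a b where "(\<integral>\<^sup>+x. ennreal (g x) \<partial>M) = ennreal a" "a \<ge> 0"
    "(\<integral>\<^sup>+x. ennreal (- g x) \<partial>M) = ennreal b" "b \<ge> 0"
    using assms(1) unfolding real_integrable_def
    by (metis ennreal_cases infinity_ennreal_def)
  ultimately show ?thesis
    using real_lebesgue_integral_def[OF assms(1)] by (simp add: ext_integral_def)
qed

text \<open>Fatou's lemma packaged to give integrability and the bound together, without a
  dominating function. It serves both the lower semicontinuity argument, with varying
  \<open>b\<close>, and the first variation, with constant \<open>b\<close>.\<close>

lemma integrable_fatou_bound:
  fixes g :: "'a \<Rightarrow> real"
  assumes "\<And>n::nat. integrable M (G n)" "\<And>n. AE x in M. G n x \<ge> 0"
    and lim: "AE x in M. (\<lambda>n. G n x) \<longlonglongrightarrow> g x" and g: "g \<in> borel_measurable M"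
    and le: "\<And>n. (LINT x|M. G n x) \<le> b n" and b: "b \<longlonglongrightarrow> B"
  shows "integrable M g" "(LINT x|M. g x) \<le> B"
proof -
  have [measurable]: "G n \<in> borel_measurable M" for n using assms(1) by auto
  have "AE x in M. \<forall>n. G n x \<ge> 0" using assms(2) by (simp add: AE_all_countable)
  with lim have nonneg: "AE x in M. g x \<ge> 0"
    by eventually_elim (rule LIMSEQ_le_const, auto)
  have b_nonneg: "b n \<ge> 0" for n
    using integral_nonneg_AE[OF assms(2)[of n]] le[of n] by simp
  have "B \<ge> 0" using b by (rule LIMSEQ_le_const) (use b_nonneg in auto)
  have "(\<integral>\<^sup>+x. ennreal (g x) \<partial>M) = (\<integral>\<^sup>+x. liminf (\<lambda>n. ennreal (G n x)) \<partial>M)"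
  proof (rule nn_integral_cong_AE)
    show "AE x in M. ennreal (g x) = liminf (\<lambda>n. ennreal (G n x))"
      using lim
    proof eventually_elim
      case (elim x)
      then have "(\<lambda>n. ennreal (G n x)) \<longlonglongrightarrow> ennreal (g x)" by (rule tendsto_ennrealI)
      then show ?case by (rule lim_imp_Liminf[symmetric, rotated]) simp
    qed
  qed
  also have "\<dots> \<le> liminf (\<lambda>n. \<integral>\<^sup>+x. ennreal (G n x) \<partial>M)"
    by (rule nn_integral_liminf) simp
  also have "\<dots> \<le> liminf (\<lambda>n. ennreal (b n))"
  proof (intro Liminf_mono always_eventually allI)
    fix n
    have "(\<integral>\<^sup>+x. ennreal (G n x) \<partial>M) = ennreal (LINT x|M. G n x)"
      by (rule nn_integral_eq_integral[OF assms(1,2)])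
    also have "\<dots> \<le> ennreal (b n)" using le by (rule ennreal_leI)
    finally show "(\<integral>\<^sup>+x. ennreal (G n x) \<partial>M) \<le> ennreal (b n)" .
  qed
  also have "\<dots> = ennreal B"
    using tendsto_ennrealI[OF b] by (intro lim_imp_Liminf) simp_all
  finally have bound: "(\<integral>\<^sup>+x. ennreal (g x) \<partial>M) \<le> ennreal B" .
  show "integrable M g"
  proof (rule integrableI_nonneg)
    show "(\<integral>\<^sup>+x. ennreal (g x) \<partial>M) < \<infinity>"
      using bound by (rule le_less_trans) simp
  qed (use g nonneg in auto)
  then have "ennreal (LINT x|M. g x) \<le> ennreal B"
    using bound nn_integral_eq_integral[of M g] nonneg by simp
  then show "(LINT x|M. g x) \<le> B"
    using \<open>B \<ge> 0\<close> by (simp add: ennreal_le_iff)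
qed

text \<open>Both endpoints are compared with the tangent line of \<open>ln\<close> at the weighted
  mean \<open>w\<close>; the tangent inequality is strict since neither endpoint equals
  \<open>w\<close>.\<close>

lemma ln_strictly_concave:
  fixes a b t :: real
  assumes "a > 0" "b > 0" "a \<noteq> b" "0 < t" "t < 1"
  shows "(1 - t) * ln a + t * ln b < ln ((1 - t) * a + t * b)"
proof -
  define w where "w = (1 - t) * a + t * b"
  have w: "w > 0" using assms by (simp add: w_def add_pos_pos)
  have less: "ln (x / w) < x / w - 1" if "x > 0" "x \<noteq> w" for x
  proof -
    have "x / w > 0" "x / w \<noteq> 1" using that w by auto
    then show ?thesis using ln_le_minus_one[of "x / w"] ln_eq_minus_one[of "x / w"] by fastforce
  qed
  have "a - w = t * (a - b)" "b - w = (1 - t) * (b - a)"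
    by (simp_all add: w_def algebra_simps)
  then have "a \<noteq> w" "b \<noteq> w" using assms by auto
  then have "(1 - t) * ln (a / w) + t * ln (b / w) < (1 - t) * (a / w - 1) + t * (b / w - 1)"
    using assms by (intro add_strict_mono mult_strict_left_mono less) auto
  also have "\<dots> = ((1 - t) * a + t * b) / w - 1"
    by (simp add: field_simps diff_divide_distrib add_divide_distrib)
  also have "\<dots> = 0" using w by (simp add: w_def)
  finally have "(1 - t) * (ln a - ln w) + t * (ln b - ln w) < 0"
    using assms w by (simp add: ln_div)
  then show ?thesis
    unfolding w_def[symmetric] by (simp add: algebra_simps)
qed

section \<open>Finiteness and strict convexity of the dual functional\<close>

lemma continuous_on_trig_poly [continuous_intros]:
  "continuous_on S f \<Longrightarrow> continuous_on S (\<lambda>x. trig_poly \<Lambda> q (f x))"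
  unfolding trig_poly_def by (intro continuous_intros)

lemma measurable_trig_poly [measurable]: "trig_poly \<Lambda> q \<in> borel_measurable torus_measure"
  by (intro borel_measurable_torus borel_measurable_continuous_onI continuous_intros)

lemma measurable_cis_phase [measurable]: "(\<lambda>\<theta>. cis (phase k \<theta>)) \<in> borel_measurable torus_measure"
  by (intro borel_measurable_torus borel_measurable_continuous_onI continuous_intros)

lemma abs_trig_poly_le: "\<bar>trig_poly \<Lambda> q \<theta>\<bar> \<le> (\<Sum>k\<in>\<Lambda>. cmod (q k))"
proof -
  have "\<bar>trig_poly \<Lambda> q \<theta>\<bar> \<le> cmod (\<Sum>k\<in>\<Lambda>. q k * cis (- phase k \<theta>))"
    unfolding trig_poly_def by (rule abs_Re_le_cmod)
  also have "\<dots> \<le> (\<Sum>k\<in>\<Lambda>. cmod (q k * cis (- phase k \<theta>)))" by (rule norm_sum)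
  finally show ?thesis by (simp add: norm_mult)
qed

lemma hermitian_lincomb:
  "x \<in> hermitian \<Lambda> \<Longrightarrow> y \<in> hermitian \<Lambda> \<Longrightarrow> (\<lambda>k. of_real a * x k + of_real b * y k) \<in> hermitian \<Lambda>"
  by (simp add: hermitian_def)

context frequency_set
begin

lemma nonneg_polysD:
  assumes "q \<in> nonneg_polys \<Lambda>"
  shows "q \<in> hermitian \<Lambda>" "\<And>\<theta>. \<theta> \<in> torus \<Longrightarrow> trig_poly \<Lambda> q \<theta> \<ge> 0"
  using assms nonneg_polys_iff[OF finite_freq zero_freq] by auto

lemma nonneg_polys_lincomb:
  assumes "x \<in> nonneg_polys \<Lambda>" "y \<in> nonneg_polys \<Lambda>" "a \<ge> 0" "b \<ge> 0"
  shows "(\<lambda>k. of_real a * x k + of_real b * y k) \<in> nonneg_polys \<Lambda>"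
  using assms by (simp add: nonneg_polys_iff[OF finite_freq zero_freq] hermitian_lincomb trig_poly_lincomb)

lemma nn_integral_neg_log_trig_poly:
  assumes "q \<in> hermitian \<Lambda>" "q \<noteq> (\<lambda>_. 0)"
  shows "(\<integral>\<^sup>+\<theta>. neg_log \<bar>trig_poly \<Lambda> q \<theta>\<bar> \<partial>torus_measure) < \<infinity>"
proof -
  obtain k0 where k0: "q k0 \<noteq> 0" using assms(2) by auto
  then have "k0 \<in> \<Lambda>" using assms(1) by (auto simp: hermitian_def)
  moreover have "\<bar>trig_poly \<Lambda> q \<theta>\<bar> = cmod (\<Sum>k\<in>\<Lambda>. q k * cis (- phase k \<theta>))" for \<theta>
    using of_real_trig_poly[OF uminus_freq assms(1), of \<theta>] by (metis norm_of_real)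
  ultimately show ?thesis
    using nn_integral_neg_log_trig[of \<Lambda> k0 q] finite_freq k0 by simp
qed

text \<open>A by-product of the logarithmic estimate: the integrand is infinite at every zero, and
  its integral is finite.\<close>

lemma AE_trig_poly_nonzero:
  assumes "q \<in> hermitian \<Lambda>" "q \<noteq> (\<lambda>_. 0)"
  shows "AE \<theta> in torus_measure. trig_poly \<Lambda> q \<theta> \<noteq> 0"
proof -
  have "AE \<theta> in torus_measure. neg_log \<bar>trig_poly \<Lambda> q \<theta>\<bar> \<noteq> \<infinity>"
    using nn_integral_neg_log_trig_poly[OF assms]
    by (intro nn_integral_PInf_AE measurable_compose[OF _ measurable_neg_log]) auto
  then show ?thesis
    by eventually_elim (auto simp: neg_log_nonpos)
qed

lemma AE_trig_poly_pos:
  assumes "q \<in> nonneg_polys \<Lambda>" "q \<noteq> (\<lambda>_. 0)"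
  shows "AE \<theta> in torus_measure. trig_poly \<Lambda> q \<theta> > 0"
  using AE_trig_poly_nonzero[OF nonneg_polysD(1)[OF assms(1)] assms(2)] AE_space
  by eventually_elim (use nonneg_polysD(2)[OF assms(1)] in \<open>force simp: space_torus_measure less_le\<close>)

lemma integrable_trig_poly_mult:
  assumes "integrable torus_measure f"
  shows "integrable torus_measure (\<lambda>\<theta>. f \<theta> * trig_poly \<Lambda> q \<theta>)"
proof (rule Bochner_Integration.integrable_bound[OF integrable_mult_left[OF integrable_norm[OF assms]]])
  show "AE \<theta> in torus_measure. norm (f \<theta> * trig_poly \<Lambda> q \<theta>) \<le> norm (norm (f \<theta>) * (\<Sum>k\<in>\<Lambda>. cmod (q k)))"
  proof (intro AE_I2)
    fix \<theta>
    have "norm (f \<theta> * trig_poly \<Lambda> q \<theta>) \<le> norm (f \<theta>) * (\<Sum>k\<in>\<Lambda>. cmod (q k))"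
      unfolding norm_mult real_norm_def[of "trig_poly \<Lambda> q \<theta>"] by (intro mult_left_mono abs_trig_poly_le) simp
    then show "norm (f \<theta> * trig_poly \<Lambda> q \<theta>) \<le> norm (norm (f \<theta>) * (\<Sum>k\<in>\<Lambda>. cmod (q k)))"
      by (metis abs_ge_self order_trans real_norm_def)
  qed
qed (use assms in measurable)

lemma integrable_trig_poly: "integrable torus_measure (trig_poly \<Lambda> q)"
  using integrable_trig_poly_mult[of "\<lambda>_. 1" q] finite_measure.integrable_const[OF finite_measure_torus, of 1] by simp

text \<open>The positive part of the logarithm is below the polynomial itself, because
  \<open>ln y \<le> y - 1\<close>; the negative part is \<open>neg_log\<close>.\<close>

lemma integrable_ln_trig_poly:
  assumes "q \<in> nonneg_polys \<Lambda>" "q \<noteq> (\<lambda>_. 0)"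
  shows "integrable torus_measure (\<lambda>\<theta>. ln (trig_poly \<Lambda> q \<theta>))"
proof (rule integrableI_bounded)
  have "(\<integral>\<^sup>+\<theta>. norm (ln (trig_poly \<Lambda> q \<theta>)) \<partial>torus_measure) \<le>
      (\<integral>\<^sup>+\<theta>. ennreal (trig_poly \<Lambda> q \<theta>) + neg_log \<bar>trig_poly \<Lambda> q \<theta>\<bar> \<partial>torus_measure)"
  proof (rule nn_integral_mono_AE)
    show "AE \<theta> in torus_measure. ennreal (norm (ln (trig_poly \<Lambda> q \<theta>))) \<le>
        ennreal (trig_poly \<Lambda> q \<theta>) + neg_log \<bar>trig_poly \<Lambda> q \<theta>\<bar>"
      using AE_trig_poly_pos[OF assms]
    proof eventually_elim
      case (elim \<theta>)
      then show ?case
        using ln_le_minus_one[OF elim]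
        by (cases "ln (trig_poly \<Lambda> q \<theta>) \<ge> 0") (auto simp: neg_log_pos ennreal_plus_if intro!: ennreal_leI)
    qed
  qed
  also have "\<dots> = (\<integral>\<^sup>+\<theta>. ennreal (trig_poly \<Lambda> q \<theta>) \<partial>torus_measure) + (\<integral>\<^sup>+\<theta>. neg_log \<bar>trig_poly \<Lambda> q \<theta>\<bar> \<partial>torus_measure)"
    by (intro nn_integral_add measurable_compose[OF _ measurable_neg_log]) auto
  also have "\<dots> < \<infinity>"
    using nn_integral_neg_log_trig_poly[OF nonneg_polysD(1)[OF assms(1)] assms(2)]
      integrable_trig_poly[of q] by (auto simp: real_integrable_def less_top)
  finally show "(\<integral>\<^sup>+\<theta>. norm (ln (trig_poly \<Lambda> q \<theta>)) \<partial>torus_measure) < \<infinity>" .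
qed measurable

lemma integrable_entropy:
  assumes "q \<in> nonneg_polys \<Lambda>" "q \<noteq> (\<lambda>_. 0)"
  shows "integrable torus_measure (\<lambda>\<theta>. trig_poly \<Lambda> p \<theta> * ln (trig_poly \<Lambda> q \<theta>))"
  using integrable_trig_poly_mult[OF integrable_ln_trig_poly[OF assms], of p] by (simp add: mult.commute)

text \<open>A real-valued version of the dual functional, meaningful for nonzero nonnegative
  polynomials only: there zeros are null, so the convention \<open>ln 0 = 0\<close> does no
  harm.\<close>

definition real_dual :: "(int ^ 'd \<Rightarrow> complex) \<Rightarrow> (int ^ 'd \<Rightarrow> complex) \<Rightarrow> (int ^ 'd \<Rightarrow> complex) \<Rightarrow> real" where
  "real_dual c p q = pairing \<Lambda> c q - (LINT \<theta>|torus_measure. trig_poly \<Lambda> p \<theta> * ln (trig_poly \<Lambda> q \<theta>))"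

lemma dual_functional_eq:
  assumes "q \<in> nonneg_polys \<Lambda>" "q \<noteq> (\<lambda>_. 0)"
  shows "dual_functional \<Lambda> c p q = ereal (real_dual c p q)"
proof -
  have "AE \<theta> in torus_measure. ereal (trig_poly \<Lambda> p \<theta>) * ext_ln (trig_poly \<Lambda> q \<theta>) =
      ereal (trig_poly \<Lambda> p \<theta> * ln (trig_poly \<Lambda> q \<theta>))"
    using AE_trig_poly_pos[OF assms] by eventually_elim (simp add: ext_ln_def)
  then have "ext_integral torus_measure (\<lambda>\<theta>. ereal (trig_poly \<Lambda> p \<theta>) * ext_ln (trig_poly \<Lambda> q \<theta>)) =
      ereal (LINT \<theta>|torus_measure. trig_poly \<Lambda> p \<theta> * ln (trig_poly \<Lambda> q \<theta>))"
    by (rule ext_integral_eq_integral[OF integrable_entropy[OF assms]])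
  then show ?thesis
    using assms(2) by (simp add: dual_functional_def real_dual_def)
qed

lemma nonneg_comb_nonzero:
  assumes "x \<in> nonneg_polys \<Lambda>" "x \<noteq> (\<lambda>_. 0)" "y \<in> nonneg_polys \<Lambda>" "a > 0" "b \<ge> 0"
  shows "(\<lambda>k. of_real a * x k + of_real b * y k) \<noteq> (\<lambda>_. 0)"
proof
  assume "(\<lambda>k. of_real a * x k + of_real b * y k) = (\<lambda>_. 0)"
  then have zero: "a * trig_poly \<Lambda> x \<theta> + b * trig_poly \<Lambda> y \<theta> = 0" for \<theta>
    unfolding trig_poly_lincomb[symmetric] by (simp add: trig_poly_def)
  have "AE \<theta> in torus_measure. trig_poly \<Lambda> x \<theta> > 0 \<and> \<theta> \<in> torus"
    using AE_trig_poly_pos[OF assms(1,2)] AE_space[of torus_measure]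
    by eventually_elim (simp add: space_torus_measure)
  then obtain \<theta> where "trig_poly \<Lambda> x \<theta> > 0" "\<theta> \<in> torus" using AE_torus_imp_ex by blast
  then show False
    using zero[of \<theta>] assms(4,5) nonneg_polysD(2)[OF assms(3)] by (smt (verit) mult_pos_pos mult_nonneg_nonneg)
qed

text \<open>The pairing is linear, so strictness must come from the logarithm. It survives
  integration because \<open>P\<close> is positive and the two polynomials differ almost everywhere,
  their difference being a nonzero polynomial.\<close>

lemma real_dual_strictly_convex:
  assumes p: "p \<in> nonneg_polys \<Lambda>" "p \<noteq> (\<lambda>_. 0)"
    and x: "x \<in> nonneg_polys \<Lambda>" "x \<noteq> (\<lambda>_. 0)" and y: "y \<in> nonneg_polys \<Lambda>" "y \<noteq> (\<lambda>_. 0)"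
    and "x \<noteq> y" and t: "0 < t" "t < 1"
  shows "real_dual c p (\<lambda>k. of_real (1 - t) * x k + of_real t * y k) < (1 - t) * real_dual c p x + t * real_dual c p y"
proof -
  let ?T = "trig_poly \<Lambda>" and ?m = "torus_measure :: (real ^ 'd) measure"
  let ?z = "\<lambda>k. of_real (1 - t) * x k + of_real t * y k"
  have z: "?z \<in> nonneg_polys \<Lambda>" "?z \<noteq> (\<lambda>_. 0)"
    using nonneg_polys_lincomb[OF x(1) y(1), of "1 - t" t] nonneg_comb_nonzero[OF x y(1), of "1 - t" t] t by auto
  let ?d = "\<lambda>k. of_real 1 * x k + of_real (- 1) * y k"
  have "?d \<in> hermitian \<Lambda>"
    using nonneg_polysD(1) x y by (intro hermitian_lincomb)
  moreover have "?d \<noteq> (\<lambda>_. 0)"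
    using \<open>x \<noteq> y\<close> by (auto simp: fun_eq_iff)
  ultimately have "AE \<theta> in ?m. ?T ?d \<theta> \<noteq> 0" by (rule AE_trig_poly_nonzero)
  then have ne: "AE \<theta> in ?m. ?T x \<theta> \<noteq> ?T y \<theta>"
    unfolding trig_poly_lincomb by eventually_elim simp
  have "(LINT \<theta>|?m. (1 - t) * (?T p \<theta> * ln (?T x \<theta>)) + t * (?T p \<theta> * ln (?T y \<theta>))) < (LINT \<theta>|?m. ?T p \<theta> * ln (?T ?z \<theta>))"
  proof (rule finite_measure.integral_less_AE_space[OF finite_measure_torus])
    show "AE \<theta> in ?m. (1 - t) * (?T p \<theta> * ln (?T x \<theta>)) + t * (?T p \<theta> * ln (?T y \<theta>)) < ?T p \<theta> * ln (?T ?z \<theta>)"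
      using ne AE_trig_poly_pos[OF p] AE_trig_poly_pos[OF x] AE_trig_poly_pos[OF y]
    proof eventually_elim
      case (elim \<theta>)
      have "?T p \<theta> * ((1 - t) * ln (?T x \<theta>) + t * ln (?T y \<theta>)) < ?T p \<theta> * ln ((1 - t) * ?T x \<theta> + t * ?T y \<theta>)"
        using elim t by (intro mult_strict_left_mono ln_strictly_concave) auto
      then show ?case unfolding trig_poly_lincomb by (simp add: algebra_simps)
    qed
    show "emeasure ?m (space ?m) \<noteq> 0" using emeasure_torus_pos by (metis less_irrefl)
  qed (use integrable_entropy x y z in auto)
  then show ?thesis
    using integrable_entropy[OF x, of p] integrable_entropy[OF y, of p]
    unfolding real_dual_def pairing_lincomb by (simp add: algebra_simps)
qed

lemma dual_functional_strictly_convex: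
  assumes p: "p \<in> nonneg_polys \<Lambda>" "p \<noteq> (\<lambda>_. 0)"
  shows "strictly_convex_on (nonneg_polys \<Lambda>) (dual_functional \<Lambda> c p)"
  unfolding strictly_convex_on_def
proof (intro ballI allI impI)
  fix x y and t :: real
  assume x: "x \<in> nonneg_polys \<Lambda>" and y: "y \<in> nonneg_polys \<Lambda>" and "x \<noteq> y" and t: "0 < t" "t < 1"
  let ?z = "\<lambda>k. of_real (1 - t) * x k + of_real t * y k"
  have z: "?z \<in> nonneg_polys \<Lambda>"
    using nonneg_polys_lincomb[OF x y, of "1 - t" t] t by auto
  have infty: "dual_functional \<Lambda> c p (\<lambda>_. 0) = \<infinity>" by (simp add: dual_functional_def)
  \<comment> \<open>If an endpoint is 0, the right-hand side is \<open>\<infinity>\<close>, while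
    the interior point is nonzero and has a finite value.\<close>
  consider "x = (\<lambda>_. 0)" | "y = (\<lambda>_. 0)" | "x \<noteq> (\<lambda>_. 0)" "y \<noteq> (\<lambda>_. 0)" by blast
  then show "dual_functional \<Lambda> c p ?z < ereal (1 - t) * dual_functional \<Lambda> c p x + ereal t * dual_functional \<Lambda> c p y"
  proof cases
    case 1
    then have y0: "y \<noteq> (\<lambda>_. 0)" using \<open>x \<noteq> y\<close> by auto
    have "?z \<noteq> (\<lambda>_. 0)"
      using nonneg_comb_nonzero[OF y y0 x, of t "1 - t"] t by (simp add: add.commute)
    then show ?thesis
      using dual_functional_eq[OF z] dual_functional_eq[OF y y0] infty t 1 by simp
  next
    case 2
    then have x0: "x \<noteq> (\<lambda>_. 0)" using \<open>x \<noteq> y\<close> by auto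
    have "?z \<noteq> (\<lambda>_. 0)"
      using nonneg_comb_nonzero[OF x x0 y, of "1 - t" t] t by simp
    then show ?thesis
      using dual_functional_eq[OF z] dual_functional_eq[OF x x0] infty t 2 by simp
  next
    case 3
    then have "?z \<noteq> (\<lambda>_. 0)"
      using nonneg_comb_nonzero[OF x _ y, of "1 - t" t] t by simp
    then show ?thesis
      using dual_functional_eq[OF z] dual_functional_eq[OF x] dual_functional_eq[OF y] 3
        real_dual_strictly_convex[OF p x _ y _ \<open>x \<noteq> y\<close> t, of c] by simp
  qed
qed

end

section \<open>Existence of the minimiser\<close>

lemma tendsto_fun_iff:
  fixes f :: "nat \<Rightarrow> 'i \<Rightarrow> 'a::topological_space"
  shows "f \<longlonglongrightarrow> l \<longleftrightarrow> (\<forall>k. (\<lambda>n. f n k) \<longlonglongrightarrow> l k)"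
  using limitin_componentwise[of "\<lambda>_. euclidean" UNIV f l sequentially]
  by (simp add: euclidean_product_topology)

lemma continuous_on_coordinate: "continuous_on S (\<lambda>q :: 'i \<Rightarrow> 'a::topological_space. q k)"
  by (rule continuous_on_subset[OF continuous_on_product_coordinates]) simp

context frequency_set
begin

text \<open>The sum norm of the coefficients bounds the polynomial by 1 on the torus, so
  \<open>- P ln Q\<close> is nonnegative almost everywhere on this base, as Fatou's lemma
  requires.\<close>

definition unit_polys :: "(int ^ 'd \<Rightarrow> complex) set" where
  "unit_polys = {q \<in> nonneg_polys \<Lambda>. (\<Sum>k\<in>\<Lambda>. cmod (q k)) = 1}"

lemma unit_polysD:
  assumes "q \<in> unit_polys"
  shows "q \<in> nonneg_polys \<Lambda>" "q \<noteq> (\<lambda>_. 0)"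
  using assms by (auto simp: unit_polys_def)

lemma compact_unit_polys: "compact unit_polys"
proof -
  let ?D = "{q :: int ^ 'd \<Rightarrow> complex. \<forall>k. q k \<in> cball 0 1}"
  have "closed (nonneg_polys \<Lambda> \<inter> {q. (\<Sum>k\<in>\<Lambda>. cmod (q k)) = 1})"
    unfolding nonneg_polys_def
    by (intro closed_Int closed_closure closed_Collect_eq continuous_intros continuous_on_coordinate)
  moreover have "compact ?D" by (intro compact_PiE_UNIV) simp
  moreover have "unit_polys = ?D \<inter> (nonneg_polys \<Lambda> \<inter> {q. (\<Sum>k\<in>\<Lambda>. cmod (q k)) = 1})"
  proof -
    have "cmod (q k) \<le> 1" if "q \<in> nonneg_polys \<Lambda>" "(\<Sum>k\<in>\<Lambda>. cmod (q k)) = 1" for q k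
    proof (cases "k \<in> \<Lambda>")
      case True
      then show ?thesis
        using member_le_sum[of k \<Lambda> "\<lambda>k. cmod (q k)"] finite_freq that(2) by simp
    next
      case False
      then show ?thesis using nonneg_polysD(1)[OF that(1)] by (simp add: hermitian_def)
    qed
    then show ?thesis by (auto simp: unit_polys_def)
  qed
  ultimately show ?thesis by (simp add: compact_Int_closed)
qed

lemma trig_poly_one: "trig_poly \<Lambda> (\<lambda>k. if k = 0 then 1 else 0) \<theta> = 1"
  using finite_freq zero_freq
  by (simp add: trig_poly_def phase_def if_distrib[of "\<lambda>x. x * _"] cong: if_cong)

lemma unit_polys_nonempty: "(\<lambda>k. if k = 0 then 1 else 0) \<in> unit_polys"
proof -
  let ?e = "\<lambda>k :: int ^ 'd. if k = 0 then 1 else 0 :: complex"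
  have "?e \<in> hermitian \<Lambda>" using zero_freq by (auto simp: hermitian_def)
  moreover have "(\<Sum>k\<in>\<Lambda>. cmod (?e k)) = 1"
    using finite_freq zero_freq by (simp add: if_distrib[of cmod] cong: if_cong)
  ultimately show ?thesis
    by (simp add: unit_polys_def nonneg_polys_iff[OF finite_freq zero_freq] trig_poly_one)
qed

lemma pairing_tendsto:
  assumes "f \<longlonglongrightarrow> l"
  shows "(\<lambda>n. pairing \<Lambda> c (f n)) \<longlonglongrightarrow> pairing \<Lambda> c l"
  using assms unfolding pairing_def tendsto_fun_iff by (intro tendsto_intros) auto

lemma trig_poly_tendsto:
  assumes "f \<longlonglongrightarrow> l"
  shows "(\<lambda>n. trig_poly \<Lambda> (f n) \<theta>) \<longlonglongrightarrow> trig_poly \<Lambda> l \<theta>"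
  using assms unfolding trig_poly_def tendsto_fun_iff by (intro tendsto_intros) auto

text \<open>
  On the half-line through a normalised polynomial \<open>q\<close> the dual functional is minimised explicitly; its
  minimum is, up to a constant, \<open>A ln \<langle>c, q\<rangle> - \<integral> P ln Q\<close> with \<open>A = \<integral> P\<close>, which is lower
  semicontinuous on the compact base \<open>unit_polys\<close>.
\<close>

definition base_functional :: "(int ^ 'd \<Rightarrow> complex) \<Rightarrow> (int ^ 'd \<Rightarrow> complex) \<Rightarrow> (int ^ 'd \<Rightarrow> complex) \<Rightarrow> real" where
  "base_functional c p q = (LINT \<theta>|torus_measure. trig_poly \<Lambda> p \<theta>) * ln (pairing \<Lambda> c q) -
    (LINT \<theta>|torus_measure. trig_poly \<Lambda> p \<theta> * ln (trig_poly \<Lambda> q \<theta>))"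

text \<open>The direct method: on the compact base the continuous pairing with \<open>c\<close> has
  a positive minimum, so the functional is bounded below. Along a convergent minimising sequence the
  pairing term converges, and Fatou's lemma handles the logarithmic term.\<close>

lemma base_functional_attains_min:
  assumes c: "c \<in> dual_cone \<Lambda>" and p: "p \<in> nonneg_polys \<Lambda>"
  shows "\<exists>l\<in>unit_polys. \<forall>q\<in>unit_polys. base_functional c p l \<le> base_functional c p q"
proof -
  let ?T = "trig_poly \<Lambda>" and ?m = "torus_measure :: (real ^ 'd) measure"
  define A where "A = (LINT \<theta>|?m. ?T p \<theta>)"
  have A: "A \<ge> 0"
    unfolding A_def by (intro integral_nonneg_AE AE_I2) (simp add: nonneg_polysD(2)[OF p] space_torus_measure)
  have pair_pos: "pairing \<Lambda> c q > 0" if "q \<in> unit_polys" for q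
    using c unit_polysD[OF that] by (auto simp: dual_cone_def)
  have G_nonneg: "AE \<theta> in ?m. - (?T p \<theta> * ln (?T q \<theta>)) \<ge> 0" if q: "q \<in> unit_polys" for q
    using AE_trig_poly_pos[OF unit_polysD[OF q]] AE_space[of ?m]
  proof eventually_elim
    case (elim \<theta>)
    have "?T q \<theta> \<le> 1"
      using abs_trig_poly_le[of \<Lambda> q \<theta>] q by (simp add: unit_polys_def)
    then have "ln (?T q \<theta>) \<le> 0" using elim by (simp add: ln_le_zero_iff)
    moreover have "?T p \<theta> \<ge> 0" using nonneg_polysD(2)[OF p] elim by (simp add: space_torus_measure)
    ultimately show ?case by (simp add: mult_nonneg_nonpos)
  qed
  have cont: "continuous_on unit_polys (pairing \<Lambda> c)"
    unfolding pairing_def by (intro continuous_intros continuous_on_coordinate)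
  obtain q0 where q0: "q0 \<in> unit_polys" "\<And>q. q \<in> unit_polys \<Longrightarrow> pairing \<Lambda> c q0 \<le> pairing \<Lambda> c q"
    using continuous_attains_inf[OF compact_unit_polys _ cont] unit_polys_nonempty by blast
  let ?H = "base_functional c p"
  have H_ge: "A * ln (pairing \<Lambda> c q0) \<le> ?H q" if "q \<in> unit_polys" for q
  proof -
    have "A * ln (pairing \<Lambda> c q0) \<le> A * ln (pairing \<Lambda> c q)"
      using A q0 that pair_pos by (intro mult_left_mono) simp_all
    moreover have "(LINT \<theta>|?m. - (?T p \<theta> * ln (?T q \<theta>))) \<ge> 0"
      by (rule integral_nonneg_AE[OF G_nonneg[OF that]])
    ultimately show ?thesis by (simp add: base_functional_def A_def)
  qed
  define h where "h = Inf (?H ` unit_polys)"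
  have bdd: "bdd_below (?H ` unit_polys)" using H_ge by (auto simp: bdd_below_def)
  have h_le: "h \<le> ?H q" if "q \<in> unit_polys" for q
    unfolding h_def using that bdd by (intro cInf_lower) auto
  have "\<exists>q\<in>unit_polys. ?H q < h + inverse (real (Suc n))" for n
  proof -
    have "Inf (?H ` unit_polys) < h + inverse (real (Suc n))" by (simp add: h_def)
    then show ?thesis using unit_polys_nonempty bdd by (subst (asm) cInf_less_iff) auto
  qed
  then obtain f where f: "\<And>n. f n \<in> unit_polys" "\<And>n. ?H (f n) < h + inverse (real (Suc n))"
    by metis
  obtain l r where l: "l \<in> unit_polys" and r: "strict_mono r" and lim: "(f \<circ> r) \<longlonglongrightarrow> l"
    using seq_compactE[OF compact_imp_seq_compact[OF compact_unit_polys], of f] f(1) by blast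
  define g where "g n = f (r n)" for n
  have g: "g n \<in> unit_polys" "?H (g n) < h + inverse (real (Suc n))" for n
  proof -
    show "g n \<in> unit_polys" using f by (simp add: g_def)
    have "n \<le> r n" by (rule seq_suble[OF r])
    then have "inverse (real (Suc (r n))) \<le> inverse (real (Suc n))"
      by (intro le_imp_inverse_le) simp_all
    then show "?H (g n) < h + inverse (real (Suc n))"
      using f(2)[of "r n"] unfolding g_def by linarith
  qed
  have glim: "g \<longlonglongrightarrow> l" using lim by (simp add: g_def[abs_def] o_def)
  have "(LINT \<theta>|?m. - (?T p \<theta> * ln (?T l \<theta>))) \<le> h - A * ln (pairing \<Lambda> c l)"
  proof (rule integrable_fatou_bound(2))
    show "integrable ?m (\<lambda>\<theta>. - (?T p \<theta> * ln (?T (g n) \<theta>)))" for n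
      using integrable_entropy[OF unit_polysD[OF g(1)]] by simp
    show "AE \<theta> in ?m. 0 \<le> - (?T p \<theta> * ln (?T (g n) \<theta>))" for n by (rule G_nonneg[OF g(1)])
    show "AE \<theta> in ?m. (\<lambda>n. - (?T p \<theta> * ln (?T (g n) \<theta>))) \<longlonglongrightarrow> - (?T p \<theta> * ln (?T l \<theta>))"
      using AE_trig_poly_pos[OF unit_polysD[OF l]]
      by eventually_elim (intro tendsto_intros trig_poly_tendsto glim, simp)
    show "(LINT \<theta>|?m. - (?T p \<theta> * ln (?T (g n) \<theta>))) \<le> h + inverse (real (Suc n)) - A * ln (pairing \<Lambda> c (g n))" for n
      using g(2)[of n] by (simp add: base_functional_def A_def)
    have "(\<lambda>n. h + inverse (real (Suc n)) - A * ln (pairing \<Lambda> c (g n))) \<longlonglongrightarrow> h + 0 - A * ln (pairing \<Lambda> c l)"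
      using pair_pos[OF l] by (intro tendsto_intros LIMSEQ_inverse_real_of_nat pairing_tendsto glim) simp
    then show "(\<lambda>n. h + inverse (real (Suc n)) - A * ln (pairing \<Lambda> c (g n))) \<longlonglongrightarrow> h - A * ln (pairing \<Lambda> c l)"
      by simp
  qed measurable
  then have "?H l \<le> h" by (simp add: base_functional_def A_def)
  then show ?thesis using l h_le by (intro bexI[of _ l]) (auto intro: order_trans)
qed

lemma integral_trig_poly_pos:
  assumes "p \<in> nonneg_polys \<Lambda>" "p \<noteq> (\<lambda>_. 0)"
  shows "(LINT \<theta>|torus_measure. trig_poly \<Lambda> p \<theta>) > 0"
proof -
  have "(LINT \<theta>|(torus_measure :: (real ^ 'd) measure). 0) < (LINT \<theta>|torus_measure. trig_poly \<Lambda> p \<theta>)"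
    using emeasure_torus_pos[where 'd='d] AE_trig_poly_pos[OF assms]
    by (intro finite_measure.integral_less_AE_space[OF finite_measure_torus] integrable_trig_poly) auto
  then show ?thesis by simp
qed

lemma real_dual_scale:
  assumes "q \<in> unit_polys" "s > 0"
  shows "real_dual c p (\<lambda>k. of_real s * q k) = s * pairing \<Lambda> c q -
    (LINT \<theta>|torus_measure. trig_poly \<Lambda> p \<theta>) * ln s -
    (LINT \<theta>|torus_measure. trig_poly \<Lambda> p \<theta> * ln (trig_poly \<Lambda> q \<theta>))"
proof -
  have scale: "pairing \<Lambda> c (\<lambda>k. of_real s * q k) = s * pairing \<Lambda> c q"
    "trig_poly \<Lambda> (\<lambda>k. of_real s * q k) \<theta> = s * trig_poly \<Lambda> q \<theta>" for \<theta>
    using pairing_lincomb[of \<Lambda> c s q 0 "\<lambda>_. 0"] trig_poly_lincomb[of \<Lambda> s q 0 "\<lambda>_. 0" \<theta>] by simp_all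
  have "(LINT \<theta>|torus_measure. trig_poly \<Lambda> p \<theta> * ln (s * trig_poly \<Lambda> q \<theta>)) =
      (LINT \<theta>|torus_measure. ln s * trig_poly \<Lambda> p \<theta> + trig_poly \<Lambda> p \<theta> * ln (trig_poly \<Lambda> q \<theta>))"
  proof (rule integral_cong_AE)
    show "AE \<theta> in torus_measure. trig_poly \<Lambda> p \<theta> * ln (s * trig_poly \<Lambda> q \<theta>) =
        ln s * trig_poly \<Lambda> p \<theta> + trig_poly \<Lambda> p \<theta> * ln (trig_poly \<Lambda> q \<theta>)"
      using AE_trig_poly_pos[OF unit_polysD[OF assms(1)]]
      by eventually_elim (use assms(2) in \<open>simp add: ln_mult algebra_simps\<close>)
  qed measurable
  also have "\<dots> = ln s * (LINT \<theta>|torus_measure. trig_poly \<Lambda> p \<theta>) +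
      (LINT \<theta>|torus_measure. trig_poly \<Lambda> p \<theta> * ln (trig_poly \<Lambda> q \<theta>))"
    using integrable_trig_poly integrable_entropy[OF unit_polysD[OF assms(1)]] by simp
  finally show ?thesis by (simp add: real_dual_def scale)
qed

lemma real_dual_has_min:
  assumes c: "c \<in> dual_cone \<Lambda>" and p: "p \<in> nonneg_polys \<Lambda>" "p \<noteq> (\<lambda>_. 0)"
  obtains q where "q \<in> nonneg_polys \<Lambda>" "q \<noteq> (\<lambda>_. 0)"
    "pairing \<Lambda> c q = (LINT \<theta>|torus_measure. trig_poly \<Lambda> p \<theta>)"
    "\<And>r. r \<in> nonneg_polys \<Lambda> \<Longrightarrow> r \<noteq> (\<lambda>_. 0) \<Longrightarrow> real_dual c p q \<le> real_dual c p r"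
proof -
  define A where "A = (LINT \<theta>|(torus_measure :: (real ^ 'd) measure). trig_poly \<Lambda> p \<theta>)"
  have A: "A > 0" unfolding A_def by (rule integral_trig_poly_pos[OF p])
  obtain l where l: "l \<in> unit_polys" and l_min: "\<And>q. q \<in> unit_polys \<Longrightarrow> base_functional c p l \<le> base_functional c p q"
    using base_functional_attains_min[OF c p(1)] by blast
  have pair_pos: "pairing \<Lambda> c q > 0" if "q \<in> unit_polys" for q
    using c unit_polysD[OF that] by (auto simp: dual_cone_def)
  \<comment> \<open>The critical point of \<open>s * pairing \<Lambda> c l - A * ln s\<close>, the
    part of the functional that varies along the ray through \<open>l\<close>.\<close>
  define s where "s = A / pairing \<Lambda> c l"
  have s: "s > 0" using A pair_pos[OF l] by (simp add: s_def)
  define q where "q k = of_real s * l k" for k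
  have q_lin: "q = (\<lambda>k. of_real s * l k + of_real 0 * l k)" by (simp add: q_def fun_eq_iff)
  have min: "A - A * ln A + base_functional c p l \<le> real_dual c p r"
    if r: "r \<in> nonneg_polys \<Lambda>" "r \<noteq> (\<lambda>_. 0)" for r
  proof -
    define N where "N = (\<Sum>k\<in>\<Lambda>. cmod (r k))"
    obtain k where "r k \<noteq> 0" using r(2) by auto
    moreover from this have "k \<in> \<Lambda>" using nonneg_polysD(1)[OF r(1)] by (auto simp: hermitian_def)
    ultimately have "N > 0"
      unfolding N_def using finite_freq by (intro sum_pos2[of _ k]) auto
    define u where "u k = of_real (1 / N) * r k + of_real 0 * r k" for k
    have "cmod (u k) = cmod (r k) / N" for k
      using \<open>N > 0\<close> by (simp add: u_def norm_divide)
    then have "(\<Sum>k\<in>\<Lambda>. cmod (u k)) = 1"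
      using \<open>N > 0\<close> by (simp add: sum_divide_distrib[symmetric] N_def)
    moreover have "u \<in> nonneg_polys \<Lambda>"
      unfolding u_def[abs_def] using r(1) \<open>N > 0\<close> by (intro nonneg_polys_lincomb) auto
    ultimately have u: "u \<in> unit_polys" by (simp add: unit_polys_def)
    have "r = (\<lambda>k. of_real N * u k)" using \<open>N > 0\<close> by (simp add: u_def fun_eq_iff)
    then have eq: "real_dual c p r = N * pairing \<Lambda> c u - A * ln N -
        (LINT \<theta>|torus_measure. trig_poly \<Lambda> p \<theta> * ln (trig_poly \<Lambda> u \<theta>))"
      using real_dual_scale[OF u \<open>N > 0\<close>] by (simp add: A_def)
    define y where "y = N * pairing \<Lambda> c u"
    have y: "y > 0" using \<open>N > 0\<close> pair_pos[OF u] by (simp add: y_def)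
    \<comment> \<open>Equivalent to \<open>y - A * ln y\<close> being smallest at
      \<open>y = A\<close>, the minimisation along the ray through \<open>u\<close>.\<close>
    have "ln (y / A) \<le> y / A - 1" using y A by (intro ln_le_minus_one) simp
    then have "A * (ln y - ln A) \<le> A * (y / A - 1)"
      using y A by (intro mult_left_mono) (simp_all add: ln_div)
    then have "A - A * ln A \<le> y - A * ln y"
      using A by (simp add: right_diff_distrib)
    moreover have "ln y = ln N + ln (pairing \<Lambda> c u)"
      using \<open>N > 0\<close> pair_pos[OF u] by (simp add: y_def ln_mult)
    ultimately have "A - A * ln A + base_functional c p u \<le> real_dual c p r"
      unfolding eq by (simp add: base_functional_def A_def[symmetric] y_def distrib_left)
    then show ?thesis using l_min[OF u] by simp
  qed
  have "q \<in> nonneg_polys \<Lambda>"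
    unfolding q_lin using l s by (intro nonneg_polys_lincomb unit_polysD) auto
  moreover have "q \<noteq> (\<lambda>_. 0)"
    using unit_polysD(2)[OF l] s by (auto simp: q_def fun_eq_iff)
  moreover have "pairing \<Lambda> c q = A"
    unfolding q_lin pairing_lincomb using pair_pos[OF l] by (simp add: s_def)
  moreover have "real_dual c p q = A - A * ln A + base_functional c p l"
  proof -
    have "real_dual c p q = s * pairing \<Lambda> c l - A * ln s - (LINT \<theta>|torus_measure. trig_poly \<Lambda> p \<theta> * ln (trig_poly \<Lambda> l \<theta>))"
      unfolding q_def[abs_def] A_def by (rule real_dual_scale[OF l s])
    moreover have "s * pairing \<Lambda> c l = A" using pair_pos[OF l] by (simp add: s_def)
    moreover have "ln s = ln A - ln (pairing \<Lambda> c l)" using A pair_pos[OF l] by (simp add: s_def ln_div)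
    ultimately show ?thesis by (simp add: base_functional_def A_def[symmetric] algebra_simps)
  qed
  ultimately show ?thesis
    using min that[of q] by (simp add: A_def)
qed

end

section \<open>First variation and duality\<close>

lemma pairing_integral:
  assumes w: "integrable M w" and [measurable]: "\<And>k. (\<lambda>\<theta>. cis (phase k \<theta>)) \<in> borel_measurable M"
  shows "integrable M (\<lambda>\<theta>. w \<theta> *\<^sub>R cis (phase k \<theta>))"
    and "pairing \<Lambda> (\<lambda>k. LINT \<theta>|M. w \<theta> *\<^sub>R cis (phase k \<theta>)) r = (LINT \<theta>|M. w \<theta> * trig_poly \<Lambda> r \<theta>)"
proof -
  have [measurable]: "w \<in> borel_measurable M" using w by auto
  have int: "integrable M (\<lambda>\<theta>. w \<theta> *\<^sub>R cis (phase k \<theta>))" for k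
    by (rule Bochner_Integration.integrable_bound[OF w]) auto
  then show "integrable M (\<lambda>\<theta>. w \<theta> *\<^sub>R cis (phase k \<theta>))" .
  have "(\<Sum>k\<in>\<Lambda>. (LINT \<theta>|M. w \<theta> *\<^sub>R cis (phase k \<theta>)) * cnj (r k)) =
      (\<Sum>k\<in>\<Lambda>. LINT \<theta>|M. w \<theta> *\<^sub>R cis (phase k \<theta>) * cnj (r k))"
    by (simp only: integral_mult_left_zero)
  also have "\<dots> = (LINT \<theta>|M. (\<Sum>k\<in>\<Lambda>. w \<theta> *\<^sub>R cis (phase k \<theta>) * cnj (r k)))"
    by (intro Bochner_Integration.integral_sum[symmetric] integrable_mult_left int)
  also have "Re \<dots> = (LINT \<theta>|M. Re (\<Sum>k\<in>\<Lambda>. w \<theta> *\<^sub>R cis (phase k \<theta>) * cnj (r k)))"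
    using int by (intro integral_Re[symmetric] Bochner_Integration.integrable_sum integrable_mult_left) auto
  also have "\<dots> = (LINT \<theta>|M. w \<theta> * trig_poly \<Lambda> r \<theta>)"
    unfolding pairing_cis[symmetric] by (simp add: pairing_def sum_distrib_left algebra_simps)
  finally show "pairing \<Lambda> (\<lambda>k. LINT \<theta>|M. w \<theta> *\<^sub>R cis (phase k \<theta>)) r = (LINT \<theta>|M. w \<theta> * trig_poly \<Lambda> r \<theta>)"
    by (simp add: pairing_def)
qed

lemma bounded_measuresD:
  assumes "\<mu> \<in> bounded_measures"
  shows "sets \<mu> = sets torus_measure" "space \<mu> = torus" "finite_measure \<mu>"
    and "f \<in> borel_measurable torus_measure \<Longrightarrow> f \<in> borel_measurable \<mu>"
  using assms sets_eq_imp_space_eq[of \<mu> torus_measure] measurable_cong_sets[of \<mu> torus_measure borel borel]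
  by (auto simp: bounded_measures_def space_torus_measure)

lemma integrable_cis_phase:
  assumes "\<mu> \<in> bounded_measures"
  shows "integrable \<mu> (\<lambda>\<theta>. cis (phase k \<theta>))"
  using pairing_integral(1)[of \<mu> "\<lambda>_. 1" k] bounded_measuresD[OF assms]
  by (simp add: finite_measure.integrable_const)

lemma integral_trig_poly_moments:
  assumes "has_moments \<Lambda> \<mu> c"
  shows "(LINT \<theta>|\<mu>. trig_poly \<Lambda> r \<theta>) = pairing \<Lambda> c r"
proof -
  have \<mu>: "\<mu> \<in> bounded_measures" using assms by (simp add: has_moments_def)
  have "pairing \<Lambda> c r = pairing \<Lambda> (\<lambda>k. LINT \<theta>|\<mu>. 1 *\<^sub>R cis (phase k \<theta>)) r"
    using assms by (intro pairing_cong) (simp_all add: has_moments_def)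
  also have "\<dots> = (LINT \<theta>|\<mu>. 1 * trig_poly \<Lambda> r \<theta>)"
    using bounded_measuresD[OF \<mu>] by (intro pairing_integral(2)) (auto simp: finite_measure.integrable_const)
  finally show ?thesis by simp
qed

section \<open>First variation at the minimiser\<close>

context frequency_set
begin

text \<open>The equation for \<open>pairing \<Lambda> c q\<close> is stationarity under rescaling of
  \<open>q\<close>. It is carried along because minimisation over rays supplies it directly, and it
  later yields complementary slackness.\<close>

definition dual_minimizer :: "(int ^ 'd \<Rightarrow> complex) \<Rightarrow> (int ^ 'd \<Rightarrow> complex) \<Rightarrow> (int ^ 'd \<Rightarrow> complex) \<Rightarrow> bool" where
  "dual_minimizer c p q \<longleftrightarrow> q \<in> nonneg_polys \<Lambda> \<and> q \<noteq> (\<lambda>_. 0) \<and>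
    pairing \<Lambda> c q = (LINT \<theta>|torus_measure. trig_poly \<Lambda> p \<theta>) \<and>
    (\<forall>r\<in>nonneg_polys \<Lambda>. r \<noteq> (\<lambda>_. 0) \<longrightarrow> real_dual c p q \<le> real_dual c p r)"

text \<open>
  The directional derivative of the dual functional towards \<open>R\<close> is nonnegative. The difference quotients
  are bounded below by \<open>P R / (Q + R / n)\<close>, so that Fatou's lemma suffices to pass to the limit.
\<close>

lemma minimizer_variation:
  assumes p: "p \<in> nonneg_polys \<Lambda>" and q: "dual_minimizer c p q" and r: "r \<in> nonneg_polys \<Lambda>"
  shows "integrable torus_measure (\<lambda>\<theta>. trig_poly \<Lambda> p \<theta> / trig_poly \<Lambda> q \<theta> * trig_poly \<Lambda> r \<theta>)"
    and "(LINT \<theta>|torus_measure. trig_poly \<Lambda> p \<theta> / trig_poly \<Lambda> q \<theta> * trig_poly \<Lambda> r \<theta>) \<le> pairing \<Lambda> c r"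
proof -
  let ?T = "trig_poly \<Lambda>" and ?m = "torus_measure :: (real ^ 'd) measure"
  have q': "q \<in> nonneg_polys \<Lambda>" "q \<noteq> (\<lambda>_. 0)"
    and q_min: "\<And>r. r \<in> nonneg_polys \<Lambda> \<Longrightarrow> r \<noteq> (\<lambda>_. 0) \<Longrightarrow> real_dual c p q \<le> real_dual c p r"
    using q by (auto simp: dual_minimizer_def)
  define e where "e n = inverse (real (Suc n))" for n
  have e: "e n > 0" for n by (simp add: e_def)
  define s where "s n k = of_real 1 * q k + of_real (e n) * r k" for n k
  have s: "s n \<in> nonneg_polys \<Lambda>" "s n \<noteq> (\<lambda>_. 0)" for n
    using nonneg_polys_lincomb[OF q'(1) r, of 1 "e n"] nonneg_comb_nonzero[OF q' r, of 1 "e n"] e[of n]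
    by (simp_all add: s_def[abs_def])
  have Ts: "?T (s n) \<theta> = ?T q \<theta> + e n * ?T r \<theta>" for n \<theta>
    unfolding s_def[abs_def] trig_poly_lincomb by simp
  define g where "g n \<theta> = (?T p \<theta> * ln (?T (s n) \<theta>) - ?T p \<theta> * ln (?T q \<theta>)) / e n" for n \<theta>
  have g_int: "integrable ?m (g n)" for n
    unfolding g_def[abs_def] using integrable_entropy[OF s] integrable_entropy[OF q'] by simp
  have g_le: "(LINT \<theta>|?m. g n \<theta>) \<le> pairing \<Lambda> c r" for n
  proof -
    have "pairing \<Lambda> c (s n) = pairing \<Lambda> c q + e n * pairing \<Lambda> c r"
      unfolding s_def[abs_def] pairing_lincomb by simp
    then have "(LINT \<theta>|?m. ?T p \<theta> * ln (?T (s n) \<theta>)) - (LINT \<theta>|?m. ?T p \<theta> * ln (?T q \<theta>)) \<le> e n * pairing \<Lambda> c r"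
      using q_min[OF s(1)[of n] s(2)] by (simp add: real_dual_def)
    moreover have "(LINT \<theta>|?m. g n \<theta>) =
        ((LINT \<theta>|?m. ?T p \<theta> * ln (?T (s n) \<theta>)) - (LINT \<theta>|?m. ?T p \<theta> * ln (?T q \<theta>))) / e n"
      unfolding g_def using integrable_entropy[OF s] integrable_entropy[OF q'] by simp
    ultimately show ?thesis using e[of n] by (simp add: pos_divide_le_eq mult.commute)
  qed
  define G where "G n \<theta> = ?T p \<theta> * ?T r \<theta> / ?T (s n) \<theta>" for n \<theta>
  have pos: "AE \<theta> in ?m. ?T q \<theta> > 0 \<and> ?T r \<theta> \<ge> 0 \<and> ?T p \<theta> \<ge> 0"
    using AE_trig_poly_pos[OF q'] AE_space[of ?m]
    by eventually_elim (simp add: space_torus_measure nonneg_polysD(2) r p)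
  have Gg: "AE \<theta> in ?m. 0 \<le> G n \<theta> \<and> G n \<theta> \<le> g n \<theta>" for n
    using pos
  proof eventually_elim
    case (elim \<theta>)
    have sp: "?T (s n) \<theta> > 0" using elim e[of n] by (simp add: Ts add_pos_nonneg)
    \<comment> \<open>Applied to \<open>Q / (Q + e R)\<close>, this bounds the difference quotient
      of the logarithm below by \<open>R / (Q + e R)\<close>, which is nonnegative.\<close>
    have "ln (?T q \<theta> / ?T (s n) \<theta>) \<le> ?T q \<theta> / ?T (s n) \<theta> - 1"
      using elim sp by (intro ln_le_minus_one) simp
    moreover have "?T q \<theta> / ?T (s n) \<theta> - 1 = - (e n * (?T r \<theta> / ?T (s n) \<theta>))"
    proof -
      have "?T q \<theta> / ?T (s n) \<theta> = (?T (s n) \<theta> - e n * ?T r \<theta>) / ?T (s n) \<theta>" by (simp add: Ts)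
      then show ?thesis using sp by (simp add: diff_divide_distrib)
    qed
    ultimately have "e n * (?T r \<theta> / ?T (s n) \<theta>) \<le> ln (?T (s n) \<theta>) - ln (?T q \<theta>)"
      using elim sp by (simp add: ln_div)
    then have "?T r \<theta> / ?T (s n) \<theta> \<le> (ln (?T (s n) \<theta>) - ln (?T q \<theta>)) / e n"
      using e[of n] by (simp only: pos_le_divide_eq mult.commute)
    then have "?T p \<theta> * (?T r \<theta> / ?T (s n) \<theta>) \<le> ?T p \<theta> * ((ln (?T (s n) \<theta>) - ln (?T q \<theta>)) / e n)"
      using elim by (intro mult_left_mono) auto
    then show ?case using elim sp by (simp add: G_def g_def right_diff_distrib)
  qed
  have G_meas [measurable]: "G n \<in> borel_measurable ?m" for n unfolding G_def[abs_def] by measurable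
  have G_int: "integrable ?m (G n)" for n
  proof (rule Bochner_Integration.integrable_bound[OF g_int[of n]])
    show "AE \<theta> in ?m. norm (G n \<theta>) \<le> norm (g n \<theta>)"
      using Gg[of n] by eventually_elim auto
  qed measurable
  have G_le: "(LINT \<theta>|?m. G n \<theta>) \<le> pairing \<Lambda> c r" for n
  proof -
    have "AE \<theta> in ?m. G n \<theta> \<le> g n \<theta>" using Gg[of n] by eventually_elim simp
    then show ?thesis using integral_mono_AE[OF G_int g_int, of n n] g_le[of n] by simp
  qed
  have lim: "AE \<theta> in ?m. (\<lambda>n. G n \<theta>) \<longlonglongrightarrow> ?T p \<theta> / ?T q \<theta> * ?T r \<theta>"
    using pos
  proof eventually_elim
    case (elim \<theta>)
    have "(\<lambda>n. G n \<theta>) \<longlonglongrightarrow> ?T p \<theta> * ?T r \<theta> / (?T q \<theta> + 0 * ?T r \<theta>)"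
      unfolding G_def Ts e_def using elim by (intro tendsto_intros LIMSEQ_inverse_real_of_nat) simp
    then show ?case by simp
  qed
  have nn: "AE \<theta> in ?m. 0 \<le> G n \<theta>" for n using Gg[of n] by eventually_elim simp
  have meas: "(\<lambda>\<theta>. ?T p \<theta> / ?T q \<theta> * ?T r \<theta>) \<in> borel_measurable ?m" by measurable
  note * = integrable_fatou_bound[OF G_int nn lim meas G_le tendsto_const]
  show "integrable ?m (\<lambda>\<theta>. ?T p \<theta> / ?T q \<theta> * ?T r \<theta>)" by (rule *(1))
  show "(LINT \<theta>|?m. ?T p \<theta> / ?T q \<theta> * ?T r \<theta>) \<le> pairing \<Lambda> c r" by (rule *(2))
qed

text \<open>Variation towards the constant polynomial 1. When \<open>Q\<close> has zeros, this
  integrability is a consequence of minimality and not automatic.\<close>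

lemma integrable_spectral_density:
  assumes "p \<in> nonneg_polys \<Lambda>" "dual_minimizer c p q"
  shows "integrable torus_measure (\<lambda>\<theta>. trig_poly \<Lambda> p \<theta> / trig_poly \<Lambda> q \<theta>)"
  using minimizer_variation(1)[OF assms unit_polysD(1)[OF unit_polys_nonempty]] by (simp add: trig_poly_one)

text \<open>The only candidate for the moments of the singular part: whatever \<open>P / Q\<close>
  leaves of \<open>c\<close>.\<close>

definition residual_moments :: "(int ^ 'd \<Rightarrow> complex) \<Rightarrow> (int ^ 'd \<Rightarrow> complex) \<Rightarrow> (int ^ 'd \<Rightarrow> complex) \<Rightarrow> int ^ 'd \<Rightarrow> complex" where
  "residual_moments c p q k = (if k \<in> \<Lambda> then
     c k - (LINT \<theta>|torus_measure. (trig_poly \<Lambda> p \<theta> / trig_poly \<Lambda> q \<theta>) *\<^sub>R cis (phase k \<theta>)) else 0)"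

lemma residual_moments_hermitian:
  assumes "c \<in> hermitian \<Lambda>"
  shows "residual_moments c p q \<in> hermitian \<Lambda>"
proof -
  have "(LINT \<theta>|torus_measure. (trig_poly \<Lambda> p \<theta> / trig_poly \<Lambda> q \<theta>) *\<^sub>R cis (phase (- k) \<theta>)) =
      cnj (LINT \<theta>|torus_measure. (trig_poly \<Lambda> p \<theta> / trig_poly \<Lambda> q \<theta>) *\<^sub>R cis (phase k \<theta>))" for k :: "int ^ 'd"
  proof -
    have "(trig_poly \<Lambda> p \<theta> / trig_poly \<Lambda> q \<theta>) *\<^sub>R cis (phase (- k) \<theta>) =
        cnj ((trig_poly \<Lambda> p \<theta> / trig_poly \<Lambda> q \<theta>) *\<^sub>R cis (phase k \<theta>))" for \<theta>
      by (simp add: phase_uminus cis_cnj)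
    then have "(LINT \<theta>|torus_measure. (trig_poly \<Lambda> p \<theta> / trig_poly \<Lambda> q \<theta>) *\<^sub>R cis (phase (- k) \<theta>)) =
        (LINT \<theta>|torus_measure. cnj ((trig_poly \<Lambda> p \<theta> / trig_poly \<Lambda> q \<theta>) *\<^sub>R cis (phase k \<theta>)))"
      by (rule Bochner_Integration.integral_cong[OF refl])
    then show ?thesis by (rule trans) (rule Bochner_Integration.integral_cnj)
  qed
  then show ?thesis
    using assms neg_mem by (simp add: hermitian_def residual_moments_def)
qed

lemma pairing_residual_moments:
  assumes "p \<in> nonneg_polys \<Lambda>" "dual_minimizer c p q"
  shows "pairing \<Lambda> (residual_moments c p q) r =
    pairing \<Lambda> c r - (LINT \<theta>|torus_measure. trig_poly \<Lambda> p \<theta> / trig_poly \<Lambda> q \<theta> * trig_poly \<Lambda> r \<theta>)"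
proof -
  have "pairing \<Lambda> (residual_moments c p q) r = pairing \<Lambda> c r -
      pairing \<Lambda> (\<lambda>k. LINT \<theta>|torus_measure. (trig_poly \<Lambda> p \<theta> / trig_poly \<Lambda> q \<theta>) *\<^sub>R cis (phase k \<theta>)) r"
    by (simp add: pairing_def residual_moments_def sum_subtractf left_diff_distrib)
  then show ?thesis
    by (simp add: pairing_integral(2)[OF integrable_spectral_density[OF assms] measurable_cis_phase])
qed

text \<open>Complementary slackness: \<open>P / Q * Q\<close> is \<open>P\<close> almost everywhere,
  so the rescaling equation cancels both terms.\<close>

lemma pairing_residual_minimizer:
  assumes "p \<in> nonneg_polys \<Lambda>" "dual_minimizer c p q"
  shows "pairing \<Lambda> (residual_moments c p q) q = 0"
proof -
  have q: "q \<in> nonneg_polys \<Lambda>" "q \<noteq> (\<lambda>_. 0)"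
    and cq: "pairing \<Lambda> c q = (LINT \<theta>|torus_measure. trig_poly \<Lambda> p \<theta>)"
    using assms(2) by (auto simp: dual_minimizer_def)
  have "(LINT \<theta>|torus_measure. trig_poly \<Lambda> p \<theta> / trig_poly \<Lambda> q \<theta> * trig_poly \<Lambda> q \<theta>) =
      (LINT \<theta>|torus_measure. trig_poly \<Lambda> p \<theta>)"
    using AE_trig_poly_pos[OF q] by (intro integral_cong_AE) (auto elim!: eventually_mono)
  then show ?thesis by (simp add: pairing_residual_moments[OF assms] cq)
qed

lemma dual_coneD: "c \<in> dual_cone \<Lambda> \<Longrightarrow> c \<in> hermitian \<Lambda>"
  by (simp add: dual_cone_def)

text \<open>Adding a small multiple of \<open>c\<close> makes all pairings with nonzero elements of
  the cone strictly positive, so the residual is a limit of points of the dual cone. It lies outside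
  that cone because it is orthogonal to the nonzero \<open>q\<close>.\<close>

lemma residual_moments_boundary:
  assumes c: "c \<in> dual_cone \<Lambda>" and p: "p \<in> nonneg_polys \<Lambda>" and q: "dual_minimizer c p q"
  shows "residual_moments c p q \<in> dual_boundary \<Lambda>"
  unfolding dual_boundary_def
proof
  let ?r = "residual_moments c p q"
  have herm: "?r \<in> hermitian \<Lambda>" by (rule residual_moments_hermitian[OF dual_coneD[OF c]])
  define f where "f n k = of_real 1 * ?r k + of_real (inverse (real (Suc n))) * c k" for n k
  have "f n \<in> dual_cone \<Lambda>" for n
  proof -
    have "pairing \<Lambda> (f n) u > 0" if u: "u \<in> nonneg_polys \<Lambda> - {\<lambda>_. 0}" for u
    proof -
      have "pairing \<Lambda> (f n) u = pairing \<Lambda> ?r u + inverse (real (Suc n)) * pairing \<Lambda> c u"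
        unfolding f_def[abs_def] pairing_commute[of \<Lambda> _ u] pairing_lincomb by simp
      moreover have "pairing \<Lambda> ?r u \<ge> 0"
        using minimizer_variation(2)[OF p q, of u] u by (simp add: pairing_residual_moments[OF p q])
      moreover have "inverse (real (Suc n)) * pairing \<Lambda> c u > 0"
        using c u by (intro mult_pos_pos) (auto simp: dual_cone_def)
      ultimately show ?thesis by simp
    qed
    moreover have "f n \<in> hermitian \<Lambda>"
      unfolding f_def[abs_def] by (intro hermitian_lincomb herm dual_coneD c)
    ultimately show ?thesis by (simp add: dual_cone_def)
  qed
  moreover have "f \<longlonglongrightarrow> ?r"
    unfolding tendsto_fun_iff
  proof
    fix k
    have "(\<lambda>n. f n k) \<longlonglongrightarrow> of_real 1 * ?r k + of_real 0 * c k"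
      unfolding f_def by (intro tendsto_intros LIMSEQ_inverse_real_of_nat)
    then show "(\<lambda>n. f n k) \<longlonglongrightarrow> ?r k" by simp
  qed
  ultimately show "?r \<in> closure (dual_cone \<Lambda>)"
    by (rule_tac closed_sequentially[OF closed_closure, of f]) (auto intro: subsetD[OF closure_subset])
  show "?r \<notin> dual_cone \<Lambda>"
    using pairing_residual_minimizer[OF p q] q by (force simp: dual_cone_def dual_minimizer_def)
qed

text \<open>Supplies the zeros off \<open>\<Lambda>\<close>, where moment conditions say nothing;
  uniqueness of the residual as a function depends on them.\<close>

lemma dual_boundary_hermitian: "dual_boundary \<Lambda> \<subseteq> hermitian \<Lambda>"
proof -
  have "hermitian \<Lambda> = (\<Inter>k\<in>\<Lambda>. {p. p (- k) = cnj (p k)}) \<inter> (\<Inter>k\<in>- \<Lambda>. {p. p k = 0})"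
    by (auto simp: hermitian_def)
  also have "closed \<dots>"
    by (intro closed_Int closed_INT ballI closed_Collect_eq continuous_intros continuous_on_coordinate)
  finally have "closure (dual_cone \<Lambda>) \<subseteq> hermitian \<Lambda>"
    by (intro closure_minimal) (auto simp: dual_cone_def)
  then show ?thesis by (auto simp: dual_boundary_def)
qed

section \<open>The singular part and the primal problem\<close>

lemma spectral_density_AE_nonneg:
  assumes "p \<in> nonneg_polys \<Lambda>" "q \<in> nonneg_polys \<Lambda>"
  shows "AE \<theta> in torus_measure. trig_poly \<Lambda> p \<theta> / trig_poly \<Lambda> q \<theta> \<ge> 0"
  by (rule AE_I2) (simp add: space_torus_measure nonneg_polysD(2) assms)

lemma integral_spectral_measure:
  assumes p: "p \<in> nonneg_polys \<Lambda>" and q: "dual_minimizer c p q" and \<nu>: "\<nu> \<in> bounded_measures"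
  shows "spectral_measure \<Lambda> p q \<nu> \<in> bounded_measures"
    and "k \<in> \<Lambda> \<Longrightarrow> (LINT \<theta>|spectral_measure \<Lambda> p q \<nu>. cis (phase k \<theta>)) =
      c k - residual_moments c p q k + (LINT \<theta>|\<nu>. cis (phase k \<theta>))"
proof -
  let ?m = "torus_measure :: (real ^ 'd) measure"
  let ?w = "\<lambda>\<theta>. trig_poly \<Lambda> p \<theta> / trig_poly \<Lambda> q \<theta>"
  let ?D = "density ?m (\<lambda>\<theta>. ennreal (?w \<theta>))"
  have w: "integrable ?m ?w" by (rule integrable_spectral_density[OF p q])
  have w0: "AE \<theta> in ?m. ?w \<theta> \<ge> 0"
    using spectral_density_AE_nonneg[OF p] q by (simp add: dual_minimizer_def)
  have sets: "sets \<nu> = sets ?D" using bounded_measuresD[OF \<nu>] by simp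
  interpret \<nu>: finite_measure \<nu> by (rule bounded_measuresD(3)[OF \<nu>])
  have "emeasure (spectral_measure \<Lambda> p q \<nu>) (space (spectral_measure \<Lambda> p q \<nu>)) =
      emeasure ?D (space ?m) + emeasure \<nu> (space \<nu>)"
    using sets bounded_measuresD[OF \<nu>] sets_eq_imp_space_eq[OF sets] sets.top[of ?m]
    by (simp add: spectral_measure_def emeasure_measure_add)
  also have "emeasure ?D (space ?m) = (\<integral>\<^sup>+\<theta>. ennreal (?w \<theta>) \<partial>?m)"
    by (simp add: emeasure_density cong: nn_integral_cong)
  also have "\<dots> < \<infinity>"
    using w by (simp add: real_integrable_def less_top)
  finally have "emeasure (spectral_measure \<Lambda> p q \<nu>) (space (spectral_measure \<Lambda> p q \<nu>)) \<noteq> \<infinity>"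
    using \<nu>.emeasure_finite by (simp add: less_top)
  then show "spectral_measure \<Lambda> p q \<nu> \<in> bounded_measures"
    by (auto simp: bounded_measures_def spectral_measure_def intro: finite_measureI)
  assume k: "k \<in> \<Lambda>"
  have "integrable ?D (\<lambda>\<theta>. cis (phase k \<theta>))"
    using pairing_integral(1)[OF w measurable_cis_phase, of k] w0 by (subst integrable_density) auto
  then have "(LINT \<theta>|spectral_measure \<Lambda> p q \<nu>. cis (phase k \<theta>)) =
      (LINT \<theta>|?D. cis (phase k \<theta>)) + (LINT \<theta>|\<nu>. cis (phase k \<theta>))"
    unfolding spectral_measure_def using sets integrable_cis_phase[OF \<nu>] by (intro integral_measure_add) auto
  also have "(LINT \<theta>|?D. cis (phase k \<theta>)) = (LINT \<theta>|?m. ?w \<theta> *\<^sub>R cis (phase k \<theta>))"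
    using w0 by (intro integral_density) auto
  finally show "(LINT \<theta>|spectral_measure \<Lambda> p q \<nu>. cis (phase k \<theta>)) =
      c k - residual_moments c p q k + (LINT \<theta>|\<nu>. cis (phase k \<theta>))"
    using k by (simp add: residual_moments_def)
qed

text \<open>Subtracting the moments of \<open>P / Q\<close> from those of the whole measure leaves
  no freedom on \<open>\<Lambda>\<close>, whichever \<open>\<nu>\<close> realises them.\<close>

lemma singular_part_unique:
  assumes p: "p \<in> nonneg_polys \<Lambda>" and q: "dual_minimizer c p q"
    and c': "c' \<in> dual_boundary \<Lambda>" "singular_part_for \<Lambda> c p q c' \<nu>"
  shows "c' = residual_moments c p q"
proof
  fix k
  show "c' k = residual_moments c p q k"
  proof (cases "k \<in> \<Lambda>")
    case True
    then show ?thesis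
      using c'(2) integral_spectral_measure(2)[OF p q _ True, of \<nu>]
      by (simp add: singular_part_for_def has_moments_def)
  next
    case False
    then show ?thesis
      using c'(1) dual_boundary_hermitian by (auto simp: hermitian_def residual_moments_def)
  qed
qed

lemma singular_part_exists:
  assumes p: "p \<in> nonneg_polys \<Lambda>" and q: "dual_minimizer c p q" and c: "c \<in> dual_cone \<Lambda>"
  obtains \<nu> where "singular_part_for \<Lambda> c p q (residual_moments c p q) \<nu>"
    "finite (measure_supp \<nu>)" "card (measure_supp \<nu>) \<le> card \<Lambda> - 1"
proof -
  let ?r = "residual_moments c p q"
  have herm: "?r \<in> hermitian \<Lambda>" by (rule residual_moments_hermitian[OF dual_coneD[OF c]])
  have q': "q \<in> nonneg_polys \<Lambda>" "q \<noteq> (\<lambda>_. 0)" using q by (auto simp: dual_minimizer_def)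
  have "pairing \<Lambda> ?r u \<ge> 0" if "u \<in> hermitian \<Lambda>" "\<And>\<theta>. \<theta> \<in> torus \<Longrightarrow> trig_poly \<Lambda> u \<theta> \<ge> 0" for u
  proof -
    have "u \<in> nonneg_polys \<Lambda>" using that by (simp add: nonneg_polys_iff[OF finite_freq zero_freq])
    then show ?thesis using minimizer_variation(2)[OF p q, of u] by (simp add: pairing_residual_moments[OF p q])
  qed
  then obtain n :: nat and a \<theta> where a: "\<And>j. j < n \<Longrightarrow> a j \<ge> 0" and \<theta>: "\<And>j. j < n \<Longrightarrow> \<theta> j \<in> torus"
    and rep: "\<And>k. k \<in> \<Lambda> \<Longrightarrow> ?r k = (\<Sum>j<n. of_real (a j) * cis (phase k (\<theta> j)))"
    using moment_representation[OF herm] by blast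
  \<comment> \<open>This sum of nonnegative terms vanishes, so every atom with positive mass sits at
    a zero of \<open>Q\<close>.\<close>
  have "(\<Sum>j<n. a j * trig_poly \<Lambda> q (\<theta> j)) = pairing \<Lambda> ?r q"
    unfolding pairing_moments[symmetric] by (intro pairing_cong) (simp_all add: rep)
  also have "\<dots> = 0" by (rule pairing_residual_minimizer[OF p q])
  finally have "\<forall>j\<in>{..<n}. a j * trig_poly \<Lambda> q (\<theta> j) = 0"
    using a \<theta> nonneg_polysD(2)[OF q'(1)] by (subst (asm) sum_nonneg_eq_0_iff) auto
  then have zero: "a j = 0 \<or> trig_poly \<Lambda> q (\<theta> j) = 0" if "j < n" for j
    using that by auto
  define J where "J = {j. j < n \<and> a j \<noteq> 0}"
  have J: "finite J" "\<And>j. j \<in> J \<Longrightarrow> a j \<ge> 0" "\<And>j. j \<in> J \<Longrightarrow> trig_poly \<Lambda> q (\<theta> j) = 0"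
    using a zero by (auto simp: J_def)
  have rep_J: "?r k = (\<Sum>j\<in>J. of_real (a j) * cis (phase k (\<theta> j)))" if "k \<in> \<Lambda>" for k
    unfolding rep[OF that] by (rule sum.mono_neutral_right) (auto simp: J_def)
  have "\<exists>J' a'. J' \<subseteq> J \<and> card J' \<le> card \<Lambda> - 1 \<and> (\<forall>j\<in>J'. a' j > 0) \<and>
    (\<forall>k\<in>\<Lambda>. (\<Sum>j\<in>J'. of_real (a' j) * cis (phase k (\<theta> j))) = (\<Sum>j\<in>J. of_real (a j) * cis (phase k (\<theta> j))))"
    using J nonneg_polysD(1)[OF q'(1)] q'(2) by (intro moments_caratheodory_orthogonal[where q = q])
  then obtain J' a' where J': "J' \<subseteq> J" "card J' \<le> card \<Lambda> - 1" "\<forall>j\<in>J'. a' j > 0"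
    and rep': "\<forall>k\<in>\<Lambda>. (\<Sum>j\<in>J'. of_real (a' j) * cis (phase k (\<theta> j))) = (\<Sum>j\<in>J. of_real (a j) * cis (phase k (\<theta> j)))"
    by (elim exE conjE)
  have fin: "finite J'" using J'(1) J(1) by (rule finite_subset)
  have tor: "\<theta> j \<in> torus" if "j \<in> J'" for j using that J'(1) \<theta> by (auto simp: J_def)
  define \<nu> where "\<nu> = atomic_measure J' a' \<theta>"
  have \<nu>: "\<nu> \<in> bounded_measures" unfolding \<nu>_def by (rule atomic_measure_bounded[OF fin tor])
  have supp: "measure_supp \<nu> \<subseteq> \<theta> ` J'" unfolding \<nu>_def by (rule measure_supp_atomic_measure[OF fin tor])
  have mom: "(LINT \<phi>|\<nu>. cis (phase k \<phi>)) = ?r k" if "k \<in> \<Lambda>" for k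
  proof -
    have "(LINT \<phi>|\<nu>. cis (phase k \<phi>)) = (\<Sum>j\<in>J'. of_real (a' j) * cis (phase k (\<theta> j)))"
      unfolding \<nu>_def using J'(3) by (intro integral_atomic_measure fin tor measurable_cis_phase) (auto simp: less_imp_le)
    then show ?thesis using rep' rep_J that by simp
  qed
  have "singular_measure \<nu>" unfolding \<nu>_def by (rule singular_atomic_measure[OF fin tor])
  moreover have "measure_supp \<nu> \<subseteq> {\<theta>\<in>torus. trig_poly \<Lambda> q \<theta> = 0}"
    using supp tor J(3) J'(1) by blast
  ultimately have "singular_part_for \<Lambda> c p q ?r \<nu>"
    using \<nu> mom integral_spectral_measure[OF p q \<nu>] by (simp add: singular_part_for_def has_moments_def)
  moreover have "finite (measure_supp \<nu>)" using supp fin by (rule finite_subset[OF _ finite_imageI])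
  moreover have "card (measure_supp \<nu>) \<le> card \<Lambda> - 1"
    using card_mono[OF finite_imageI[OF fin] supp] card_image_le[OF fin, of \<theta>] J'(2) by simp
  ultimately show ?thesis by (rule that)
qed

text \<open>Weak duality: the pointwise bound is \<open>ln u \<le> u - 1\<close> at
  \<open>u = \<Phi> Q / P\<close>. The extra term integrates to something nonpositive, because the
  singular part of \<open>\<mu>\<close> only adds to the integral of \<open>Q\<close>, whose total
  is the integral of \<open>P\<close>. For \<open>P / Q\<close> itself the bound is
  attained.\<close>

lemma spectral_measure_optimal:
  assumes p: "p \<in> nonneg_polys \<Lambda>" "p \<noteq> (\<lambda>_. 0)" and q: "dual_minimizer c p q"
    and \<nu>: "\<nu> \<in> bounded_measures" "singular_measure \<nu>" and \<mu>: "has_moments \<Lambda> \<mu> c"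
  shows "primal_functional \<Lambda> p \<mu> \<le> primal_functional \<Lambda> p (spectral_measure \<Lambda> p q \<nu>)"
proof -
  let ?m = "torus_measure :: (real ^ 'd) measure" and ?T = "trig_poly \<Lambda>"
  let ?w = "\<lambda>\<theta>. ?T p \<theta> / ?T q \<theta>"
  have q': "q \<in> nonneg_polys \<Lambda>" "q \<noteq> (\<lambda>_. 0)" and cq: "pairing \<Lambda> c q = (LINT \<theta>|?m. ?T p \<theta>)"
    using q by (auto simp: dual_minimizer_def)
  have pos: "AE \<theta> in ?m. ?T p \<theta> > 0 \<and> ?T q \<theta> > 0"
    using AE_trig_poly_pos[OF p] AE_trig_poly_pos[OF q'] by eventually_elim simp
  have int_w: "integrable ?m (\<lambda>\<theta>. ?T p \<theta> * ln (?T p \<theta>) - ?T p \<theta> * ln (?T q \<theta>))"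
    using integrable_entropy[OF p] integrable_entropy[OF q'] by simp
  let ?I = "LINT \<theta>|?m. ?T p \<theta> * ln (?T p \<theta>) - ?T p \<theta> * ln (?T q \<theta>)"
  have "primal_functional \<Lambda> p (spectral_measure \<Lambda> p q \<nu>) = ereal ?I"
    unfolding primal_functional_def
  proof (rule ext_integral_eq_integral[OF int_w])
    obtain \<nu>' where dec: "lebesgue_decomp (spectral_measure \<Lambda> p q \<nu>) (ac_density (spectral_measure \<Lambda> p q \<nu>)) \<nu>'"
      by (rule lebesgue_decomp_ac_density[OF integral_spectral_measure(1)[OF p(1) q \<nu>(1)]])
    have "AE \<theta> in ?m. ennreal (?w \<theta>) = ennreal (ac_density (spectral_measure \<Lambda> p q \<nu>) \<theta>)"
    proof (rule density_eq_if_singular_rests)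
      show "measure_add (density ?m (\<lambda>\<theta>. ennreal (?w \<theta>))) \<nu> =
          measure_add (density ?m (\<lambda>\<theta>. ennreal (ac_density (spectral_measure \<Lambda> p q \<nu>) \<theta>))) \<nu>'"
        using dec by (simp add: lebesgue_decomp_def spectral_measure_def)
    qed (use dec \<nu> bounded_measuresD(1)[OF \<nu>(1)] in \<open>auto simp: lebesgue_decomp_def\<close>)
    then show "AE \<theta> in ?m. ereal (?T p \<theta>) * ext_ln (ac_density (spectral_measure \<Lambda> p q \<nu>) \<theta>) =
        ereal (?T p \<theta> * ln (?T p \<theta>) - ?T p \<theta> * ln (?T q \<theta>))"
      using pos
    proof eventually_elim
      case (elim \<theta>)
      then have w: "?w \<theta> > 0" by simp
      moreover have "ac_density (spectral_measure \<Lambda> p q \<nu>) \<theta> \<ge> 0"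
        using dec by (simp add: lebesgue_decomp_def)
      ultimately have eq: "ac_density (spectral_measure \<Lambda> p q \<nu>) \<theta> = ?w \<theta>"
        using elim(1) by (simp add: ennreal_inj)
      have "ln (?w \<theta>) = ln (?T p \<theta>) - ln (?T q \<theta>)" using elim by (simp add: ln_div)
      then show ?case
        unfolding eq ext_ln_def using w by (simp add: not_le right_diff_distrib)
    qed
  qed
  moreover have "primal_functional \<Lambda> p \<mu> \<le> ereal ?I"
  proof -
    have \<mu>b: "\<mu> \<in> bounded_measures" using \<mu> by (simp add: has_moments_def)
    interpret \<mu>: finite_measure \<mu> by (rule bounded_measuresD(3)[OF \<mu>b])
    let ?\<Phi> = "ac_density \<mu>"
    obtain \<nu>' where "lebesgue_decomp \<mu> ?\<Phi> \<nu>'"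
      by (rule lebesgue_decomp_ac_density[OF \<mu>b])
    then have \<Phi> [measurable]: "?\<Phi> \<in> borel_measurable ?m" and \<Phi>0: "\<And>\<theta>. ?\<Phi> \<theta> \<ge> 0"
      and \<nu>': "sets \<nu>' = sets ?m" and \<mu>_eq: "\<mu> = measure_add (density ?m (\<lambda>\<theta>. ennreal (?\<Phi> \<theta>))) \<nu>'"
      by (auto simp: lebesgue_decomp_def)
    have T0: "?T q \<theta> \<ge> 0" if "\<theta> \<in> torus" for \<theta> using nonneg_polysD(2)[OF q'(1)] that .
    have int_q: "integrable \<mu> (?T q)"
      by (rule \<mu>.integrable_const_bound[where B = "\<Sum>k\<in>\<Lambda>. cmod (q k)"])
        (simp_all add: abs_trig_poly_le bounded_measuresD(4)[OF \<mu>b])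
    have "(\<integral>\<^sup>+\<theta>. ennreal (?\<Phi> \<theta> * ?T q \<theta>) \<partial>?m) = (\<integral>\<^sup>+\<theta>. ennreal (?T q \<theta>) \<partial>density ?m (\<lambda>\<theta>. ennreal (?\<Phi> \<theta>)))"
      using \<Phi>0 by (subst nn_integral_density) (auto simp: ennreal_mult' intro!: nn_integral_cong)
    also have "\<dots> \<le> (\<integral>\<^sup>+\<theta>. ennreal (?T q \<theta>) \<partial>\<mu>)"
      by (subst \<mu>_eq, subst nn_integral_measure_add) (simp_all add: \<nu>')
    also have "\<dots> = ennreal (LINT \<theta>|\<mu>. ?T q \<theta>)"
      using int_q T0 bounded_measuresD(2)[OF \<mu>b] by (intro nn_integral_eq_integral) auto
    also have "\<dots> = ennreal (LINT \<theta>|?m. ?T p \<theta>)"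
      by (simp add: integral_trig_poly_moments[OF \<mu>] cq)
    finally have bound: "(\<integral>\<^sup>+\<theta>. ennreal (?\<Phi> \<theta> * ?T q \<theta>) \<partial>?m) \<le> ennreal (LINT \<theta>|?m. ?T p \<theta>)" .
    have nn: "AE \<theta> in ?m. 0 \<le> ?\<Phi> \<theta> * ?T q \<theta>"
      by (rule AE_I2) (simp add: \<Phi>0 T0 space_torus_measure)
    have int_\<Phi>: "integrable ?m (\<lambda>\<theta>. ?\<Phi> \<theta> * ?T q \<theta>)"
      using nn bound by (intro integrableI_nonneg) (auto intro: le_less_trans)
    have le: "(LINT \<theta>|?m. ?\<Phi> \<theta> * ?T q \<theta>) \<le> (LINT \<theta>|?m. ?T p \<theta>)"
      using bound nn_integral_eq_integral[OF int_\<Phi> nn] integral_trig_poly_pos[OF p]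
      by (simp add: ennreal_le_iff)
    let ?g = "\<lambda>\<theta>. (?T p \<theta> * ln (?T p \<theta>) - ?T p \<theta> * ln (?T q \<theta>)) + (?\<Phi> \<theta> * ?T q \<theta> - ?T p \<theta>)"
    have int_g: "integrable ?m ?g"
      using int_w int_\<Phi> integrable_trig_poly by simp
    have "primal_functional \<Lambda> p \<mu> \<le> ext_integral ?m (\<lambda>\<theta>. ereal (?g \<theta>))"
      unfolding primal_functional_def
    proof (rule ext_integral_mono_AE)
      show "AE \<theta> in ?m. ereal (?T p \<theta>) * ext_ln (?\<Phi> \<theta>) \<le> ereal (?g \<theta>)"
        using pos
      proof eventually_elim
        case (elim \<theta>)
        show ?case
        proof (cases "?\<Phi> \<theta> = 0")
          \<comment> \<open>A vanishing density makes the left side \<open>-\<infinity>\<close>,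
            since \<open>P\<close> is positive at this point.\<close>
          case True
          then show ?thesis using elim by (simp add: ext_ln_def)
        next
          case False
          then have f: "?\<Phi> \<theta> > 0" using \<Phi>0[of \<theta>] by simp
          have "ln (?\<Phi> \<theta> * ?T q \<theta> / ?T p \<theta>) \<le> ?\<Phi> \<theta> * ?T q \<theta> / ?T p \<theta> - 1"
            using f elim by (intro ln_le_minus_one) simp
          then have "?T p \<theta> * (ln (?\<Phi> \<theta>) + ln (?T q \<theta>) - ln (?T p \<theta>)) \<le> ?T p \<theta> * (?\<Phi> \<theta> * ?T q \<theta> / ?T p \<theta> - 1)"
            using f elim by (intro mult_left_mono) (simp_all add: ln_div ln_mult)
          also have "\<dots> = ?\<Phi> \<theta> * ?T q \<theta> - ?T p \<theta>"
            using elim by (simp add: right_diff_distrib)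
          finally show ?thesis using f by (simp add: ext_ln_def algebra_simps)
        qed
      qed
    qed
    also have "\<dots> = ereal (LINT \<theta>|?m. ?g \<theta>)"
      by (rule ext_integral_eq_integral[OF int_g]) simp
    also have "(LINT \<theta>|?m. ?g \<theta>) = ?I + ((LINT \<theta>|?m. ?\<Phi> \<theta> * ?T q \<theta>) - (LINT \<theta>|?m. ?T p \<theta>))"
      using int_w int_\<Phi> integrable_trig_poly by (simp only: Bochner_Integration.integral_add Bochner_Integration.integral_diff Bochner_Integration.integrable_diff)
    also have "ereal \<dots> \<le> ereal ?I" using le by simp
    finally show ?thesis .
  qed
  ultimately show ?thesis by simp
qed

end

theorem theorem2p1:
  fixes \<Lambda> :: "(int ^ 'd::finite) set" and c p :: "int ^ 'd \<Rightarrow> complex"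
  assumes "finite \<Lambda>" and "0 \<in> \<Lambda>" and "uminus ` \<Lambda> = \<Lambda>"
    and "c \<in> dual_cone \<Lambda>" and "p \<in> nonneg_polys \<Lambda> - {\<lambda>_. 0}"
  shows "strictly_convex_on (nonneg_polys \<Lambda>) (dual_functional \<Lambda> c p) \<and>
    (\<exists>q. q \<in> nonneg_polys \<Lambda> - {\<lambda>_. 0} \<and>
      is_arg_min (dual_functional \<Lambda> c p) (\<lambda>r. r \<in> nonneg_polys \<Lambda>) q \<and>
      (\<forall>q'. is_arg_min (dual_functional \<Lambda> c p) (\<lambda>r. r \<in> nonneg_polys \<Lambda>) q' \<longrightarrow> q' = q) \<and>
      (\<exists>!c'. c' \<in> dual_boundary \<Lambda> \<and> (\<exists>\<nu>. singular_part_for \<Lambda> c p q c' \<nu>)) \<and>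
      (\<forall>c' \<nu>. c' \<in> dual_boundary \<Lambda> \<and> singular_part_for \<Lambda> c p q c' \<nu> \<longrightarrow>
        is_arg_max (primal_functional \<Lambda> p) (\<lambda>\<mu>. has_moments \<Lambda> \<mu> c) (spectral_measure \<Lambda> p q \<nu>)) \<and>
      (\<exists>c' \<nu>. c' \<in> dual_boundary \<Lambda> \<and> singular_part_for \<Lambda> c p q c' \<nu> \<and>
        finite (measure_supp \<nu>) \<and> card (measure_supp \<nu>) \<le> card \<Lambda> - 1))"
proof -
  interpret frequency_set \<Lambda> by unfold_locales fact+
  have c: "c \<in> dual_cone \<Lambda>" and p: "p \<in> nonneg_polys \<Lambda>" "p \<noteq> (\<lambda>_. 0)" using assms by auto
  let ?J = "dual_functional \<Lambda> c p"
  have convex: "strictly_convex_on (nonneg_polys \<Lambda>) ?J"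
    by (rule dual_functional_strictly_convex[OF p])
  obtain q where q: "dual_minimizer c p q"
    using real_dual_has_min[OF c p] by (metis dual_minimizer_def)
  have q': "q \<in> nonneg_polys \<Lambda>" "q \<noteq> (\<lambda>_. 0)"
    and q_min: "\<And>r. r \<in> nonneg_polys \<Lambda> \<Longrightarrow> r \<noteq> (\<lambda>_. 0) \<Longrightarrow> real_dual c p q \<le> real_dual c p r"
    using q by (auto simp: dual_minimizer_def)
  have min: "?J q \<le> ?J r" if "r \<in> nonneg_polys \<Lambda>" for r
  proof (cases "r = (\<lambda>_. 0)")
    case True
    then show ?thesis by (simp add: dual_functional_def)
  next
    case False
    then show ?thesis using q_min[OF that] dual_functional_eq q' that by simp
  qed
  then have arg_min: "is_arg_min ?J (\<lambda>r. r \<in> nonneg_polys \<Lambda>) q"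
    using q'(1) by (auto simp: is_arg_min_def not_less)
  have unique: "q2 = q" if q2: "is_arg_min ?J (\<lambda>r. r \<in> nonneg_polys \<Lambda>) q2" for q2
  proof (rule ccontr)
    assume ne: "q2 \<noteq> q"
    have q2': "q2 \<in> nonneg_polys \<Lambda>" "?J q2 \<le> ?J q"
      using q2 q'(1) by (auto simp: is_arg_min_def not_less)
    \<comment> \<open>The midpoint would undercut the minimum; the contradiction uses that the value
      at \<open>q\<close> is finite.\<close>
    let ?z = "\<lambda>k. of_real (1 - 1 / 2) * q k + of_real (1 / 2) * q2 k"
    have "?J ?z < ereal (1 - 1 / 2) * ?J q + ereal (1 / 2) * ?J q2"
      using convex[unfolded strictly_convex_on_def, rule_format, of q q2 "1 / 2"] q' q2' ne by auto
    also have "\<dots> \<le> ereal (1 - 1 / 2) * ?J q + ereal (1 / 2) * ?J q"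
      using q2'(2) by (intro add_left_mono ereal_mult_left_mono) auto
    also have "\<dots> = ?J q"
      using dual_functional_eq[OF q', of c p] by simp
    also have "\<dots> \<le> ?J ?z"
      using q'(1) q2'(1) by (intro min nonneg_polys_lincomb) auto
    finally show False by simp
  qed
  obtain \<nu>0 where \<nu>0: "singular_part_for \<Lambda> c p q (residual_moments c p q) \<nu>0"
    "finite (measure_supp \<nu>0)" "card (measure_supp \<nu>0) \<le> card \<Lambda> - 1"
    by (rule singular_part_exists[OF p(1) q c])
  have boundary: "residual_moments c p q \<in> dual_boundary \<Lambda>"
    by (rule residual_moments_boundary[OF c p(1) q])
  have ex1: "\<exists>!c'. c' \<in> dual_boundary \<Lambda> \<and> (\<exists>\<nu>. singular_part_for \<Lambda> c p q c' \<nu>)"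
    using boundary \<nu>0(1) singular_part_unique[OF p(1) q] by blast
  have optimal: "is_arg_max (primal_functional \<Lambda> p) (\<lambda>\<mu>. has_moments \<Lambda> \<mu> c) (spectral_measure \<Lambda> p q \<nu>)"
    if "singular_part_for \<Lambda> c p q c' \<nu>" for c' \<nu>
    using that spectral_measure_optimal[OF p q, of \<nu>]
    by (auto simp: is_arg_max_def singular_part_for_def not_less)
  show ?thesis
    using convex q' arg_min unique ex1 optimal boundary \<nu>0 by blast
qed

end
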